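(* Let $N$ be a squarefree positive integer, let $K=\mathbb{Q}(\sqrt{-N})$ with discriminant $D$, let $\Sigma$ be the Hilbert class field of $K$, and let $\Sigma_0=\Sigma\cap\mathbb{R}$ be its real subfield. Let $p$ be an odd prime with $\left(\frac{-N}{p}\right)=-1$. If $$\left(\frac{-p}{q}\right)=1 \quad\text{for every odd prime } q \text{ dividing } N,$$ then $p$ has a prime divisor $\mathfrak{p}$ of degree $1$ (over $\mathbb{Q}$) in $\Sigma_0$.
   Context: $D$ is the fundamental discriminant of the imaginary quadratic field $K$. The Hilbert class field $\Sigma$ is the maximal unramified abelian extension of $K$; it is Galois over $\mathbb{Q}$ and its real subfield $\Sigma_0$ is the fixed field of complex conjugation. A prime divisor of degree 1 in $\Sigma_0$ means a prime ideal of the ring of integers of $\Sigma_0$ over $p$ with residue degree $1$ over $\mathbb{Q}$. *)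

theory Defs
  imports
    "HOL-Algebra.Algebra"
    "HOL-Algebra.Algebraic_Closure_Type"
    "HOL-Number_Theory.Number_Theory"
begin

text \<open>
  Number fields are subfields of the complex numbers, so that \<^term>\<open>L \<inter> \<real>\<close> is the real subfield
  of such a field \<^term>\<open>L\<close>.
\<close>

abbreviation CC :: "complex ring" where
  "CC \<equiv> ring_of_type_algebra"

abbreviation field_on :: "complex set \<Rightarrow> complex ring" where
  "field_on L \<equiv> CC\<lparr>carrier := L\<rparr>"

definition number_field :: "complex set \<Rightarrow> bool" where
  "number_field L \<longleftrightarrow> subfield L CC \<and> ring.finite_dimension CC \<rat> L"

definition integer_ring :: "complex set \<Rightarrow> complex ring" where
  "integer_ring L = CC\<lparr>carrier := {x \<in> L. algebraic_int x}\<rparr>"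


subsection \<open>Galois theory of an extension \<open>L / K\<close>\<close>

definition galois_group :: "complex set \<Rightarrow> complex set \<Rightarrow> (complex \<Rightarrow> complex) monoid" where
  "galois_group K L = BijGroup L
     \<lparr>carrier := {\<sigma> \<in> Bij L. \<sigma> \<in> ring_hom (field_on L) (field_on L) \<and> (\<forall>x\<in>K. \<sigma> x = x)}\<rparr>"

definition galois_extension :: "complex set \<Rightarrow> complex set \<Rightarrow> bool" where
  "galois_extension K L \<longleftrightarrow> number_field K \<and> number_field L \<and> K \<subseteq> L \<and>
     {x \<in> L. \<forall>\<sigma>\<in>carrier (galois_group K L). \<sigma> x = x} = K"

definition abelian_extension :: "complex set \<Rightarrow> complex set \<Rightarrow> bool" where
  "abelian_extension K L \<longleftrightarrow> galois_extension K L \<and> comm_group (galois_group K L)"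


subsection \<open>Ramification and residue degree\<close>

text \<open>
  Below, \<^term>\<open>Q\<close> is a nonzero prime ideal of \<^term>\<open>integer_ring L\<close>, and the prime of
  \<^term>\<open>integer_ring K\<close> beneath it is its contraction.
\<close>

definition prime_below :: "complex set \<Rightarrow> complex set \<Rightarrow> complex set" where
  "prime_below K Q = Q \<inter> carrier (integer_ring K)"

definition ramification_index :: "complex set \<Rightarrow> complex set \<Rightarrow> complex set \<Rightarrow> nat" where
  "ramification_index K L Q =
     (GREATEST e. Idl\<^bsub>integer_ring L\<^esub> (prime_below K Q) \<subseteq> Q [^]\<^bsub>ideals_set (integer_ring L)\<^esub> e)"

text \<open>
  The residue field of \<^term>\<open>K\<close> is taken as its image in the residue field of \<^term>\<open>L\<close>.
\<close>

definition residue_degree :: "complex set \<Rightarrow> complex set \<Rightarrow> complex set \<Rightarrow> nat" where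
  "residue_degree K L Q =
     (let k = integer_ring L Quot Q
      in ring.dim k ((\<lambda>x. Q +>\<^bsub>integer_ring L\<^esub> x) ` carrier (integer_ring K)) (carrier k))"

text \<open>
  Residue fields of number fields are finite, hence perfect, so no separability condition is needed
  at the finite primes. The second conjunct says that no real place of \<^term>\<open>K\<close> becomes complex in
  \<^term>\<open>L\<close>; it is vacuous when \<^term>\<open>K\<close> is imaginary quadratic.
\<close>

definition unramified_extension :: "complex set \<Rightarrow> complex set \<Rightarrow> bool" where
  "unramified_extension K L \<longleftrightarrow>
     (\<forall>Q. primeideal Q (integer_ring L) \<and> Q \<noteq> {0} \<longrightarrow> ramification_index K L Q = 1) \<and>
     (\<forall>\<phi> \<in> ring_hom (field_on L) CC. \<phi> ` K \<subseteq> \<real> \<longrightarrow> \<phi> ` L \<subseteq> \<real>)"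

text \<open>
  Maximality is with respect to inclusion among the unramified abelian extensions inside the complex
  numbers; as these are closed under composita, the maximal one contains all others.
\<close>

definition is_hilbert_class_field :: "complex set \<Rightarrow> complex set \<Rightarrow> bool" where
  "is_hilbert_class_field K H \<longleftrightarrow>
     abelian_extension K H \<and> unramified_extension K H \<and>
     (\<forall>L. abelian_extension K L \<and> unramified_extension K L \<longrightarrow> L \<subseteq> H)"

end

(*
  No class field theory is needed. Let O be the ring of integers of \<Sigma>, A = Gal(\<Sigma>/K), \<tau> complex
  conjugation, which maps \<Sigma> to itself by maximality, and G = A \<union> A\<tau> = Gal(\<Sigma>/\<rat>). Let \<phi> \<in> G be the
  Frobenius element of a prime of O over p. It suffices that \<phi> is conjugate to \<tau>: then some prime P of O over p
  satisfies x^p = cnj x modulo P for all x in O, so P \<inter> \<Sigma>\<^sub>0 has a residue field in which x^p = x holds.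

  As A is abelian, the conjugates of \<tau> are the elements c\<tau> with c in the subgroup X of all a\<tau>a^-1\<tau>, the
  commutator subgroup of G. The field fixed by X is generated over \<rat> by square roots of integers. For this,
  one needs that \<tau> and the inertia groups, whose elements have order at most 2 modulo X because \<Sigma>/K is
  unramified, generate G modulo X; a field fixed by all of them is totally real and unramified over \<rat>, hence is
  \<rat> by Minkowski's theorem. If \<phi>\<tau> is not in X, it moves the square root of some squarefree d in \<Sigma>.
  Unramifiedness of \<Sigma>/K makes d, up to a factor -N and squares, congruent to 1 modulo 4 with all odd prime factors
  dividing N, so quadratic reciprocity and the hypothesis give (d/p) = sgn d. Thus \<phi> and \<tau> act alike
  on the square root of d, a contradiction.
*)
theory Submission
  imports Defs "Jordan_Normal_Form.Char_Poly"
begin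

hide_const (open) UnivPoly.monom UnivPoly.coeff Divisibility.prime Coset.order

section \<open>Algebraic integers\<close>

text \<open>Divisibility by a prime \<open>Q\<close> is controlled by norms instead of unique
  factorization of ideals. A polynomial with coefficients in \<open>Q\<close> has a norm whose
  coefficients are rational integers in \<open>Q\<close>, hence multiples of \<open>q\<close>; the
  Prague theorem passes this divisibility on to products of single coefficients. So the powers of
  \<open>Q\<close> intersect in 0, and \<open>Q\<close> is locally generated by one element.
  Unramifiedness enters only as the existence, for each \<open>Q\<close>, of an element of
  \<open>Q\<close> that is fixed by \<open>A\<close> and lies outside the square of
  \<open>Q\<close>. Every restriction on \<open>d\<close> is won by forcing all elements of
  \<open>Q\<close> from the quadratic field into that square; the prime 2 is the laborious case,
  since it may already ramify in K. The factor -N in \<open>d\<close> is harmless exactly because p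
  is inert in K: both the sign of -N and its symbol at p are -1. A real unramified ring has an
  integral basis of discriminant 1 or -1. Minkowski's linear forms then leave no slack, so one form
  is allowed an extra \<open>e\<close>, and a minimum over a finite set closes the gap.\<close>

inductive_set zspan :: "complex set \<Rightarrow> complex set" for U where
  zero: "0 \<in> zspan U"
| base: "u \<in> U \<Longrightarrow> u \<in> zspan U"
| add: "a \<in> zspan U \<Longrightarrow> b \<in> zspan U \<Longrightarrow> a + b \<in> zspan U"
| minus: "a \<in> zspan U \<Longrightarrow> - a \<in> zspan U"

lemma zspan_sum: "(\<And>i. i \<in> I \<Longrightarrow> f i \<in> zspan U) \<Longrightarrow> sum f I \<in> zspan U"
  by (induction I rule: infinite_finite_induct) (auto intro: zspan.zero zspan.add)

lemma zspan_nat_mult: "a \<in> zspan U \<Longrightarrow> of_nat n * a \<in> zspan U"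
  by (induction n) (auto simp: algebra_simps intro: zspan.zero zspan.add)

lemma zspan_int_mult:
  assumes "a \<in> zspan U" shows "of_int n * a \<in> zspan U"
proof (cases "n \<ge> 0")
  case True
  then show ?thesis using zspan_nat_mult[OF assms, of "nat n"] by simp
next
  case False
  then show ?thesis using zspan.minus[OF zspan_nat_mult[OF assms, of "nat (-n)"]] by simp
qed

lemma zspan_mult_closed:
  assumes "x \<in> zspan U" "\<And>u. u \<in> U \<Longrightarrow> c * u \<in> zspan V"
  shows "c * x \<in> zspan V"
  using assms(1)
  by induction (auto simp: assms(2) distrib_left intro: zspan.zero zspan.add zspan.minus)

lemma zspan_finite_coeffs:
  assumes "finite U" "x \<in> zspan U"
  obtains m :: "complex \<Rightarrow> int" where "x = (\<Sum>w\<in>U. of_int (m w) * w)"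
proof -
  have "\<exists>m :: complex \<Rightarrow> int. x = (\<Sum>w\<in>U. of_int (m w) * w)"
    using assms(2)
  proof induction
    case zero
    show ?case by (rule exI[of _ "\<lambda>_. 0"]) simp
  next
    case (base u)
    have "(\<Sum>w\<in>U. of_int (if w = u then 1 else 0) * w) = (\<Sum>w\<in>U. if w = u then u else 0)"
      by (intro sum.cong) auto
    also have "\<dots> = u" using assms(1) base by (subst sum.delta) auto
    finally show ?case by (intro exI[of _ "\<lambda>w. if w = u then 1 else 0"]) (rule sym)
  next
    case (add a b)
    then obtain m1 m2 :: "complex \<Rightarrow> int"
      where "a = (\<Sum>w\<in>U. of_int (m1 w) * w)" "b = (\<Sum>w\<in>U. of_int (m2 w) * w)" by blast
    then show ?case
      by (intro exI[of _ "\<lambda>w. m1 w + m2 w"]) (simp add: sum.distrib distrib_right)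
  next
    case (minus a)
    then obtain m :: "complex \<Rightarrow> int" where "a = (\<Sum>w\<in>U. of_int (m w) * w)" by blast
    then show ?case by (intro exI[of _ "\<lambda>w. - m w"]) (simp add: sum_negf)
  qed
  then show ?thesis using that by blast
qed

lemma of_int_floor_Re: "z \<in> \<int> \<Longrightarrow> of_int \<lfloor>Re z\<rfloor> = z"
  by (auto elim!: Ints_cases)

lemma coeff_char_poly_Ints:
  fixes A :: "complex mat"
  assumes "A \<in> carrier_mat n n" "\<And>i j. i < n \<Longrightarrow> j < n \<Longrightarrow> A $$ (i, j) \<in> \<int>"
  shows "coeff (char_poly A) k \<in> \<int>"
proof -
  define B where "B = mat n n (\<lambda>(i, j). \<lfloor>Re (A $$ (i, j))\<rfloor>)"
  have B: "B \<in> carrier_mat n n" by (simp add: B_def)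
  have "A = map_mat of_int B"
    using assms of_int_floor_Re by (intro eq_matI) (auto simp: B_def)
  then have "char_poly A = map_poly of_int (char_poly B)"
    using of_int_hom.char_poly_hom[OF B] by simp
  then show ?thesis by (simp add: coeff_map_poly)
qed

text \<open>Determinant trick: multiplication by \<open>x\<close> acts on the generators through an
  integer matrix having the vector of generators as an eigenvector, so \<open>x\<close> is a root of
  its monic characteristic polynomial. The generators may be dependent; \<open>u0\<close> only keeps
  the eigenvector nonzero.\<close>

lemma algebraic_int_zspan:
  fixes x :: complex
  assumes "finite U" "u0 \<in> U" "u0 \<noteq> 0" and ev: "\<And>u. u \<in> U \<Longrightarrow> x * u \<in> zspan U"
  shows "algebraic_int x"
proof -
  obtain us where us: "set us = U" "distinct us" using finite_distinct_list[OF assms(1)] by blast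
  define n where "n = length us"
  have "\<exists>m :: complex \<Rightarrow> int. x * u = (\<Sum>w\<in>U. of_int (m w) * w)" if "u \<in> U" for u
    using zspan_finite_coeffs[OF assms(1) ev[OF that]] by metis
  then obtain m :: "complex \<Rightarrow> complex \<Rightarrow> int"
    where m: "\<And>u. u \<in> U \<Longrightarrow> x * u = (\<Sum>w\<in>U. of_int (m u w) * w)" by metis
  define A where "A = mat n n (\<lambda>(i, j). (of_int (m (us ! i) (us ! j)) :: complex))"
  define v where "v = vec n (\<lambda>i. us ! i)"
  have A: "A \<in> carrier_mat n n" and v: "v \<in> carrier_vec n" by (simp_all add: A_def v_def)
  have bij: "bij_betw (\<lambda>i. us ! i) {0..<n} U"
    using us unfolding n_def bij_betw_def by (auto simp: inj_on_nth set_conv_nth)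
  have "A *\<^sub>v v = x \<cdot>\<^sub>v v"
  proof (rule eq_vecI)
    fix i assume i: "i < dim_vec (x \<cdot>\<^sub>v v)"
    then have i: "i < n" using v by simp
    have "(A *\<^sub>v v) $ i = (\<Sum>j\<in>{0..<n}. of_int (m (us ! i) (us ! j)) * us ! j)"
      using i by (simp add: A_def v_def scalar_prod_def)
    also have "\<dots> = (\<Sum>w\<in>U. of_int (m (us ! i) w) * w)"
      by (rule sum.reindex_bij_betw[OF bij])
    also have "\<dots> = x * us ! i"
      using m[of "us ! i"] i us n_def by auto
    finally show "(A *\<^sub>v v) $ i = (x \<cdot>\<^sub>v v) $ i" using i by (simp add: v_def)
  qed (use A v in auto)
  moreover have "v \<noteq> 0\<^sub>v n"
  proof -
    obtain i where "i < n" "us ! i = u0" using assms(2) us n_def by (metis in_set_conv_nth)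
    then have "v $ i \<noteq> 0\<^sub>v n $ i" using assms(3) by (simp add: v_def)
    then show ?thesis by metis
  qed
  ultimately have "eigenvalue A x"
    unfolding eigenvalue_def eigenvector_def using A v by auto
  then have "poly (char_poly A) x = 0" using eigenvalue_root_char_poly[OF A] by simp
  moreover have "coeff (char_poly A) k \<in> \<int>" for k
    by (rule coeff_char_poly_Ints[OF A]) (simp add: A_def)
  moreover have "monic (char_poly A)" using degree_monic_char_poly[OF A] by simp
  ultimately show ?thesis by (auto intro: algebraic_int.intros)
qed

text \<open>A single module stable under all of \<open>C\<close> serves every sum and product of its
  elements. To adjoin \<open>c\<close>, the generators are multiplied by the powers of
  \<open>c\<close> below the degree of its monic equation, which rewrites the next power.\<close>

lemma algebraic_ints_common_module:
  fixes C :: "complex set"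
  assumes "finite C" "\<And>c. c \<in> C \<Longrightarrow> algebraic_int c"
  obtains U where "finite U" "1 \<in> U" "\<And>c u. c \<in> C \<Longrightarrow> u \<in> zspan U \<Longrightarrow> c * u \<in> zspan U"
proof -
  have "\<exists>U. finite U \<and> 1 \<in> U \<and> (\<forall>c\<in>C. \<forall>u\<in>U. c * u \<in> zspan U)"
    using assms
  proof (induction C rule: finite_induct)
    case empty
    show ?case by (intro exI[of _ "{1}"]) auto
  next
    case (insert c C)
    then obtain U where U: "finite U" "1 \<in> U" "\<And>c u. c \<in> C \<Longrightarrow> u \<in> U \<Longrightarrow> c * u \<in> zspan U" by auto
    obtain p where p: "monic p" "\<And>i. coeff p i \<in> \<int>" "poly p c = 0"
      using insert.prems[of c] by (auto elim: algebraic_int.cases)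
    define n where "n = Polynomial.degree p"
    have n: "n > 0"
    proof (rule ccontr)
      assume "\<not> n > 0"
      then have "Polynomial.degree p = 0" by (simp add: n_def)
      then have "p = 1" using p(1) monic_degree_0 by blast
      then show False using p(3) by simp
    qed
    define V where "V = (\<lambda>(u, j). u * c ^ j) ` (U \<times> {..<n})"
    have Vj: "u * c ^ j \<in> zspan V" if "u \<in> zspan U" "j < n" for u j
    proof -
      have "c ^ j * w \<in> zspan V" if "w \<in> U" for w
        using that \<open>j < n\<close> by (auto simp: V_def mult.commute intro!: zspan.base)
      then show ?thesis using zspan_mult_closed[OF that(1), of "c ^ j" V] by (simp add: mult.commute)
    qed
    have cn: "c ^ n = - (\<Sum>j<n. coeff p j * c ^ j)"
    proof -
      have "0 = (\<Sum>j\<le>n. coeff p j * c ^ j)" using p(3) by (simp add: poly_altdef n_def)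
      also have "\<dots> = (\<Sum>j<n. coeff p j * c ^ j) + coeff p n * c ^ n"
        using n by (cases n) (auto simp: lessThan_Suc_atMost)
      finally show ?thesis using p(1) by (simp add: n_def eq_neg_iff_add_eq_0 add.commute)
    qed
    have "c' * v \<in> zspan V" if c': "c' \<in> insert c C" and v: "v \<in> V" for c' v
    proof -
      obtain u j where uj: "u \<in> U" "j < n" "v = u * c ^ j" using v by (auto simp: V_def)
      show ?thesis
      proof (cases "c' = c")
        case False
        then have "c' * u \<in> zspan U" using c' U(3) uj by blast
        then have "(c' * u) * c ^ j \<in> zspan V" using Vj uj by blast
        then show ?thesis by (simp add: uj mult.assoc)
      next
        case c: True
        show ?thesis
        proof (cases "Suc j < n")
          case True
          then have "u * c ^ Suc j \<in> zspan V" using Vj[OF zspan.base[OF uj(1)]] by blast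
          then show ?thesis by (simp add: uj c algebra_simps)
        next
          case False
          then have j: "Suc j = n" using uj by simp
          have "c' * v = u * c ^ Suc j" by (simp add: uj c algebra_simps)
          also have "\<dots> = - (\<Sum>j<n. coeff p j * (u * c ^ j))"
            unfolding j cn by (simp add: sum_distrib_left algebra_simps)
          also have "\<dots> \<in> zspan V"
          proof (intro zspan.minus zspan_sum)
            fix i assume "i \<in> {..<n}"
            then have "u * c ^ i \<in> zspan V" using Vj[OF zspan.base[OF uj(1)]] by simp
            moreover obtain k where "coeff p i = of_int k" using p(2)[of i] Ints_cases by blast
            ultimately show "coeff p i * (u * c ^ i) \<in> zspan V" by (simp add: zspan_int_mult)
          qed
          finally show ?thesis .
        qed
      qed
    qed
    moreover have "finite V" using U(1) by (simp add: V_def)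
    moreover have "1 \<in> V"
      unfolding V_def using U(2) n by (intro image_eqI[of _ _ "(1, 0)"]) auto
    ultimately show ?case by blast
  qed
  then show ?thesis using that zspan_mult_closed by metis
qed

lemma
  fixes x y :: complex
  assumes "algebraic_int x" "algebraic_int y"
  shows algebraic_int_plus: "algebraic_int (x + y)" and algebraic_int_times: "algebraic_int (x * y)"
proof -
  obtain U where U: "finite U" "1 \<in> U" "\<And>c u. c \<in> {x, y} \<Longrightarrow> u \<in> zspan U \<Longrightarrow> c * u \<in> zspan U"
    using algebraic_ints_common_module[of "{x, y}"] assms by auto
  have "(x + y) * u \<in> zspan U" if "u \<in> U" for u
    using U(3)[OF _ zspan.base[OF that]] by (auto simp: distrib_right intro: zspan.add)
  then show "algebraic_int (x + y)" using U by (intro algebraic_int_zspan[of U 1]) auto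
  have "(x * y) * u \<in> zspan U" if "u \<in> U" for u
    using U(3)[OF _ U(3)[OF _ zspan.base[OF that]], of x y] by (auto simp: mult.assoc)
  then show "algebraic_int (x * y)" using U by (intro algebraic_int_zspan[of U 1]) auto
qed

lemma algebraic_int_diff: "algebraic_int x \<Longrightarrow> algebraic_int y \<Longrightarrow> algebraic_int (x - y)"
  for x y :: complex
  using algebraic_int_plus[of x "-y"] by auto

lemma algebraic_int_of_int [simp]: "algebraic_int (of_int n)"
  by (rule int_imp_algebraic_int) simp

lemma algebraic_int_sum:
  fixes f :: "'i \<Rightarrow> complex"
  shows "(\<And>i. i \<in> I \<Longrightarrow> algebraic_int (f i)) \<Longrightarrow> algebraic_int (sum f I)"
  by (induction I rule: infinite_finite_induct) (auto intro: algebraic_int_plus)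

lemma algebraic_int_prod:
  fixes f :: "'i \<Rightarrow> complex"
  shows "(\<And>i. i \<in> I \<Longrightarrow> algebraic_int (f i)) \<Longrightarrow> algebraic_int (prod f I)"
  by (induction I rule: infinite_finite_induct) (auto intro: algebraic_int_times)

text \<open>The root \<open>r\<close> need not be integral. Multiplication by
  \<open>coeff h k\<close> preserves the module spanned by the \<open>u * r ^ i\<close> with
  \<open>i < n\<close>: the relations between the coefficients are solved from the top
  (\<open>up\<close>) when \<open>i \<le> k\<close> and from the bottom (\<open>low\<close>) when
  \<open>i > k\<close>, and both ways leave only exponents below \<open>n\<close>.\<close>

lemma algebraic_int_coeff_linear_cofactor:
  fixes h :: "complex poly"
  assumes "\<And>k. algebraic_int (coeff ([:- r, 1:] * h) k)"
  shows "algebraic_int (coeff h k)" "algebraic_int (r * coeff h k)"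
proof -
  define c where "c = coeff ([:- r, 1:] * h)"
  define b where "b = coeff h"
  define n where "n = Suc (Polynomial.degree h)"
  have c0: "c 0 = - r * b 0" and cS: "c (Suc j) = b j - r * b (Suc j)" for j
    by (simp_all add: c_def b_def)
  have low: "r ^ Suc k * b k = - (\<Sum>j\<le>k. c j * r ^ j)" for k
  proof (induction k)
    case 0
    show ?case by (simp add: c0)
  next
    case (Suc k)
    have "r ^ Suc (Suc k) * b (Suc k) = r ^ Suc k * b k - c (Suc k) * r ^ Suc k"
      by (simp add: cS algebra_simps)
    also have "\<dots> = - (\<Sum>j\<le>Suc k. c j * r ^ j)" by (subst Suc) simp
    finally show ?case .
  qed
  have up: "(\<Sum>a<N. c (Suc k + a) * r ^ a) = b k - r ^ N * b (k + N)" for N k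
    by (induction N) (auto simp: cS algebra_simps)
  have b0: "b j = 0" if "j \<ge> n" for j
    using that by (simp add: b_def n_def coeff_eq_0)
  define C where "C = c ` {..n}"
  have "finite C" "\<And>x. x \<in> C \<Longrightarrow> algebraic_int x" using assms by (auto simp: C_def c_def)
  then obtain U where U: "finite U" "1 \<in> U" "\<And>c u. c \<in> C \<Longrightarrow> u \<in> zspan U \<Longrightarrow> c * u \<in> zspan U"
    using algebraic_ints_common_module by blast
  have cU: "c j * u \<in> zspan U" if "u \<in> U" for j u
  proof (cases "j \<le> n")
    case True
    then show ?thesis using that U(3)[OF _ zspan.base] by (auto simp: C_def)
  next
    case False
    then obtain i where "j = Suc i" "i \<ge> n" by (cases j) auto
    then have "c j = 0" using b0 by (simp add: cS)
    then show ?thesis by (simp add: zspan.zero)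
  qed
  define W where "W = (\<lambda>(u, l). u * r ^ l) ` (U \<times> {..<n})"
  have Wl: "u * r ^ l \<in> zspan W" if "u \<in> zspan U" "l < n" for u l
  proof -
    have "r ^ l * w \<in> zspan W" if "w \<in> U" for w
      using that \<open>l < n\<close> by (auto simp: W_def mult.commute intro!: zspan.base)
    then show ?thesis using zspan_mult_closed[OF that(1), of "r ^ l" W] by (simp add: mult.commute)
  qed
  show alg: "algebraic_int (coeff h k)" for k
  proof (rule algebraic_int_zspan)
    show "finite W" using U(1) by (simp add: W_def)
    show "1 \<in> W"
      unfolding W_def using U(2) by (intro image_eqI[of _ _ "(1, 0)"]) (auto simp: n_def)
    fix w assume "w \<in> W"
    then obtain u i where w: "u \<in> U" "i < n" "w = u * r ^ i" by (auto simp: W_def)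
    show "coeff h k * w \<in> zspan W"
    proof (cases "i \<le> k")
      case True
      have "b k * w = (\<Sum>a<n - i. c (Suc k + a) * r ^ a) * w"
        using True b0[of "k + (n - i)"] w(2) by (subst up) simp
      also have "\<dots> = (\<Sum>a<n - i. (c (Suc k + a) * u) * r ^ (a + i))"
        by (simp add: w(3) sum_distrib_left sum_distrib_right algebra_simps power_add)
      also have "\<dots> \<in> zspan W" using w by (intro zspan_sum Wl cU) auto
      finally show ?thesis by (simp add: b_def)
    next
      case False
      then have i: "r ^ i = r ^ (i - Suc k) * r ^ Suc k"
        unfolding power_add[symmetric] by simp
      have "b k * w = u * r ^ (i - Suc k) * (r ^ Suc k * b k)"
        unfolding w(3) i by (simp add: algebra_simps)
      also have "\<dots> = - (\<Sum>j\<le>k. (c j * u) * r ^ (j + (i - Suc k)))"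
        unfolding low by (simp add: sum_distrib_left algebra_simps power_add)
      also have "\<dots> \<in> zspan W" using w False by (intro zspan.minus zspan_sum Wl cU) auto
      finally show ?thesis by (simp add: b_def)
    qed
  qed simp
  show "algebraic_int (r * coeff h k)"
  proof (cases k)
    case 0
    then have "r * coeff h k = - c 0" by (simp add: c0 b_def)
    moreover have "algebraic_int (- c 0)" unfolding c_def using assms by (rule algebraic_int_minus)
    ultimately show ?thesis by simp
  next
    case (Suc j)
    then have "r * coeff h k = coeff h j - c k" by (simp add: cS b_def)
    moreover have "algebraic_int (c k)" unfolding c_def by (rule assms)
    ultimately show ?thesis using alg by (simp add: algebraic_int_diff)
  qed
qed

text \<open>Dedekind's ``Prague theorem'', which replaces unique factorization of ideals below.\<close>

lemma algebraic_int_coeff_mult: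
  fixes f h :: "complex poly"
  assumes "\<And>k. algebraic_int (coeff (f * h) k)"
  shows "algebraic_int (coeff f i * coeff h j)"
  using assms
proof (induction "Polynomial.degree f" arbitrary: f h i j)
  case 0
  then obtain a where f: "f = [:a:]" by (metis degree_eq_zeroE)
  show ?case
  proof (cases i)
    case 0
    then show ?thesis using "0.prems"[of j] by (simp add: f)
  qed (simp add: f)
next
  case (Suc n)
  have "\<not> constant (poly f)" using Suc.hyps(2) by (simp add: constant_degree)
  then obtain r where "poly f r = 0" using fundamental_theorem_of_algebra by blast
  then obtain g where g: "f = [:- r, 1:] * g" by (auto simp: poly_eq_0_iff_dvd elim: dvdE)
  then have "g \<noteq> 0" using Suc.hyps(2) by auto
  then have deg: "n = Polynomial.degree g" using Suc.hyps(2) unfolding g by (subst (asm) degree_mult_eq) auto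
  \<comment> \<open>Dividing by the linear factor keeps the coefficients of \<open>g * h\<close> and
    of \<open>r * g * h\<close> integral. These two suffice, because coefficient \<open>i\<close> of
    \<open>f\<close> is coefficient \<open>i - 1\<close> of \<open>g\<close> minus \<open>r\<close>
    times coefficient \<open>i\<close> of \<open>g\<close>.\<close>
  have "algebraic_int (coeff ([:- r, 1:] * (g * h)) k)" for k
    using Suc.prems[of k] unfolding g mult.assoc .
  note * = algebraic_int_coeff_linear_cofactor[OF this]
  have 1: "algebraic_int (coeff g i * coeff h j)" for i
    by (rule Suc.hyps(1)[OF deg]) (rule *(1))
  have 2: "algebraic_int (coeff g i * coeff (Polynomial.smult r h) j)" for i
    by (rule Suc.hyps(1)[OF deg]) (use *(2) in simp)
  show ?case
  proof (cases i)
    case 0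
    then have "coeff f i * coeff h j = - (coeff g 0 * coeff (Polynomial.smult r h) j)" by (simp add: g)
    then show ?thesis using 2[of 0] by simp
  next
    case (Suc l)
    then have "coeff f i * coeff h j =
        coeff g l * coeff h j - coeff g i * coeff (Polynomial.smult r h) j"
      by (simp add: g algebra_simps)
    then show ?thesis using 1[of l] 2[of i] by (simp add: algebraic_int_diff)
  qed
qed

text \<open>The factor \<open>c\<close> collects the coefficients already picked, so that the
  induction can split off one polynomial at a time. In the applications it starts as
  \<open>1 / q\<close>, which turns integrality into divisibility by \<open>q\<close>.\<close>

lemma algebraic_int_prod_coeffs:
  fixes f :: "'i \<Rightarrow> complex poly"
  assumes "finite I" "\<And>k. algebraic_int (c * coeff (\<Prod>i\<in>I. f i) k)"
  shows "algebraic_int (c * (\<Prod>i\<in>I. coeff (f i) (k i)))"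
  using assms
proof (induction I arbitrary: c rule: finite_induct)
  case empty
  then show ?case using empty.prems[of 0] by simp
next
  case (insert x I)
  have "algebraic_int (coeff (Polynomial.smult c (f x) * (\<Prod>i\<in>I. f i)) k)" for k
    using insert.prems[of k] insert.hyps by simp
  from algebraic_int_coeff_mult[OF this, of "k x"]
  have "algebraic_int ((c * coeff (f x) (k x)) * coeff (\<Prod>i\<in>I. f i) j)" for j by simp
  from insert.IH[OF this] insert.hyps show ?case by (simp add: mult.assoc)
qed

section \<open>Finite groups acting on rings\<close>

text \<open>Subrings, ideals and primes are plain sets in a ring given by its type, so that the same
  notions apply to polynomials over \<open>R\<close> and to polynomials over those.\<close>

definition is_subring :: "'a::comm_ring_1 set \<Rightarrow> bool" where
  "is_subring R \<longleftrightarrow> 0 \<in> R \<and> 1 \<in> R \<and> (\<forall>x\<in>R. - x \<in> R) \<and>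
     (\<forall>x\<in>R. \<forall>y\<in>R. x + y \<in> R \<and> x * y \<in> R)"

definition is_ideal :: "'a::comm_ring_1 set \<Rightarrow> 'a set \<Rightarrow> bool" where
  "is_ideal R Q \<longleftrightarrow> Q \<subseteq> R \<and> 0 \<in> Q \<and> (\<forall>x\<in>Q. \<forall>y\<in>Q. x + y \<in> Q) \<and> (\<forall>x\<in>R. \<forall>y\<in>Q. x * y \<in> Q)"

definition is_prime :: "'a::comm_ring_1 set \<Rightarrow> 'a set \<Rightarrow> bool" where
  "is_prime R Q \<longleftrightarrow> is_ideal R Q \<and> 1 \<notin> Q \<and> (\<forall>x\<in>R. \<forall>y\<in>R. x * y \<in> Q \<longrightarrow> x \<in> Q \<or> y \<in> Q)"

text \<open>Homomorphisms from \<open>R\<close> to \<open>R / Q\<close>, represented by maps of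
  \<open>R\<close> into itself; for \<open>Q = {0}\<close> they are the endomorphisms of
  \<open>R\<close>. The equation \<open>f 0 = 0\<close> is exact, not only modulo \<open>Q\<close>,
  so that \<open>map_poly f\<close> acts coefficientwise.\<close>

definition hom_mod :: "'a::comm_ring_1 set \<Rightarrow> 'a set \<Rightarrow> ('a \<Rightarrow> 'a) \<Rightarrow> bool" where
  "hom_mod R Q f \<longleftrightarrow> f 0 = 0 \<and> f 1 - 1 \<in> Q \<and> (\<forall>x\<in>R. f x \<in> R) \<and>
     (\<forall>x\<in>R. \<forall>y\<in>R. f (x + y) - (f x + f y) \<in> Q \<and> f (x * y) - f x * f y \<in> Q)"

definition polys :: "'a::comm_ring_1 set \<Rightarrow> 'a poly set" where
  "polys R = {p. \<forall>i. coeff p i \<in> R}"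

lemma is_subringD:
  assumes "is_subring R"
  shows "0 \<in> R" "1 \<in> R" "x \<in> R \<Longrightarrow> - x \<in> R" "x \<in> R \<Longrightarrow> y \<in> R \<Longrightarrow> x + y \<in> R"
    "x \<in> R \<Longrightarrow> y \<in> R \<Longrightarrow> x * y \<in> R" "x \<in> R \<Longrightarrow> y \<in> R \<Longrightarrow> x - y \<in> R"
proof -
  show "x \<in> R \<Longrightarrow> y \<in> R \<Longrightarrow> x - y \<in> R"
    using assms unfolding is_subring_def by (metis diff_conv_add_uminus)
qed (use assms in \<open>auto simp: is_subring_def\<close>)

lemma is_subring_sum: "is_subring R \<Longrightarrow> (\<And>i. i \<in> I \<Longrightarrow> f i \<in> R) \<Longrightarrow> sum f I \<in> R"
  by (induction I rule: infinite_finite_induct) (auto simp: is_subringD)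

lemma is_subring_prod: "is_subring R \<Longrightarrow> (\<And>i. i \<in> I \<Longrightarrow> f i \<in> R) \<Longrightarrow> prod f I \<in> R"
  by (induction I rule: infinite_finite_induct) (auto simp: is_subringD)

lemma is_subring_power: "is_subring R \<Longrightarrow> x \<in> R \<Longrightarrow> x ^ n \<in> R"
  by (induction n) (auto simp: is_subringD)

lemma is_subring_of_nat: "is_subring R \<Longrightarrow> of_nat n \<in> R"
  by (induction n) (auto simp: is_subringD)

lemma is_subring_of_int: "is_subring R \<Longrightarrow> of_int n \<in> R"
  by (cases n) (auto simp: is_subringD is_subring_of_nat simp del: of_nat_Suc)

lemma is_idealD:
  assumes "is_ideal R Q"
  shows "x \<in> Q \<Longrightarrow> x \<in> R" "0 \<in> Q" "x \<in> Q \<Longrightarrow> y \<in> Q \<Longrightarrow> x + y \<in> Q"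
    "x \<in> R \<Longrightarrow> y \<in> Q \<Longrightarrow> x * y \<in> Q" "x \<in> R \<Longrightarrow> y \<in> Q \<Longrightarrow> y * x \<in> Q"
  using assms by (auto simp: is_ideal_def mult.commute)

lemma is_ideal_minus: "is_subring R \<Longrightarrow> is_ideal R Q \<Longrightarrow> x \<in> Q \<Longrightarrow> - x \<in> Q"
  using is_idealD(4)[of R Q "-1" x] is_subringD[of R] by simp

lemma is_ideal_diff: "is_subring R \<Longrightarrow> is_ideal R Q \<Longrightarrow> x \<in> Q \<Longrightarrow> y \<in> Q \<Longrightarrow> x - y \<in> Q"
  using is_idealD(3)[of R Q x "-y"] is_ideal_minus[of R Q y] by simp

lemma is_ideal_sum: "is_ideal R Q \<Longrightarrow> (\<And>i. i \<in> I \<Longrightarrow> f i \<in> Q) \<Longrightarrow> sum f I \<in> Q"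
  by (induction I rule: infinite_finite_induct) (auto simp: is_idealD)

lemma is_ideal_trans_diff:
  assumes "is_subring R" "is_ideal R Q" "x - y \<in> Q" "y - z \<in> Q"
  shows "x - z \<in> Q"
  using is_idealD(3)[OF assms(2-4)] by simp

lemma is_ideal_cong:
  assumes "is_subring R" "is_ideal R Q" "x - y \<in> Q"
  shows "x \<in> Q \<longleftrightarrow> y \<in> Q"
  using is_idealD(3)[OF assms(2,3), of y] is_ideal_diff[OF assms(1,2) _ assms(3), of x] by auto

lemma is_prime_ideal: "is_prime R Q \<Longrightarrow> is_ideal R Q"
  by (simp add: is_prime_def)

lemma is_prime_prod:
  assumes "is_subring R" "is_prime R Q" "finite I" "\<And>i. i \<in> I \<Longrightarrow> f i \<in> R" "prod f I \<in> Q"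
  shows "\<exists>i\<in>I. f i \<in> Q"
  using assms(3-5)
proof (induction I rule: finite_induct)
  case (insert x F)
  then show ?case using assms(2) is_subring_prod[OF assms(1), of F f] by (auto simp: is_prime_def)
qed (use assms(2) in \<open>auto simp: is_prime_def\<close>)

lemma is_prime_power:
  assumes "is_subring R" "is_prime R Q" "x \<in> R" "x ^ n \<in> Q"
  shows "x \<in> Q"
  using is_prime_prod[OF assms(1,2), of "{..<n}" "\<lambda>_. x"] assms by auto

lemma is_subring_polys: "is_subring R \<Longrightarrow> is_subring (polys R)"
proof -
  assume R: "is_subring R"
  have "coeff (x * y) i \<in> R" if "x \<in> polys R" "y \<in> polys R" for x y i
    unfolding coeff_mult using that by (intro is_subring_sum[OF R] is_subringD(5)[OF R]) (auto simp: polys_def)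
  then show ?thesis
    using is_subringD(1-4)[OF R] unfolding is_subring_def[of "polys R"]
    by (auto simp: polys_def coeff_1)
qed

lemma is_ideal_polys: "is_ideal R Q \<Longrightarrow> is_ideal (polys R) (polys Q)"
proof -
  assume Q: "is_ideal R Q"
  have "coeff (x * y) i \<in> Q" if "x \<in> polys R" "y \<in> polys Q" for x y i
    unfolding coeff_mult using that by (intro is_ideal_sum[OF Q] is_idealD(4)[OF Q]) (auto simp: polys_def)
  then show ?thesis
    using is_idealD(1-3)[OF Q] unfolding is_ideal_def[of "polys R"] by (auto simp: polys_def)
qed

text \<open>Gauss's argument: for the lowest coefficients of the two factors outside
  \<open>Q\<close>, at \<open>i\<close> and \<open>j\<close>, all other terms of the coefficient at
  \<open>i + j\<close> lie in \<open>Q\<close>.\<close>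

lemma is_prime_polys:
  assumes "is_subring R" "is_prime R Q"
  shows "is_prime (polys R) (polys Q)"
proof -
  note id = is_prime_ideal[OF assms(2)]
  have "x \<in> polys Q \<or> y \<in> polys Q" if x: "x \<in> polys R" and y: "y \<in> polys R" and xy: "x * y \<in> polys Q" for x y
  proof (rule ccontr)
    assume "\<not> ?thesis"
    then have ex: "\<exists>i. coeff x i \<notin> Q" "\<exists>j. coeff y j \<notin> Q" by (auto simp: polys_def)
    define i where "i = (LEAST i. coeff x i \<notin> Q)"
    define j where "j = (LEAST j. coeff y j \<notin> Q)"
    have i: "coeff x i \<notin> Q" "\<And>l. l < i \<Longrightarrow> coeff x l \<in> Q"
      using LeastI_ex[OF ex(1)] not_less_Least unfolding i_def by blast+
    have j: "coeff y j \<notin> Q" "\<And>l. l < j \<Longrightarrow> coeff y l \<in> Q"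
      using LeastI_ex[OF ex(2)] not_less_Least unfolding j_def by blast+
    have "coeff (x * y) (i + j) = coeff x i * coeff y j +
        (\<Sum>l\<in>{..i+j}-{i}. coeff x l * coeff y (i + j - l))"
      unfolding coeff_mult by (subst sum.remove[of _ i]) auto
    moreover have "(\<Sum>l\<in>{..i+j}-{i}. coeff x l * coeff y (i + j - l)) \<in> Q" (is "?S \<in> Q")
    proof (rule is_ideal_sum[OF id])
      fix l assume l: "l \<in> {..i+j}-{i}"
      show "coeff x l * coeff y (i + j - l) \<in> Q"
      proof (cases "l < i")
        case True
        then show ?thesis using i(2) y by (intro is_idealD(5)[OF id]) (auto simp: polys_def)
      next
        case False
        then show ?thesis using j(2) x l by (intro is_idealD(4)[OF id]) (auto simp: polys_def)
      qed
    qed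
    moreover have "coeff (x * y) (i + j) \<in> Q" using xy by (auto simp: polys_def)
    ultimately have "coeff x i * coeff y j + ?S - ?S \<in> Q"
      by (intro is_ideal_diff[OF assms(1) id]) simp_all
    then have "coeff x i * coeff y j \<in> Q" by simp
    then show False using i(1) j(1) x y assms(2) by (auto simp: is_prime_def polys_def)
  qed
  moreover have "1 \<notin> polys Q"
    using assms(2) by (auto simp: polys_def is_prime_def intro!: exI[of _ 0])
  ultimately show ?thesis using is_ideal_polys[OF id] by (auto simp: is_prime_def[of "polys R"])
qed

lemma hom_modD:
  assumes "hom_mod R Q f"
  shows "f 0 = 0" "f 1 - 1 \<in> Q" "x \<in> R \<Longrightarrow> f x \<in> R"
    "x \<in> R \<Longrightarrow> y \<in> R \<Longrightarrow> f (x + y) - (f x + f y) \<in> Q"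
    "x \<in> R \<Longrightarrow> y \<in> R \<Longrightarrow> f (x * y) - f x * f y \<in> Q"
  using assms unfolding hom_mod_def by blast+

lemma hom_mod_sum:
  assumes "is_subring R" "is_ideal R Q" "hom_mod R Q f" "\<And>i. i \<in> I \<Longrightarrow> x i \<in> R"
  shows "f (\<Sum>i\<in>I. x i) - (\<Sum>i\<in>I. f (x i)) \<in> Q"
  using assms(4)
proof (induction I rule: infinite_finite_induct)
  case (insert a I)
  then have "f (x a + sum x I) - (f (x a) + f (sum x I)) \<in> Q"
    by (intro hom_modD(4)[OF assms(3)] is_subring_sum[OF assms(1)]) auto
  moreover have "f (sum x I) - (\<Sum>i\<in>I. f (x i)) \<in> Q" using insert by auto
  ultimately have "f (x a + sum x I) - (f (x a) + f (sum x I)) + (f (sum x I) - (\<Sum>i\<in>I. f (x i))) \<in> Q"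
    using is_idealD(3)[OF assms(2)] by blast
  then show ?case using insert by (simp add: algebra_simps)
qed (use hom_modD[OF assms(3)] is_idealD[OF assms(2)] in auto)

lemma is_ideal_mult_cong:
  assumes "is_subring R" "is_ideal R Q" "x - x' \<in> Q" "y - y' \<in> Q" "x' \<in> R" "y \<in> R"
  shows "x * y - x' * y' \<in> Q"
proof -
  have "x * y - x' * y' = (x - x') * y + x' * (y - y')" by (simp add: algebra_simps)
  then show ?thesis using is_idealD[OF assms(2)] assms by metis
qed

lemma is_ideal_power_cong:
  assumes "is_subring R" "is_ideal R Q" "x - y \<in> Q" "x \<in> R" "y \<in> R"
  shows "x ^ n - y ^ n \<in> Q"
  by (induction n) (use assms in \<open>auto intro!: is_ideal_mult_cong is_subring_power is_idealD(2)\<close>)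

lemma hom_mod_power:
  assumes "is_subring R" "is_ideal R Q" "hom_mod R Q f" "x \<in> R"
  shows "f (x ^ n) - f x ^ n \<in> Q"
proof (induction n)
  case (Suc n)
  have "f (x * x ^ n) - f x * f (x ^ n) \<in> Q"
    by (intro hom_modD(5)[OF assms(3)] is_subring_power[OF assms(1)] assms(4))
  moreover have "f x * (f (x ^ n) - f x ^ n) \<in> Q"
    using Suc hom_modD(3)[OF assms(3,4)] is_idealD(4)[OF assms(2)] by blast
  ultimately have "f (x * x ^ n) - f x * f (x ^ n) + f x * (f (x ^ n) - f x ^ n) \<in> Q"
    using is_idealD(3)[OF assms(2)] by blast
  moreover have "f (x * x ^ n) - f x * f (x ^ n) + f x * (f (x ^ n) - f x ^ n) = f (x ^ Suc n) - f x ^ Suc n"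
    by (simp add: right_diff_distrib)
  ultimately show ?case by metis
qed (simp add: hom_modD(2)[OF assms(3)])

lemma hom_mod_polys:
  assumes "is_subring R" "is_ideal R Q" "hom_mod R Q f"
  shows "hom_mod (polys R) (polys Q) (map_poly f)"
proof -
  have co: "coeff (map_poly f p) i = f (coeff p i)" for p i
    by (simp add: coeff_map_poly hom_modD[OF assms(3)])
  have "map_poly f 1 - 1 \<in> polys Q"
    using hom_modD[OF assms(3)] is_idealD(2)[OF assms(2)] by (auto simp: polys_def co coeff_1)
  moreover have "map_poly f (x * y) - map_poly f x * map_poly f y \<in> polys Q"
    if x: "x \<in> polys R" and y: "y \<in> polys R" for x y
  proof -
    have "f (\<Sum>i\<le>k. coeff x i * coeff y (k - i)) - (\<Sum>i\<le>k. f (coeff x i) * f (coeff y (k - i))) \<in> Q" for k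
    proof (rule is_ideal_trans_diff[OF assms(1,2)])
      show "f (\<Sum>i\<le>k. coeff x i * coeff y (k - i)) - (\<Sum>i\<le>k. f (coeff x i * coeff y (k - i))) \<in> Q"
        using x y by (intro hom_mod_sum[OF assms]) (auto simp: polys_def is_subringD[OF assms(1)])
      show "(\<Sum>i\<le>k. f (coeff x i * coeff y (k - i))) - (\<Sum>i\<le>k. f (coeff x i) * f (coeff y (k - i))) \<in> Q"
        unfolding sum_subtractf[symmetric] using x y
        by (intro is_ideal_sum[OF assms(2)] hom_modD(5)[OF assms(3)]) (auto simp: polys_def)
    qed
    then show ?thesis by (auto simp: polys_def co coeff_mult)
  qed
  ultimately show ?thesis
    using hom_modD[OF assms(3)] by (auto simp: hom_mod_def polys_def co)
qed

lemma is_ideal_0: "is_subring R \<Longrightarrow> is_ideal R {0}"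
  by (auto simp: is_ideal_def is_subring_def)

lemma is_prime_0: "is_subring R \<Longrightarrow> is_prime R {0}" for R :: "'a::idom set"
  by (auto simp: is_prime_def is_ideal_0)

lemma polys_0: "polys {0} = {0}"
  by (auto simp: polys_def poly_eq_iff)

lemma hom_mod_0_minus:
  assumes "is_subring R" "hom_mod R {0} f" "x \<in> R"
  shows "f (- x) = - f x"
  using hom_modD(4)[OF assms(2), of x "-x"] hom_modD(1)[OF assms(2)] assms is_subringD(3)[OF assms(1)]
  by (simp add: eq_neg_iff_add_eq_0 add.commute)

lemma hom_mod_0_prod:
  assumes "is_subring R" "hom_mod R {0} f" "\<And>i. i \<in> I \<Longrightarrow> x i \<in> R"
  shows "f (\<Prod>i\<in>I. x i) = (\<Prod>i\<in>I. f (x i))"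
  using assms(3)
proof (induction I rule: infinite_finite_induct)
  case (insert a I)
  then have "f (x a * prod x I) - (f (x a) * f (prod x I)) \<in> {0}"
    by (intro hom_modD(5)[OF assms(2)] is_subring_prod[OF assms(1)]) auto
  then show ?case using insert by simp
qed (use hom_modD[OF assms(2)] in auto)

text \<open>The condition \<open>outside\<close> makes an element of \<open>G\<close> determined by
  its values on \<open>R\<close>, so that group identities are plain equations between
  functions.\<close>

locale ring_action =
  fixes R :: "'a::idom set" and G :: "('a \<Rightarrow> 'a) set"
  assumes subring: "is_subring R"
    and fin: "finite G"
    and id_mem: "id \<in> G"
    and comp_mem: "g \<in> G \<Longrightarrow> h \<in> G \<Longrightarrow> g \<circ> h \<in> G"
    and inverse_ex: "g \<in> G \<Longrightarrow> \<exists>h\<in>G. h \<circ> g = id \<and> g \<circ> h = id"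
    and hom: "g \<in> G \<Longrightarrow> hom_mod R {0} g"
    and outside: "g \<in> G \<Longrightarrow> x \<notin> R \<Longrightarrow> g x = x"
begin

lemma action_closed: "g \<in> G \<Longrightarrow> x \<in> R \<Longrightarrow> g x \<in> R"
  and action_add: "g \<in> G \<Longrightarrow> x \<in> R \<Longrightarrow> y \<in> R \<Longrightarrow> g (x + y) = g x + g y"
  and action_mult: "g \<in> G \<Longrightarrow> x \<in> R \<Longrightarrow> y \<in> R \<Longrightarrow> g (x * y) = g x * g y"
  and action_0: "g \<in> G \<Longrightarrow> g 0 = 0"
  and action_1: "g \<in> G \<Longrightarrow> g 1 = 1"
  and action_minus: "g \<in> G \<Longrightarrow> x \<in> R \<Longrightarrow> g (- x) = - g x"
  using hom_modD[OF hom] hom_mod_0_minus[OF subring hom] by auto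

lemma action_diff: "g \<in> G \<Longrightarrow> x \<in> R \<Longrightarrow> y \<in> R \<Longrightarrow> g (x - y) = g x - g y"
  using action_add[of g x "-y"] action_minus[of g y] is_subringD(3)[OF subring, of y] by simp

lemma action_power: "g \<in> G \<Longrightarrow> x \<in> R \<Longrightarrow> g (x ^ n) = g x ^ n"
  by (induction n) (auto simp: action_1 action_mult is_subring_power[OF subring])

lemma action_prod:
  "g \<in> G \<Longrightarrow> (\<And>i. i \<in> I \<Longrightarrow> f i \<in> R) \<Longrightarrow> g (\<Prod>i\<in>I. f i) = (\<Prod>i\<in>I. g (f i))"
  by (rule hom_mod_0_prod[OF subring hom])

lemma action_sum:
  "g \<in> G \<Longrightarrow> (\<And>i. i \<in> I \<Longrightarrow> f i \<in> R) \<Longrightarrow> g (\<Sum>i\<in>I. f i) = (\<Sum>i\<in>I. g (f i))"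
  using hom_mod_sum[OF subring is_ideal_0[OF subring] hom, of g I f] by simp

lemma action_of_nat: "g \<in> G \<Longrightarrow> g (of_nat n) = of_nat n"
  by (induction n) (auto simp: action_0 action_1 action_add is_subringD[OF subring] is_subring_of_nat[OF subring])

lemma action_of_int: "g \<in> G \<Longrightarrow> g (of_int n) = of_int n"
  using action_of_nat[of g "nat n"] action_of_nat[of g "nat (- n)"]
    action_minus[of g "of_nat (nat (- n))"] is_subring_of_nat[OF subring, of "nat (- n)"]
  by (cases "n \<ge> 0") auto

lemma action_inj: "g \<in> G \<Longrightarrow> g x = g y \<Longrightarrow> x = y"
  using inverse_ex[of g] by (metis comp_apply id_apply)

lemma bij_left_mult: "h \<in> G \<Longrightarrow> bij_betw (\<lambda>g. h \<circ> g) G G"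
proof -
  assume h: "h \<in> G"
  obtain k where k: "k \<in> G" "k \<circ> h = id" "h \<circ> k = id" using inverse_ex[OF h] by blast
  show ?thesis
    by (rule bij_betw_byWitness[of _ "\<lambda>g. k \<circ> g"])
      (use h k in \<open>auto simp: comp_mem simp flip: comp_assoc\<close>)
qed

definition fixed :: "'a set" where "fixed = {x \<in> R. \<forall>g\<in>G. g x = x}"

text \<open>The norm of a polynomial. Left multiplication permutes the factors, which makes the
  coefficients invariant, and the factor for \<open>id\<close> is \<open>w\<close> itself, which
  keeps the product in every ideal containing the coefficients of \<open>w\<close>.\<close>

lemma poly_orbit_prod:
  assumes "w \<in> polys R"
  defines "P \<equiv> \<Prod>g\<in>G. map_poly g w"
  shows "P \<in> polys fixed" "\<And>Q. is_ideal R Q \<Longrightarrow> w \<in> polys Q \<Longrightarrow> P \<in> polys Q"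
proof -
  note sp = is_subring_polys[OF subring]
  have hp: "hom_mod (polys R) {0} (map_poly h)" if "h \<in> G" for h
    using hom_mod_polys[OF subring is_ideal_0[OF subring] hom[OF that]] by (simp add: polys_0)
  have mem: "map_poly g w \<in> polys R" if "g \<in> G" for g using hom_modD(3)[OF hp[OF that] assms(1)] .
  have PR: "P \<in> polys R" unfolding P_def using mem by (intro is_subring_prod[OF sp])
  have "map_poly h P = P" if h: "h \<in> G" for h
  proof -
    have "map_poly h P = (\<Prod>g\<in>G. map_poly h (map_poly g w))"
      unfolding P_def using mem by (intro hom_mod_0_prod[OF sp hp[OF h]])
    also have "\<dots> = (\<Prod>g\<in>G. map_poly (h \<circ> g) w)"
      using h by (intro prod.cong refl) (simp add: map_poly_map_poly action_0)
    also have "\<dots> = P" unfolding P_def by (rule prod.reindex_bij_betw[OF bij_left_mult[OF h]])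
    finally show ?thesis .
  qed
  then have "h (coeff P i) = coeff P i" if "h \<in> G" for h i
    using that by (metis coeff_map_poly action_0)
  then show "P \<in> polys fixed" using PR by (auto simp: polys_def fixed_def)
  fix Q assume Q: "is_ideal R Q" "w \<in> polys Q"
  have "P = w * (\<Prod>g\<in>G - {id}. map_poly g w)"
    unfolding P_def by (subst prod.remove[OF fin id_mem]) simp
  also have "\<dots> \<in> polys Q"
    using mem Q(2) by (intro is_idealD(5)[OF is_ideal_polys[OF Q(1)]] is_subring_prod[OF sp]) auto
  finally show "P \<in> polys Q" .
qed

text \<open>
  Two homomorphisms from \<open>R\<close> into the domain \<open>R/Q\<close> that agree on the invariants differ by an element
  of \<open>G\<close>. Collecting witnesses into the coefficients of one polynomial handles all elements of \<open>R\<close>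
  at once. For \<open>Q = 0\<close> this is the Galois correspondence, for \<open>\<psi> x = x ^ p\<close> it yields Frobenius
  elements, and for \<open>\<psi>\<close> a group element it compares inertia groups.
\<close>

theorem hom_mod_is_action:
  assumes Q: "is_prime R Q" and psi: "hom_mod R Q \<psi>"
    and agree: "\<And>x. x \<in> fixed \<Longrightarrow> \<psi> x - x \<in> Q"
  shows "\<exists>g\<in>G. \<forall>x\<in>R. \<psi> x - g x \<in> Q"
proof (rule ccontr)
  assume "\<not> ?thesis"
  then have "\<forall>g\<in>G. \<exists>x\<in>R. \<psi> x - g x \<notin> Q" by blast
  then obtain xf where xf: "\<And>g. g \<in> G \<Longrightarrow> xf g \<in> R \<and> \<psi> (xf g) - g (xf g) \<notin> Q" by metis
  obtain gs where gs: "set gs = G" using finite_list[OF fin] by blast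
  \<comment> \<open>The coefficients of \<open>w\<close> are the witnesses against all group
    elements, so a single congruence for \<open>w\<close> refutes one of the choices.\<close>
  define w where "w = Poly (map xf gs)"
  have w: "w \<in> polys R"
    using xf gs is_subringD(1)[OF subring]
    by (auto simp: polys_def w_def coeff_Poly_eq nth_default_def)
  note id = is_prime_ideal[OF Q]
  note sp = is_subring_polys[OF subring] and ip = is_ideal_polys[OF id]
  note spp = is_subring_polys[OF sp]
  have hp: "hom_mod (polys R) {0} (map_poly h)" if "h \<in> G" for h
    using hom_mod_polys[OF subring is_ideal_0[OF subring] hom[OF that]] by (simp add: polys_0)
  have hpp: "hom_mod (polys (polys R)) {0} (map_poly (map_poly h))" if "h \<in> G" for h
    using hom_mod_polys[OF sp is_ideal_0[OF sp] hp[OF that]] by (simp add: polys_0)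
  note psip = hom_mod_polys[OF subring id psi]
  have mem: "map_poly g w \<in> polys R" if "g \<in> G" for g using hom_modD(3)[OF hp[OF that] w] .
  \<comment> \<open>\<open>F\<close> is the polynomial over the ring of polynomials whose roots are
    the conjugates of \<open>w\<close>. Its coefficients are invariant, hence moved by
    \<open>\<psi>\<close> only within \<open>Q\<close>.\<close>
  define L where "L g = [:- map_poly g w, 1:]" for g :: "'a \<Rightarrow> 'a"
  define F where "F = (\<Prod>g\<in>G. L g)"
  have L: "L g \<in> polys (polys R)" if "g \<in> G" for g
    using mem[OF that] is_subringD[OF sp]
    by (auto simp: polys_def[of "polys R"] L_def coeff_pCons split: nat.splits)
  have F: "F \<in> polys (polys R)" unfolding F_def using L by (intro is_subring_prod[OF spp])
  have "map_poly (map_poly h) F = F" if h: "h \<in> G" for h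
  proof -
    have "map_poly (map_poly h) F = (\<Prod>g\<in>G. map_poly (map_poly h) (L g))"
      unfolding F_def using L by (intro hom_mod_0_prod[OF spp hpp[OF h]])
    also have "\<dots> = (\<Prod>g\<in>G. L (h \<circ> g))"
    proof (intro prod.cong refl)
      fix g assume g: "g \<in> G"
      have "map_poly h (map_poly g w) = map_poly (h \<circ> g) w"
        using h g by (simp add: map_poly_map_poly action_0)
      moreover have "map_poly h (- map_poly g w) = - map_poly h (map_poly g w)"
        by (rule hom_mod_0_minus[OF sp hp[OF h] mem[OF g]])
      moreover have "map_poly h 1 = 1" using hom_modD(2)[OF hp[OF h]] by simp
      ultimately show "map_poly (map_poly h) (L g) = L (h \<circ> g)" by (simp add: L_def map_poly_pCons)
    qed
    also have "\<dots> = F" unfolding F_def by (rule prod.reindex_bij_betw[OF bij_left_mult[OF h]])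
    finally show ?thesis .
  qed
  then have "map_poly h (coeff F i) = coeff F i" if "h \<in> G" for h i
    using that by (metis coeff_map_poly map_poly_0)
  then have "h (coeff (coeff F i) j) = coeff (coeff F i) j" if "h \<in> G" for h i j
    using that by (metis coeff_map_poly action_0)
  then have "coeff (coeff F i) j \<in> fixed" for i j
    using F by (auto simp: fixed_def polys_def)
  then have agreep: "map_poly \<psi> (coeff F i) - coeff F i \<in> polys Q" for i
    using agree by (auto simp: polys_def coeff_map_poly hom_modD(1)[OF psi])
  define W where "W = map_poly \<psi> w"
  have W: "W \<in> polys R" unfolding W_def using hom_modD(3)[OF psip w] .
  have pF: "poly F x = (\<Prod>g\<in>G. x - map_poly g w)" for x
    unfolding F_def L_def poly_prod by simp
  have pw: "w ^ i \<in> polys R" for i using is_subring_power[OF sp w] .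
  have cF: "coeff F i \<in> polys R" for i using F by (simp add: polys_def[of "polys R"])
  \<comment> \<open>Applying \<open>\<psi>\<close> to this equation shows that the image
    \<open>W\<close> of \<open>w\<close> is a root of \<open>F\<close> modulo \<open>Q\<close>;
    primality then makes \<open>W\<close> congruent to a conjugate of \<open>w\<close>.\<close>
  have "poly F w = 0" unfolding pF by (rule prod_zero[OF fin bexI[OF _ id_mem]]) simp
  then have "map_poly \<psi> (poly F w) = 0" using hom_modD(1)[OF psip] by simp
  moreover have "map_poly \<psi> (poly F w) - (\<Sum>i\<le>Polynomial.degree F. map_poly \<psi> (coeff F i * w ^ i)) \<in> polys Q"
    unfolding poly_altdef using pw cF by (intro hom_mod_sum[OF sp ip psip]) (auto intro: is_subringD[OF sp])
  moreover have "(\<Sum>i\<le>Polynomial.degree F. map_poly \<psi> (coeff F i * w ^ i)) - poly F W \<in> polys Q"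
    unfolding poly_altdef sum_subtractf[symmetric]
  proof (rule is_ideal_sum[OF ip], rule is_ideal_trans_diff[OF sp ip])
    fix i
    show "map_poly \<psi> (coeff F i * w ^ i) - map_poly \<psi> (coeff F i) * map_poly \<psi> (w ^ i) \<in> polys Q"
      using pw cF by (intro hom_modD(5)[OF psip])
    show "map_poly \<psi> (coeff F i) * map_poly \<psi> (w ^ i) - coeff F i * W ^ i \<in> polys Q"
      unfolding W_def using pw cF w
      by (intro is_ideal_mult_cong[OF sp ip] agreep hom_mod_power[OF sp ip psip] hom_modD(3)[OF psip])
  qed
  ultimately have "0 - poly F W \<in> polys Q" using is_ideal_trans_diff[OF sp ip] by metis
  then have "(\<Prod>g\<in>G. W - map_poly g w) \<in> polys Q"
    using is_ideal_minus[OF sp ip, of "- poly F W"] by (simp add: pF)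
  then obtain g where g: "g \<in> G" "W - map_poly g w \<in> polys Q"
    using is_prime_prod[OF sp is_prime_polys[OF subring Q] fin, of "\<lambda>g. W - map_poly g w"] W mem is_subringD(6)[OF sp]
    by blast
  obtain i where i: "i < length gs" "gs ! i = g" using g(1) gs by (metis in_set_conv_nth)
  have "coeff (W - map_poly g w) i \<in> Q" using g(2) by (simp add: polys_def)
  then have "\<psi> (coeff w i) - g (coeff w i) \<in> Q"
    using g(1) by (simp add: W_def coeff_map_poly action_0 hom_modD(1)[OF psi])
  moreover have "coeff w i = xf g" using i by (simp add: w_def coeff_Poly_eq nth_default_def)
  ultimately show False using xf[OF g(1)] by simp
qed

end

section \<open>Powers of a prime ideal\<close>

inductive_set iprod :: "'a::comm_ring_1 set \<Rightarrow> 'a set \<Rightarrow> 'a set" for I J where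
  prod: "i \<in> I \<Longrightarrow> j \<in> J \<Longrightarrow> i * j \<in> iprod I J"
| sum: "a \<in> iprod I J \<Longrightarrow> b \<in> iprod I J \<Longrightarrow> a + b \<in> iprod I J"

primrec ipow :: "'a::comm_ring_1 set \<Rightarrow> 'a set \<Rightarrow> nat \<Rightarrow> 'a set" where
  "ipow R Q 0 = R"
| "ipow R Q (Suc n) = iprod (ipow R Q n) Q"

lemma is_ideal_self: "is_subring R \<Longrightarrow> is_ideal R R"
  by (auto simp: is_ideal_def is_subring_def)

lemma is_ideal_iprod:
  assumes R: "is_subring R" and IJ: "is_ideal R I" "is_ideal R J"
  shows "is_ideal R (iprod I J)"
proof -
  have "x \<in> R" if "x \<in> iprod I J" for x
    using that by induction (auto intro: is_subringD(4,5)[OF R] is_idealD(1)[OF IJ(1)] is_idealD(1)[OF IJ(2)])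
  moreover have "0 \<in> iprod I J"
    using iprod.prod[OF is_idealD(2)[OF IJ(1)] is_idealD(2)[OF IJ(2)]] by simp
  moreover have "r * x \<in> iprod I J" if "x \<in> iprod I J" "r \<in> R" for x r
    using that(1)
  proof induction
    case (prod i j)
    then have "(r * i) * j \<in> iprod I J" using is_idealD(4)[OF IJ(1) that(2)] by (intro iprod.prod)
    then show ?case by (simp add: mult.assoc)
  qed (auto simp: distrib_left intro: iprod.sum)
  ultimately show ?thesis by (auto simp: is_ideal_def intro: iprod.sum)
qed

context
  fixes R Q :: "'a::comm_ring_1 set"
  assumes R: "is_subring R" and Q: "is_ideal R Q"
begin

lemma is_ideal_ipow: "is_ideal R (ipow R Q n)"
  by (induction n) (auto intro: is_ideal_self R is_ideal_iprod[OF R] Q)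

lemma ipow_1: "ipow R Q 1 = Q"
proof
  show "ipow R Q 1 \<subseteq> Q"
  proof
    fix x assume "x \<in> ipow R Q 1"
    then have "x \<in> iprod R Q" by simp
    then show "x \<in> Q" by induction (use is_idealD[OF Q] in auto)
  qed
  show "Q \<subseteq> ipow R Q 1" using iprod.prod[of 1 R _ Q] is_subringD(2)[OF R] by auto
qed

lemma ipow_mult: "x \<in> ipow R Q m \<Longrightarrow> y \<in> ipow R Q n \<Longrightarrow> x * y \<in> ipow R Q (m + n)"
proof (induction n arbitrary: x y)
  case 0
  then show ?case using is_idealD(5)[OF is_ideal_ipow] by simp
next
  case (Suc n)
  from Suc.prems(2) have "y \<in> iprod (ipow R Q n) Q" by simp
  then show ?case
  proof induction
    case (prod i j)
    then have "(x * i) * j \<in> ipow R Q (Suc (m + n))"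
      using Suc.IH[OF Suc.prems(1)] by (auto intro: iprod.prod)
    then show ?case by (simp add: mult.assoc)
  next
    case (sum a b)
    then show ?case by (auto simp: distrib_left intro: iprod.sum)
  qed
qed

lemma ipow_Suc_mult: "x \<in> ipow R Q m \<Longrightarrow> y \<in> Q \<Longrightarrow> x * y \<in> ipow R Q (Suc m)"
  by (auto intro: iprod.prod)

text \<open>An inverse modulo \<open>Q\<close> suffices, because
  \<open>x = v * (u * x) - x * (u * v - 1)\<close> and the last product gains a power from its
  second factor.\<close>

lemma ipow_cancel_unit:
  assumes "v \<in> R" "u * v - 1 \<in> Q" "x \<in> ipow R Q n" "u * x \<in> ipow R Q (Suc n)"
  shows "x \<in> ipow R Q (Suc n)"
proof -
  note id = is_ideal_ipow[of "Suc n"]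
  have "v * (u * x) \<in> ipow R Q (Suc n)" using is_idealD(4)[OF id] assms by blast
  moreover have "x * (u * v - 1) \<in> ipow R Q (Suc n)" using ipow_Suc_mult assms by blast
  ultimately have "v * (u * x) - x * (u * v - 1) \<in> ipow R Q (Suc n)" by (rule is_ideal_diff[OF R id])
  then show ?thesis by (simp add: algebra_simps)
qed

end

lemma is_ideal_of_int_dvd:
  fixes Q :: "'a::comm_ring_1 set"
  assumes R: "is_subring R" and Q: "is_ideal R Q" "1 \<notin> Q" and q: "prime (q :: nat)" "of_nat q \<in> Q"
  shows "of_int n \<in> Q \<longleftrightarrow> int q dvd n"
proof
  assume n: "of_int n \<in> Q"
  show "int q dvd n"
  proof (rule ccontr)
    assume "\<not> int q dvd n"
    then have "coprime (int q) n" using q(1) by (simp add: prime_imp_coprime)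
    then obtain a b where "a * int q + b * n = 1" by (metis bezout_int coprime_imp_gcd_eq_1)
    then have "(of_int a * of_nat q + of_int b * of_int n :: 'a) = 1"
      by (metis of_int_1 of_int_add of_int_mult of_int_of_nat_eq)
    moreover have "(of_int a * of_nat q + of_int b * of_int n :: 'a) \<in> Q"
      by (intro is_idealD(3)[OF Q(1)] is_idealD(4)[OF Q(1)] is_subring_of_int[OF R] n q(2))
    ultimately show False using Q(2) by simp
  qed
next
  assume "int q dvd n"
  then obtain k where "n = k * int q" by (metis dvdE mult.commute)
  then have "of_int n = (of_int k * of_nat q :: 'a)" by simp
  then show "of_int n \<in> Q" using is_idealD(4)[OF Q(1) is_subring_of_int[OF R] q(2)] by simp
qed

lemma is_ideal_freshman:
  fixes x y :: "'a::comm_ring_1"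
  assumes R: "is_subring R" and Q: "is_ideal R Q" and q: "prime q" "of_nat q \<in> Q"
    and xy: "x \<in> R" "y \<in> R"
  shows "(x + y) ^ q - (x ^ q + y ^ q) \<in> Q"
proof -
  have q0: "q > 0" using q(1) by (simp add: prime_gt_0_nat)
  have "(x + y) ^ q = (\<Sum>k\<le>q. of_nat (q choose k) * x ^ k * y ^ (q - k))" by (rule binomial_ring)
  also have "\<dots> = x ^ q + (\<Sum>k<q. of_nat (q choose k) * x ^ k * y ^ (q - k))"
    by (simp flip: lessThan_Suc_atMost)
  also have "(\<Sum>k<q. of_nat (q choose k) * x ^ k * y ^ (q - k)) =
      y ^ q + (\<Sum>k\<in>{..<q} - {0}. of_nat (q choose k) * x ^ k * y ^ (q - k))"
    using q0 by (subst sum.remove[of _ 0]) auto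
  finally have "(x + y) ^ q - (x ^ q + y ^ q) = (\<Sum>k\<in>{..<q} - {0}. of_nat (q choose k) * x ^ k * y ^ (q - k))"
    by simp
  also have "\<dots> \<in> Q"
  proof (rule is_ideal_sum[OF Q])
    fix k assume "k \<in> {..<q} - {0}"
    then have "q dvd (q choose k)" using q(1) by (intro dvd_choose_prime) (use q(1) in auto)
    then obtain c where c: "q choose k = c * q" by (metis dvdE mult.commute)
    have "of_nat (q choose k) * x ^ k * y ^ (q - k) = (of_nat c * x ^ k * y ^ (q - k)) * of_nat q"
      by (simp add: c algebra_simps)
    then show "of_nat (q choose k) * x ^ k * y ^ (q - k) \<in> Q"
      using is_idealD(4)[OF Q _ q(2)] xy
      by (simp add: is_subringD(5)[OF R] is_subring_power[OF R] is_subring_of_nat[OF R])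
  qed
  finally show ?thesis .
qed

lemma fermat_int:
  assumes "prime (q :: nat)" shows "int q dvd n ^ q - n"
proof (cases "int q dvd n")
  case True
  moreover have "int q dvd n ^ q" using True assms by (simp add: dvd_power dvd_trans prime_gt_0_nat)
  ultimately show ?thesis by (intro dvd_diff)
next
  case False
  define m where "m = nat (n mod int q)"
  have q: "q > 0" using assms by (simp add: prime_gt_0_nat)
  have m: "int m = n mod int q" using q by (simp add: m_def)
  have "\<not> q dvd m"
  proof
    assume "q dvd m"
    then have "int q dvd int m" by simp
    then show False using False m by (simp add: dvd_mod_iff)
  qed
  then have "[m ^ (q - 1) = 1] (mod q)" using fermat_theorem[OF assms] by blast
  then have "[m ^ (q - 1) * m = 1 * m] (mod q)" by (rule cong_scalar_right)
  then have "[m ^ q = m] (mod q)" using q by (metis mult_1 power_minus_mult)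
  then have "[int m ^ q = int m] (mod int q)" by (metis cong_int_iff of_nat_power)
  moreover have "[n = int m] (mod int q)" by (simp add: m cong_def)
  ultimately have "[n ^ q = n] (mod int q)" by (meson cong_pow cong_sym cong_trans)
  then show ?thesis by (simp add: cong_iff_dvd_diff)
qed

text \<open>These axioms capture the ring of integers of a field that is Galois over
  \<open>\<rat>\<close> with group \<open>G\<close>. Integral closure is used only in the form
  \<open>saturated\<close>, for denominators that are natural numbers.\<close>

locale integer_action = ring_action R G for R :: "complex set" and G +
  assumes integral: "x \<in> R \<Longrightarrow> algebraic_int x"
    and fixed_Ints: "fixed \<subseteq> \<int>"
    and saturated: "x \<in> R \<Longrightarrow> n > 0 \<Longrightarrow> algebraic_int (x / of_nat n) \<Longrightarrow> x / of_nat n \<in> R"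
begin

section \<open>Frobenius elements and inverses modulo a prime\<close>

lemma frobenius_ex:
  assumes Q: "is_prime R Q" and q: "prime q" "of_nat q \<in> Q"
  shows "\<exists>g\<in>G. \<forall>x\<in>R. x ^ q - g x \<in> Q"
proof (rule hom_mod_is_action[OF Q])
  note id = is_prime_ideal[OF Q]
  have Q1: "1 \<notin> Q" using Q by (simp add: is_prime_def)
  show "hom_mod R Q (\<lambda>x. x ^ q)"
    unfolding hom_mod_def using is_idealD(2)[OF id] is_ideal_freshman[OF subring id q] q(1)
    by (auto simp: power_mult_distrib is_subring_power[OF subring] prime_gt_0_nat)
  fix x assume "x \<in> fixed"
  then obtain n where "x = of_int n" using fixed_Ints by (auto elim: Ints_cases)
  then have "x ^ q - x = of_int (n ^ q - n)" by simp
  then show "x ^ q - x \<in> Q" using is_ideal_of_int_dvd[OF subring id Q1 q] fermat_int[OF q(1)] by metis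
qed

lemma funpow_mem: "g \<in> G \<Longrightarrow> g ^^ n \<in> G"
  by (induction n) (auto simp: id_mem intro: comp_mem)

lemma finite_order:
  assumes "g \<in> G"
  shows "\<exists>n>0. g ^^ n = id"
proof -
  have "\<not> inj (\<lambda>n. g ^^ n)"
    using finite_subset[of "range (\<lambda>n. g ^^ n)" G] funpow_mem[OF assms] fin finite_imageD[of "\<lambda>n. g ^^ n" UNIV]
    by (auto simp: image_subset_iff)
  then obtain i j where ij: "i < j" "g ^^ i = g ^^ j"
    by (metis injI linorder_neqE_nat)
  have "(g ^^ (j - i)) x = x" for x
  proof (rule action_inj[OF funpow_mem[OF assms, of i]])
    have "(g ^^ i) ((g ^^ (j - i)) x) = (g ^^ (i + (j - i))) x" by (simp only: funpow_add comp_apply)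
    also have "\<dots> = (g ^^ i) x" using ij by simp
    finally show "(g ^^ i) ((g ^^ (j - i)) x) = (g ^^ i) x" .
  qed
  then show ?thesis using ij by (intro exI[of _ "j - i"]) auto
qed

text \<open>Iterating the Frobenius element \<open>g\<close> until \<open>g ^^ k = id\<close> gives
  \<open>s = q ^ k\<close>. This stands in for the finiteness of the residue field: it yields
  inverses modulo \<open>Q\<close>, and it lets every element be written as an \<open>s\<close>-th
  power plus an element of \<open>Q\<close>.\<close>

lemma residue_power_ex:
  assumes Q: "is_prime R Q" and q: "prime q" "of_nat q \<in> Q"
  shows "\<exists>s\<ge>2. of_nat s \<in> Q \<and> (\<forall>x\<in>R. x ^ s - x \<in> Q)"
proof -
  note id = is_prime_ideal[OF Q]
  obtain g where g: "g \<in> G" "\<And>x. x \<in> R \<Longrightarrow> x ^ q - g x \<in> Q" using frobenius_ex[OF assms] by blast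
  obtain k where k: "k > 0" "g ^^ k = id" using finite_order[OF g(1)] by blast
  have *: "x ^ (q ^ n) - (g ^^ n) x \<in> Q" if x: "x \<in> R" for x n
  proof (induction n)
    case 0
    then show ?case by (simp add: is_idealD(2)[OF id])
  next
    case (Suc n)
    have gx: "(g ^^ n) x \<in> R" using action_closed[OF funpow_mem[OF g(1)] x] .
    have "(x ^ (q ^ n)) ^ q - ((g ^^ n) x) ^ q \<in> Q"
      by (rule is_ideal_power_cong[OF subring id Suc is_subring_power[OF subring x] gx])
    from is_ideal_trans_diff[OF subring id this g(2)[OF gx]] show ?case
      by (simp flip: power_mult add: mult.commute)
  qed
  have q2: "q \<ge> 2" using q(1) by (simp add: prime_ge_2_nat)
  then have "q ^ 1 \<le> q ^ k" using k(1) by (intro power_increasing) auto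
  moreover have "of_nat (q ^ k) \<in> Q"
    using k(1) is_idealD(5)[OF id is_subring_of_nat[OF subring] q(2), of "q ^ (k - 1)"]
    by (cases k) auto
  ultimately show ?thesis using *[of _ k] k(2) q2 by (intro exI[of _ "q ^ k"]) auto
qed

lemma unit_mod_prime:
  assumes Q: "is_prime R Q" and q: "prime q" "of_nat q \<in> Q" and u: "u \<in> R" "u \<notin> Q"
  obtains v where "v \<in> R" "u * v - 1 \<in> Q"
proof -
  obtain s where s: "s \<ge> 2" "u ^ s - u \<in> Q" using residue_power_ex[OF assms(1-3)] u(1) by blast
  define v where "v = u ^ (s - 2)"
  have v: "v \<in> R" using u(1) by (simp add: v_def is_subring_power[OF subring])
  have "s = Suc (Suc (s - 2))" using s(1) by simp
  then have "u ^ s = u * u * u ^ (s - 2)" by (metis power_Suc mult.assoc)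
  then have "u * (u * v - 1) = u ^ s - u" by (simp add: v_def algebra_simps)
  then have "u * (u * v - 1) \<in> Q" using s by simp
  moreover have "u * v - 1 \<in> R" by (intro is_subringD(6,5,2)[OF subring] u(1) v)
  ultimately have "u * v - 1 \<in> Q" using Q u unfolding is_prime_def by blast
  then show ?thesis using that v by blast
qed

lemma ipow_cancel:
  assumes Q: "is_prime R Q" and q: "prime q" "of_nat q \<in> Q" and u: "u \<in> R" "u \<notin> Q"
    and x: "x \<in> ipow R Q n" "u * x \<in> ipow R Q (Suc n)"
  shows "x \<in> ipow R Q (Suc n)"
proof -
  obtain v where "v \<in> R" "u * v - 1 \<in> Q" using unit_mod_prime[OF Q q u] .
  then show ?thesis by (rule ipow_cancel_unit[OF subring is_prime_ideal[OF Q] _ _ x])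
qed

section \<open>Norms of elements of prime powers\<close>

lemma fixed_of_int_dvd:
  assumes "is_prime R Q" "prime q" "of_nat q \<in> Q" "x \<in> fixed" "x \<in> Q"
  obtains n where "x = of_nat q * of_int n"
proof -
  obtain m where m: "x = of_int m" using fixed_Ints assms by (auto elim: Ints_cases)
  have "1 \<notin> Q" using assms by (simp add: is_prime_def)
  then have "int q dvd m"
    using is_ideal_of_int_dvd[OF subring is_prime_ideal[OF assms(1)] _ assms(2,3)] assms(5) m by simp
  then obtain k where "m = int q * k" by (elim dvdE)
  then have "x = of_nat q * of_int k" using m by simp
  then show ?thesis by (rule that)
qed

text \<open>A mixed norm, with a different element of \<open>Q\<close> for each \<open>g\<close>.
  All \<open>y g\<close> become coefficients of one polynomial \<open>w\<close>; the norm of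
  \<open>w\<close> has coefficients that are multiples of \<open>q\<close>, and the Prague theorem
  extracts the product that takes coefficient \<open>idx g\<close> from the conjugate by
  \<open>g\<close>.\<close>

lemma algebraic_int_orbit_prod:
  assumes Q: "is_prime R Q" and q: "prime q" "of_nat q \<in> Q" and y: "\<And>g. g \<in> G \<Longrightarrow> y g \<in> Q"
  shows "algebraic_int ((\<Prod>g\<in>G. g (y g)) / of_nat q)"
proof -
  obtain gs where gs: "set gs = G" using finite_list[OF fin] by blast
  define w where "w = Poly (map y gs)"
  note id = is_prime_ideal[OF Q]
  have wQ: "w \<in> polys Q"
    using y gs is_idealD(2)[OF id] by (auto simp: polys_def w_def coeff_Poly_eq nth_default_def)
  then have w: "w \<in> polys R" using is_idealD(1)[OF id] by (auto simp: polys_def)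
  have "\<forall>g\<in>G. \<exists>i. coeff w i = y g"
  proof
    fix g assume "g \<in> G"
    then obtain i where "i < length gs" "gs ! i = g" using gs by (metis in_set_conv_nth)
    then show "\<exists>i. coeff w i = y g" by (intro exI[of _ i]) (simp add: w_def coeff_Poly_eq nth_default_def)
  qed
  then obtain idx where idx: "\<And>g. g \<in> G \<Longrightarrow> coeff w (idx g) = y g" by metis
  let ?P = "\<Prod>g\<in>G. map_poly g w"
  have "algebraic_int (1 / of_nat q * coeff ?P k)" for k
  proof -
    have "coeff ?P k \<in> fixed" "coeff ?P k \<in> Q"
      using poly_orbit_prod(1)[OF w] poly_orbit_prod(2)[OF w id wQ] by (auto simp: polys_def)
    then obtain n where "coeff ?P k = of_nat q * of_int n"
      using fixed_of_int_dvd[OF Q q] by blast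
    then show ?thesis using q(1) by auto
  qed
  from algebraic_int_prod_coeffs[OF fin this, of idx]
  have "algebraic_int (1 / of_nat q * (\<Prod>g\<in>G. coeff (map_poly g w) (idx g)))" .
  also have "(\<Prod>g\<in>G. coeff (map_poly g w) (idx g)) = (\<Prod>g\<in>G. g (y g))"
    using idx by (intro prod.cong refl) (simp add: coeff_map_poly action_0)
  finally show ?thesis by simp
qed

text \<open>If every entry is a pure product \<open>a * b\<close> with \<open>b\<close> in
  \<open>Q\<close>, the claim splits into the case \<open>n\<close> and the previous lemma. General
  entries are sums of such products, and the mixed norm is additive in each entry separately, which
  is why the entries are allowed to differ.\<close>

lemma algebraic_int_orbit_prod_ipow:
  assumes Q: "is_prime R Q" and q: "prime q" "of_nat q \<in> Q" and y: "\<And>g. g \<in> G \<Longrightarrow> y g \<in> ipow R Q n"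
  shows "algebraic_int ((\<Prod>g\<in>G. g (y g)) / of_nat q ^ n)"
  using y
proof (induction n arbitrary: y)
  case 0
  have "algebraic_int (g (y g))" if "g \<in> G" for g
    using 0[OF that] action_closed[OF that] integral by simp
  then show ?case by (auto intro!: algebraic_int_prod)
next
  case (Suc n)
  note id = is_prime_ideal[OF Q]
  \<comment> \<open>\<open>S\<close> holds the group elements whose entry is still an arbitrary
    element of the power, the other entries being pure products; the goal is the case
    \<open>S = G\<close>.\<close>
  have "\<forall>y. (\<forall>g\<in>S. y g \<in> ipow R Q (Suc n)) \<and>
         (\<forall>g\<in>G-S. \<exists>a\<in>ipow R Q n. \<exists>b\<in>Q. y g = a * b) \<longrightarrow>
         algebraic_int ((\<Prod>g\<in>G. g (y g)) / of_nat q ^ Suc n)" if "S \<subseteq> G" for S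
    using finite_subset[OF that fin] that
  proof (induction S rule: finite_induct)
    case empty
    show ?case
    proof (intro allI impI, elim conjE)
      fix y assume "\<forall>g\<in>G-{}. \<exists>a\<in>ipow R Q n. \<exists>b\<in>Q. y g = a * b"
      then obtain a b where ab: "\<And>g. g \<in> G \<Longrightarrow> a g \<in> ipow R Q n \<and> b g \<in> Q \<and> y g = a g * b g"
        by simp metis
      have "g (y g) = g (a g) * g (b g)" if "g \<in> G" for g
        using ab[OF that] action_mult[OF that, of "a g" "b g"] is_idealD(1)[OF id]
          is_idealD(1)[OF is_ideal_ipow[OF subring id]] by metis
      then have "(\<Prod>g\<in>G. g (y g)) = (\<Prod>g\<in>G. g (a g)) * (\<Prod>g\<in>G. g (b g))"
        unfolding prod.distrib[symmetric] by (intro prod.cong) auto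
      then have "(\<Prod>g\<in>G. g (y g)) / of_nat q ^ Suc n =
          ((\<Prod>g\<in>G. g (a g)) / of_nat q ^ n) * ((\<Prod>g\<in>G. g (b g)) / of_nat q)"
        by (simp add: prod.distrib mult.commute)
      also have "algebraic_int \<dots>"
        using ab by (intro algebraic_int_times Suc.IH algebraic_int_orbit_prod[OF Q q]) auto
      finally show "algebraic_int ((\<Prod>g\<in>G. g (y g)) / of_nat q ^ Suc n)" .
    qed
  next
    case (insert g0 S)
    then have g0: "g0 \<in> G" "g0 \<notin> S" by auto
    show ?case
    proof (intro allI impI, elim conjE)
      fix y assume y1: "\<forall>g\<in>insert g0 S. y g \<in> ipow R Q (Suc n)"
        and y2: "\<forall>g\<in>G - insert g0 S. \<exists>a\<in>ipow R Q n. \<exists>b\<in>Q. y g = a * b"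
      define c where "c = (\<Prod>g\<in>G-{g0}. g (y g))"
      have pr: "(\<Prod>g\<in>G. g ((y(g0 := x)) g)) = g0 x * c" for x
        unfolding c_def by (subst prod.remove[OF fin g0(1)]) (auto intro!: prod.cong)
      have "y g0 \<in> iprod (ipow R Q n) Q" using y1 by simp
      then have "algebraic_int (g0 (y g0) * c / of_nat q ^ Suc n) \<and> y g0 \<in> R"
      proof induction
        case (prod i j)
        have "algebraic_int ((\<Prod>g\<in>G. g ((y(g0 := i * j)) g)) / of_nat q ^ Suc n)"
        proof (rule insert.IH[THEN spec, THEN mp, OF _ conjI])
          show "S \<subseteq> G" using insert.prems by simp
          show "\<forall>g\<in>S. (y(g0 := i * j)) g \<in> ipow R Q (Suc n)"
            using y1 g0(2) by auto
          show "\<forall>g\<in>G - S. \<exists>a\<in>ipow R Q n. \<exists>b\<in>Q. (y(g0 := i * j)) g = a * b"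
            using y2 prod by auto
        qed
        then show ?case using pr prod is_subringD(5)[OF subring] is_idealD(1)[OF id]
          is_idealD(1)[OF is_ideal_ipow[OF subring id]] by simp
      next
        case (sum a b)
        then show ?case using algebraic_int_plus[of "g0 a * c / of_nat q ^ Suc n" "g0 b * c / of_nat q ^ Suc n"]
          by (simp add: action_add[OF g0(1)] is_subringD(4)[OF subring] add_divide_distrib distrib_right)
      qed
      then show "algebraic_int ((\<Prod>g\<in>G. g (y g)) / of_nat q ^ Suc n)" using pr[of "y g0"] by simp
    qed
  qed
  from this[of G] Suc.prems show ?case by blast
qed

lemma orbit_prod_fixed: "x \<in> R \<Longrightarrow> (\<Prod>g\<in>G. g x) \<in> fixed"
proof -
  assume x: "x \<in> R"
  have "h (\<Prod>g\<in>G. g x) = (\<Prod>g\<in>G. g x)" if h: "h \<in> G" for h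
  proof -
    have "h (\<Prod>g\<in>G. g x) = (\<Prod>g\<in>G. (h \<circ> g) x)"
      by (subst action_prod[OF h]) (auto simp: action_closed x)
    also have "\<dots> = (\<Prod>g\<in>G. g x)" by (rule prod.reindex_bij_betw[OF bij_left_mult[OF h]])
    finally show ?thesis .
  qed
  then show ?thesis using action_closed x by (auto simp: fixed_def intro!: is_subring_prod[OF subring])
qed

text \<open>The norm of \<open>m\<close> is \<open>m ^ card G\<close>. The resulting divisibility is
  not sharp, but it limits how high a power of \<open>Q\<close> can contain a given nonzero
  integer.\<close>

lemma of_int_in_ipow:
  assumes Q: "is_prime R Q" and q: "prime q" "of_nat q \<in> Q" and m: "of_int m \<in> ipow R Q n"
  shows "int q ^ n dvd m ^ card G"
proof -
  have "algebraic_int ((\<Prod>g\<in>G. g (of_int m)) / of_nat q ^ n :: complex)"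
    by (rule algebraic_int_orbit_prod_ipow[OF Q q m])
  also have "(\<Prod>g\<in>G. g (of_int m)) = (of_int m ^ card G :: complex)"
    by (simp add: action_of_int)
  finally have "algebraic_int (of_int m ^ card G / of_nat q ^ n :: complex)" .
  moreover have "of_int m ^ card G / of_nat q ^ n \<in> (\<rat> :: complex set)" by auto
  ultimately have "of_int m ^ card G / of_nat q ^ n \<in> (\<int> :: complex set)" by (rule rational_algebraic_int_is_int)
  then obtain k where k: "of_int m ^ card G / of_nat q ^ n = (of_int k :: complex)" by (auto elim: Ints_cases)
  have "of_int (m ^ card G) = (of_int (k * int q ^ n) :: complex)"
    using k q(1) by (simp add: divide_eq_eq prime_gt_0_nat split: if_splits)
  then have "m ^ card G = k * int q ^ n" by (simp only: of_int_eq_iff)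
  then show ?thesis by simp
qed

text \<open>Krull's intersection property by norms: the norm of a nonzero \<open>x\<close> would be
  a nonzero integer in every power of \<open>Q\<close>, and its \<open>card G\<close>-th power would
  be divisible by every power of \<open>q\<close>.\<close>

lemma ipow_Inter:
  assumes Q: "is_prime R Q" and q: "prime q" "of_nat q \<in> Q" and x: "\<And>n. x \<in> ipow R Q n"
  shows "x = 0"
proof (rule ccontr)
  assume x0: "x \<noteq> 0"
  note id = is_prime_ideal[OF Q]
  have xR: "x \<in> R" using x[of 0] by simp
  have "(\<Prod>g\<in>G. g x) \<in> \<int>" using orbit_prod_fixed[OF xR] fixed_Ints by blast
  then obtain m where m: "(\<Prod>g\<in>G. g x) = of_int m" by (auto elim: Ints_cases)
  have "(\<Prod>g\<in>G. g x) \<noteq> 0"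
    using action_inj action_0 x0 fin by (subst prod_zero_iff) metis+
  then have m0: "m \<noteq> 0" using m by auto
  have "of_int m \<in> ipow R Q n" for n
  proof -
    have "(\<Prod>g\<in>G. g x) = x * (\<Prod>g\<in>G-{id}. g x)" by (subst prod.remove[OF fin id_mem]) simp
    also have "\<dots> \<in> ipow R Q n"
      using xR action_closed
      by (intro is_idealD(5)[OF is_ideal_ipow[OF subring id] _ x] is_subring_prod[OF subring]) auto
    finally show ?thesis using m by simp
  qed
  then have dv: "int q ^ n dvd m ^ card G" for n using of_int_in_ipow[OF Q q] by blast
  have "int q ^ n \<le> \<bar>m ^ card G\<bar>" for n using dvd_imp_le_int[OF _ dv[of n]] m0 by simp
  moreover have "int n < int q ^ n" for n
  proof -
    have "n < q ^ n" using power_gt_expt[of q n] prime_gt_1_nat[OF q(1)] by simp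
    then have "int n < int (q ^ n)" by (simp only: of_nat_less_iff)
    then show ?thesis by simp
  qed
  ultimately have "int n < \<bar>m ^ card G\<bar>" for n by (meson less_le_trans)
  from this[of "nat \<bar>m ^ card G\<bar>"] show False by simp
qed

end

section \<open>Inertia\<close>

lemma prime_ideal_ex:
  fixes R :: "'a::comm_ring_1 set"
  assumes R: "is_subring R" and I: "is_ideal R I" "1 \<notin> I"
  shows "\<exists>Q. is_prime R Q \<and> I \<subseteq> Q"
proof -
  define S where "S = {J. is_ideal R J \<and> 1 \<notin> J \<and> I \<subseteq> J}"
  have "\<exists>M\<in>S. \<forall>Z\<in>S. M \<subseteq> Z \<longrightarrow> Z = M"
  proof (rule subset_Zorn_nonempty)
    show "S \<noteq> {}" using I by (auto simp: S_def)
    fix C assume C: "C \<noteq> {}" "subset.chain S C"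
    then have ch: "Z \<in> S" "Y \<in> C \<Longrightarrow> Z \<subseteq> Y \<or> Y \<subseteq> Z" if "Z \<in> C" for Z Y
      using that unfolding subset.chain_def by blast+
    have S1: "is_ideal R Z" "1 \<notin> Z" "I \<subseteq> Z" if "Z \<in> C" for Z
      using ch(1)[OF that] by (auto simp: S_def)
    have "x + y \<in> \<Union>C" if xy: "x \<in> \<Union>C" "y \<in> \<Union>C" for x y
    proof -
      obtain Z Y where XY: "Z \<in> C" "Y \<in> C" "x \<in> Z" "y \<in> Y" using xy by blast
      then show ?thesis
        using ch(2)[OF XY(1,2)] is_idealD(3)[OF S1(1)[OF XY(1)], of x y]
          is_idealD(3)[OF S1(1)[OF XY(2)], of x y] by blast
    qed
    moreover have "r * x \<in> \<Union>C" if "r \<in> R" "x \<in> \<Union>C" for r x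
      using that is_idealD(4)[OF S1(1)] by blast
    moreover have "\<Union>C \<subseteq> R" using is_idealD(1)[OF S1(1)] by blast
    moreover have "0 \<in> \<Union>C" using C(1) is_idealD(2)[OF S1(1)] by blast
    ultimately have "is_ideal R (\<Union>C)" unfolding is_ideal_def by blast
    moreover have "1 \<notin> \<Union>C" using S1(2) by blast
    moreover have "I \<subseteq> \<Union>C" using S1(3) C(1) by blast
    ultimately show "\<Union>C \<in> S" unfolding S_def by blast
  qed
  then obtain Q where Q: "Q \<in> S" "\<And>Z. Z \<in> S \<Longrightarrow> Q \<subseteq> Z \<Longrightarrow> Z = Q" by blast
  have id: "is_ideal R Q" "1 \<notin> Q" "I \<subseteq> Q" using Q(1) by (auto simp: S_def)
  have "x \<in> Q \<or> y \<in> Q" if x: "x \<in> R" and y: "y \<in> R" and xy: "x * y \<in> Q" for x y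
  proof (rule disjCI)
    assume yQ: "y \<notin> Q"
    define J where "J = {a + r * x | a r. a \<in> Q \<and> r \<in> R}"
    have QJ: "Q \<subseteq> J"
    proof
      fix a assume "a \<in> Q"
      then have "a + 0 * x \<in> J" unfolding J_def using is_subringD(1)[OF R] by blast
      then show "a \<in> J" by simp
    qed
    have "u + v \<in> J" if "u \<in> J" "v \<in> J" for u v
    proof -
      obtain a r b t where "a \<in> Q" "r \<in> R" "u = a + r * x" "b \<in> Q" "t \<in> R" "v = b + t * x"
        using \<open>u \<in> J\<close> \<open>v \<in> J\<close> by (auto simp: J_def)
      then have "u + v = (a + b) + (r + t) * x" "a + b \<in> Q" "r + t \<in> R"
        using is_idealD(3)[OF id(1)] is_subringD(4)[OF R] by (auto simp: algebra_simps)
      then show ?thesis unfolding J_def by blast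
    qed
    moreover have "c * u \<in> J" if "c \<in> R" "u \<in> J" for c u
    proof -
      obtain a r where "a \<in> Q" "r \<in> R" "u = a + r * x" using \<open>u \<in> J\<close> by (auto simp: J_def)
      then have "c * u = c * a + (c * r) * x" by (simp add: distrib_left mult.assoc)
      moreover have "c * a \<in> Q" "c * r \<in> R"
        using is_idealD(4)[OF id(1)] is_subringD(5)[OF R] \<open>c \<in> R\<close> \<open>a \<in> Q\<close> \<open>r \<in> R\<close> by blast+
      ultimately show ?thesis unfolding J_def by blast
    qed
    moreover have "J \<subseteq> R"
      using is_idealD(1)[OF id(1)] x by (auto simp: J_def intro!: is_subringD(4,5)[OF R])
    ultimately have J: "is_ideal R J" using QJ is_idealD(2)[OF id(1)] unfolding is_ideal_def by blast
    have "1 \<notin> J"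
    proof
      assume "1 \<in> J"
      then obtain a r where ar: "a \<in> Q" "r \<in> R" "1 = a + r * x" by (auto simp: J_def)
      have "y = y * (a + r * x)" using ar(3) by simp
      also have "\<dots> = y * a + r * (x * y)" by (simp add: algebra_simps)
      also have "\<dots> \<in> Q"
        by (rule is_idealD(3)[OF id(1) is_idealD(4)[OF id(1) y ar(1)] is_idealD(4)[OF id(1) ar(2) xy]])
      finally show False using yQ by simp
    qed
    then have "J \<in> S" using J QJ id(3) by (auto simp: S_def)
    then have "J = Q" using Q(2) QJ by blast
    moreover have "0 + 1 * x \<in> J" unfolding J_def using is_idealD(2)[OF id(1)] is_subringD(2)[OF R] by blast
    ultimately show "x \<in> Q" by simp
  qed
  then have "is_prime R Q" using id by (auto simp: is_prime_def)
  then show ?thesis using id(3) by blast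
qed

lemma algebraic_int_square_root: "algebraic_int (x\<^sup>2) \<Longrightarrow> algebraic_int x" for x :: complex
  by (rule algebraic_int_root[of "x\<^sup>2" "monom 1 2"]) (auto simp: poly_monom degree_monom_eq)

context integer_action
begin

lemma prime_over_ex:
  assumes q: "prime (q :: nat)"
  obtains Q where "is_prime R Q" "of_nat q \<in> Q"
proof -
  define I where "I = (\<lambda>x. of_nat q * x) ` R"
  have "is_ideal R I"
    unfolding is_ideal_def
  proof (intro conjI ballI)
    show "I \<subseteq> R" by (auto simp: I_def intro!: is_subringD(5)[OF subring] is_subring_of_nat[OF subring])
    show "0 \<in> I" unfolding I_def using is_subringD(1)[OF subring] by (auto intro!: image_eqI[of _ _ 0])
    show "x + y \<in> I" if "x \<in> I" "y \<in> I" for x y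
      using that is_subringD(4)[OF subring] unfolding I_def by (auto simp flip: distrib_left)
    show "x * y \<in> I" if "x \<in> R" "y \<in> I" for x y
      using that is_subringD(5)[OF subring] unfolding I_def by (auto simp: mult.left_commute)
  qed
  moreover have "1 \<notin> I"
  proof
    assume "1 \<in> I"
    then obtain x where x: "x \<in> R" "1 = of_nat q * x" by (auto simp: I_def)
    then have "x = 1 / of_nat q" using q by (simp add: field_simps prime_gt_0_nat)
    moreover have "algebraic_int x" using integral x(1) .
    ultimately have "x \<in> \<int>" by (intro rational_algebraic_int_is_int) auto
    then obtain n where "x = of_int n" by (auto elim: Ints_cases)
    then have "of_int (int q * n) = (of_int 1 :: complex)" using x(2) by simp
    then have "int q * n = 1" by (simp only: of_int_eq_iff)
    then have "int q dvd 1" by (metis dvd_triv_left)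
    then show False using q by (simp add: not_prime_1)
  qed
  ultimately obtain Q where "is_prime R Q" "I \<subseteq> Q" using prime_ideal_ex[OF subring] by blast
  moreover have "of_nat q \<in> I" unfolding I_def using is_subringD(2)[OF subring] by force
  ultimately show ?thesis using that by blast
qed

text \<open>The norm of \<open>x\<close> is a nonzero integer in \<open>Q\<close>, so one of its
  prime factors lies in \<open>Q\<close>.\<close>

lemma prime_contains_prime:
  assumes Q: "is_prime R Q" and x: "x \<in> Q" "x \<noteq> 0"
  obtains q :: nat where "prime q" "of_nat q \<in> Q"
proof -
  note id = is_prime_ideal[OF Q]
  have xR: "x \<in> R" using is_idealD(1)[OF id x(1)] .
  have "(\<Prod>g\<in>G. g x) = x * (\<Prod>g\<in>G-{id}. g x)" by (subst prod.remove[OF fin id_mem]) simp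
  also have "\<dots> \<in> Q"
    by (rule is_idealD(5)[OF id is_subring_prod[OF subring] x(1)]) (auto intro: action_closed xR)
  finally have NQ: "(\<Prod>g\<in>G. g x) \<in> Q" .
  have "(\<Prod>g\<in>G. g x) \<in> \<int>" using orbit_prod_fixed[OF xR] fixed_Ints by blast
  then obtain m where m: "(\<Prod>g\<in>G. g x) = of_int m" by (auto elim: Ints_cases)
  have "g x \<noteq> 0" if "g \<in> G" for g using action_inj[OF that, of x 0] action_0[OF that] x(2) by auto
  then have m0: "m \<noteq> 0" using m fin by (metis of_int_0 prod_zero_iff)
  have mQ: "of_nat (nat \<bar>m\<bar>) \<in> Q"
    using NQ m is_ideal_minus[OF subring id, of "of_int m"] by (cases "m \<ge> 0") auto
  have "prod_mset (prime_factorization (nat \<bar>m\<bar>)) = nat \<bar>m\<bar>"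
    using m0 by (simp add: prod_mset_prime_factorization_nat)
  have "\<exists>q\<in>#M. of_nat q \<in> Q" if "of_nat (prod_mset M) \<in> Q" for M :: "nat multiset"
    using that
  proof (induction M)
    case empty
    then show ?case using Q by (simp add: is_prime_def)
  next
    case (add p M)
    then have "of_nat p * of_nat (prod_mset M) \<in> Q" by simp
    then have "of_nat p \<in> Q \<or> of_nat (prod_mset M) \<in> Q"
      using Q is_subring_of_nat[OF subring] unfolding is_prime_def by blast
    then show ?case using add.IH by auto
  qed
  then obtain q where "q \<in># prime_factorization (nat \<bar>m\<bar>)" "of_nat q \<in> Q"
    using mQ \<open>prod_mset _ = _\<close> by metis
  then show ?thesis using that in_prime_factors_imp_prime by blast
qed

text \<open>
  An element \<open>\<pi>\<close> of \<open>Q\<close> outside \<open>Q\<^sup>2\<close> generates \<open>Q\<close> locally: the content of the norm of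
  \<open>\<pi> + y T\<close> provides the denominator \<open>s\<close>.
\<close>

lemma local_generator:
  assumes Q: "is_prime R Q" and q: "prime q" "of_nat q \<in> Q"
    and pi: "\<pi> \<in> Q" "\<pi> \<notin> ipow R Q 2" and y: "y \<in> Q"
  obtains s z where "s \<in> R" "s \<notin> Q" "z \<in> R" "s * y = \<pi> * z"
proof -
  note id = is_prime_ideal[OF Q]
  note i2 = is_ideal_ipow[OF subring id, of 2]
  have pR: "\<pi> \<in> R" and yR: "y \<in> R" using is_idealD(1)[OF id] pi y by auto
  have p0: "\<pi> \<noteq> 0" using pi(2) is_idealD(2)[OF i2] by auto
  \<comment> \<open>\<open>j\<close> is the cofactor of this linear polynomial in its norm
    \<open>P\<close>. The quotient of \<open>s\<close> and \<open>z\<close> will be that of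
    \<open>\<pi>\<close> and \<open>y\<close>, both multiplied by one coefficient of
    \<open>j\<close> and divided by the \<open>q\<close>-part \<open>c\<close> of the content of
    \<open>P\<close>.\<close>
  define w where "w = [:\<pi>, y:]"
  have w: "w \<in> polys R"
    using pR yR is_subringD(1)[OF subring] by (auto simp: w_def polys_def coeff_pCons split: nat.splits)
  define P where "P = (\<Prod>g\<in>G. map_poly g w)"
  define j where "j = (\<Prod>g\<in>G-{id}. map_poly g w)"
  have Pj: "P = w * j" unfolding P_def j_def by (subst prod.remove[OF fin id_mem]) simp
  have "map_poly g w \<in> polys R" if "g \<in> G" for g
    using w action_closed[OF that] by (auto simp: polys_def coeff_map_poly action_0[OF that])
  then have "j \<in> polys R" unfolding j_def by (intro is_subring_prod[OF is_subring_polys[OF subring]]) auto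
  then have jR: "coeff j k \<in> R" for k by (auto simp: polys_def)
  have "P \<in> polys fixed" unfolding P_def by (rule poly_orbit_prod(1)[OF w])
  then have "\<exists>n. coeff P k = of_int n" for k
    using fixed_Ints by (auto simp: polys_def elim!: Ints_cases)
  then obtain f where f: "\<And>k. coeff P k = of_int (f k)" by metis
  have "map_poly g w \<noteq> 0" if "g \<in> G" for g
  proof -
    have "coeff (map_poly g w) 0 = g \<pi>" by (simp add: coeff_map_poly action_0[OF that] w_def)
    moreover have "g \<pi> \<noteq> 0" using action_inj[OF that, of \<pi> 0] action_0[OF that] p0 by auto
    ultimately show ?thesis by auto
  qed
  then have "P \<noteq> 0" unfolding P_def using fin by simp
  then obtain k0 where "coeff P k0 \<noteq> 0" by (auto simp: poly_eq_iff)
  then have fk0: "f k0 \<noteq> 0" using f by auto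
  \<comment> \<open>The least bad exponent is \<open>e + 1\<close>, where \<open>q ^ e\<close> is
    the exact power of \<open>q\<close> in the content of \<open>P\<close>.\<close>
  define bad where "bad n \<longleftrightarrow> \<not> (\<forall>k. int q ^ n dvd f k)" for n
  have "bad (nat \<bar>f k0\<bar>)"
  proof -
    let ?n = "nat \<bar>f k0\<bar>"
    have "?n < q ^ ?n" using power_gt_expt[of q ?n] prime_gt_1_nat[OF q(1)] by simp
    then have "int ?n < int (q ^ ?n)" by (simp only: of_nat_less_iff)
    moreover have "int q ^ ?n \<le> \<bar>f k0\<bar>" if "int q ^ ?n dvd f k0" using dvd_imp_le_int[OF fk0 that] by simp
    ultimately have "\<not> int q ^ ?n dvd f k0" by fastforce
    then show ?thesis by (auto simp: bad_def)
  qed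
  then have lst: "bad (LEAST n. bad n)" by (rule LeastI)
  have "\<not> bad 0" by (simp add: bad_def)
  then obtain e where e: "(LEAST n. bad n) = Suc e" using lst by (metis not0_implies_Suc)
  then have "\<not> bad e" using not_less_Least[of e bad] by simp
  then have eall: "int q ^ e dvd f k" for k by (simp add: bad_def)
  obtain k1 where k1: "\<not> int q ^ Suc e dvd f k1" using lst e by (auto simp: bad_def)
  define c :: complex where "c = of_nat (q ^ e)"
  have q0: "q > 0" using q(1) by (simp add: prime_gt_0_nat)
  have c0: "c \<noteq> 0" using q0 by (simp add: c_def)
  have Pc: "\<exists>m. coeff P k = c * of_int m" for k
    using eall[of k] f[of k] by (auto simp: c_def elim!: dvdE)
  \<comment> \<open>Since \<open>P / c\<close> is integral and equals \<open>w * j / c\<close>, the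
    Prague theorem makes both coefficients of \<open>w\<close> times each coefficient of
    \<open>j / c\<close> integral.\<close>
  have al: "algebraic_int (coeff (Polynomial.smult (1 / c) w * j) k)" for k
    using Pc[of k] c0 by (auto simp flip: Pj)
  have e1: "algebraic_int (\<pi> * coeff j k / c)" and e2: "algebraic_int (y * coeff j k / c)" for k
    using algebraic_int_coeff_mult[OF al, of 0 k] algebraic_int_coeff_mult[OF al, of 1 k]
    by (simp_all add: w_def)
  have R1: "\<pi> * coeff j k / c \<in> R" and R2: "y * coeff j k / c \<in> R" for k
    using e1[of k] e2[of k] q0 unfolding c_def
    by (auto intro!: saturated is_subringD(5)[OF subring] jR pR yR simp del: of_nat_power)
  \<comment> \<open>Otherwise \<open>\<pi>\<close> times each coefficient of \<open>P / c\<close>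
    would be in the square of \<open>Q\<close>. At \<open>k1\<close> that coefficient is an integer
    prime to \<open>q\<close> and can be cancelled, leaving \<open>\<pi>\<close> itself in the
    square.\<close>
  have "\<exists>k. \<pi> * coeff j k / c \<notin> Q"
  proof (rule ccontr)
    assume "\<not> ?thesis"
    then have all: "\<pi> * coeff j k / c \<in> Q" for k by blast
    have QQ: "a * b \<in> ipow R Q 2" if "a \<in> Q" "b \<in> Q" for a b
      using ipow_mult[OF subring id, of a 1 b 1] that ipow_1[OF subring id] by (simp add: numeral_2_eq_2)
    have "\<pi> * (coeff P k / c) \<in> ipow R Q 2" for k
    proof (cases k)
      case 0
      then have "\<pi> * (coeff P k / c) = \<pi> * (\<pi> * coeff j 0 / c)"
        unfolding Pj w_def by simp
      then show ?thesis using QQ[OF pi(1) all[of 0]] by metis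
    next
      case (Suc l)
      then have "\<pi> * (coeff P k / c) = \<pi> * (\<pi> * coeff j k / c) + y * (\<pi> * coeff j l / c)"
        by (simp add: Pj w_def algebra_simps add_divide_distrib)
      also have "\<dots> \<in> ipow R Q 2" by (intro is_idealD(3)[OF i2] QQ pi y all)
      finally show ?thesis .
    qed
    moreover obtain m where m: "coeff P k1 = c * of_int m" using Pc by blast
    ultimately have "of_int m * \<pi> \<in> ipow R Q (Suc 1)"
      using c0 by (metis mult.commute nonzero_mult_div_cancel_left numeral_2_eq_2 One_nat_def)
    moreover have "of_int m \<notin> Q"
    proof
      assume "of_int m \<in> Q"
      then have "int q dvd m" using is_ideal_of_int_dvd[OF subring id _ q] Q by (auto simp: is_prime_def)
      moreover have "of_int (f k1) = (of_int (int q ^ e * m) :: complex)" using m f[of k1] by (simp add: c_def)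
      then have "f k1 = int q ^ e * m" by (simp only: of_int_eq_iff)
      ultimately show False using k1 by (simp add: mult.commute mult_dvd_mono)
    qed
    moreover have "\<pi> \<in> ipow R Q 1" using pi(1) ipow_1[OF subring id] by simp
    ultimately have "\<pi> \<in> ipow R Q (Suc 1)"
      by (rule ipow_cancel[OF Q q is_subring_of_int[OF subring], rotated 2])
    then show False using pi(2) by (simp add: numeral_2_eq_2)
  qed
  then obtain k where "\<pi> * coeff j k / c \<notin> Q" by blast
  moreover have "(\<pi> * coeff j k / c) * y = \<pi> * (y * coeff j k / c)" by simp
  ultimately show ?thesis using that R1 R2 by blast
qed

text \<open>Both tame and wild inertia are covered: the congruence \<open>g x = x\<close> is
  improved from one power of \<open>Q\<close> to the next for all \<open>x\<close> at once, by
  splitting \<open>x\<close> into \<open>x ^ s\<close> and \<open>y = x - x ^ s\<close> in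
  \<open>Q\<close>. Krull's intersection property concludes.\<close>

lemma inertia_trivial:
  assumes Q: "is_prime R Q" and q: "prime q" "of_nat q \<in> Q"
    and pi: "\<pi> \<in> Q" "\<pi> \<notin> ipow R Q 2"
    and g: "g \<in> G" "g \<pi> = \<pi>" "\<And>x. x \<in> R \<Longrightarrow> g x - x \<in> Q"
  shows "g = id"
proof -
  note id = is_prime_ideal[OF Q]
  have pR: "\<pi> \<in> R" using is_idealD(1)[OF id pi(1)] .
  obtain s where s: "s \<ge> 2" "of_nat s \<in> Q" "\<And>x. x \<in> R \<Longrightarrow> x ^ s - x \<in> Q"
    using residue_power_ex[OF Q q] by blast
  have *: "g x - x \<in> ipow R Q (Suc n)" if "x \<in> R" for n x
    using that
  proof (induction n arbitrary: x)
    case 0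
    then show ?case using g(3) ipow_1[OF subring id] by simp
  next
    case (Suc n)
    note x = Suc.prems
    note ii = is_ideal_ipow[OF subring id, of "Suc (Suc n)"]
    have gx: "g x \<in> R" using action_closed[OF g(1) x] .
    have xs: "x ^ s \<in> R" using is_subring_power[OF subring x] .
    define y where "y = x - x ^ s"
    have y: "y \<in> Q" "y \<in> R"
      using is_ideal_minus[OF subring id s(3)[OF x]] is_subringD(6)[OF subring x xs] by (auto simp: y_def)
    have "(\<Sum>i<s. x ^ (s - Suc i) * g x ^ i) - (\<Sum>i<s. x ^ (s - 1)) \<in> Q"
      unfolding sum_subtractf[symmetric]
    proof (rule is_ideal_sum[OF id])
      fix i assume "i \<in> {..<s}"
      then have "x ^ (s - 1) = x ^ (s - Suc i) * x ^ i" by (simp flip: power_add)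
      then have "x ^ (s - Suc i) * g x ^ i - x ^ (s - 1) = x ^ (s - Suc i) * (g x ^ i - x ^ i)"
        by (simp add: right_diff_distrib)
      also have "\<dots> \<in> Q"
        by (intro is_idealD(4)[OF id] is_subring_power[OF subring] x
            is_ideal_power_cong[OF subring id] g(3) gx)
      finally show "x ^ (s - Suc i) * g x ^ i - x ^ (s - 1) \<in> Q" .
    qed
    moreover have "(\<Sum>i<s. x ^ (s - 1)) \<in> Q"
      using is_idealD(5)[OF id is_subring_power[OF subring x] s(2), of "s - 1"] by simp
    ultimately have SQ: "(\<Sum>i<s. x ^ (s - Suc i) * g x ^ i) \<in> Q"
      using is_ideal_cong[OF subring id] by blast
    \<comment> \<open>The second factor is congruent to \<open>s * x ^ (s - 1)\<close> modulo
      \<open>Q\<close>, hence lies in \<open>Q\<close> because \<open>s\<close> does; this is the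
      gain of one power for \<open>x ^ s\<close>.\<close>
    have "g (x ^ s) - x ^ s = (g x - x) * (\<Sum>i<s. x ^ (s - Suc i) * g x ^ i)"
      by (simp add: action_power[OF g(1) x] power_diff_sumr2)
    also have "\<dots> \<in> ipow R Q (Suc (Suc n))"
      by (rule ipow_Suc_mult[OF subring id Suc.IH[OF x] SQ])
    finally have d1: "g (x ^ s) - x ^ s \<in> ipow R Q (Suc (Suc n))" .
    obtain t z where tz: "t \<in> R" "t \<notin> Q" "z \<in> R" "t * y = \<pi> * z"
      using local_generator[OF Q q pi y(1)] .
    \<comment> \<open>As \<open>g\<close> fixes \<open>\<pi>\<close>, comparing this with
      \<open>t * y = \<pi> * z\<close> expresses \<open>g y - y\<close>, up to the factor
      \<open>g t\<close> outside \<open>Q\<close>, by differences \<open>g z - z\<close> and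
      \<open>g t - t\<close> that are each multiplied by an element of \<open>Q\<close>.\<close>
    have "g t * g y = \<pi> * g z"
      using tz(4) action_mult[OF g(1) tz(1) y(2)] action_mult[OF g(1) pR tz(3)] g(2) by simp
    then have "g t * (g y - y) = (g z - z) * \<pi> - (g t - t) * y"
      using tz(4) by (simp add: algebra_simps)
    also have "\<dots> \<in> ipow R Q (Suc (Suc n))"
      by (intro is_ideal_diff[OF subring ii] ipow_Suc_mult[OF subring id] Suc.IH tz pi(1) y)
    finally have "g t * (g y - y) \<in> ipow R Q (Suc (Suc n))" .
    moreover have "g t \<notin> Q" using is_ideal_cong[OF subring id g(3)[OF tz(1)]] tz(2) by simp
    ultimately have d2: "g y - y \<in> ipow R Q (Suc (Suc n))"
      by (rule ipow_cancel[OF Q q action_closed[OF g(1) tz(1)] _ Suc.IH[OF y(2)], rotated])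
    have "g x - x = (g (x ^ s) - x ^ s) + (g y - y)"
      unfolding y_def action_diff[OF g(1) x xs] by simp
    then show ?case using is_idealD(3)[OF ii d1 d2] by simp
  qed
  show "g = id"
  proof
    fix x
    show "g x = id x"
    proof (cases "x \<in> R")
      case True
      have "g x - x \<in> ipow R Q n" for n
      proof (cases n)
        case 0
        then show ?thesis using action_closed[OF g(1) True] True by (simp add: is_subringD(6)[OF subring])
      qed (use *[OF True] in blast)
      then have "g x - x = 0" by (rule ipow_Inter[OF Q q])
      then show ?thesis by simp
    qed (simp add: outside g(1))
  qed
qed

end

section \<open>Square roots in extensions of an imaginary quadratic field\<close>

context integer_action
begin

context
  fixes Q :: "complex set" and q :: nat
  assumes Q: "is_prime R Q" and q: "prime q" "of_nat q \<in> Q"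
begin

lemmas ideal_Q = is_prime_ideal[OF Q]
lemmas ideal_Q2 = is_ideal_ipow[OF subring ideal_Q, of 2]

lemma one_notin_Q: "1 \<notin> Q"
  using Q by (simp add: is_prime_def)

lemma prime_Q: "a \<in> R \<Longrightarrow> b \<in> R \<Longrightarrow> a * b \<in> Q \<Longrightarrow> a \<in> Q \<or> b \<in> Q"
  using Q by (simp add: is_prime_def)

lemma of_int_Q: "of_int n \<in> Q \<longleftrightarrow> int q dvd n"
  by (rule is_ideal_of_int_dvd[OF subring ideal_Q one_notin_Q q])

lemma mult_Q2: "a \<in> Q \<Longrightarrow> b \<in> Q \<Longrightarrow> a * b \<in> ipow R Q 2"
  using ipow_mult[OF subring ideal_Q, of a 1 b 1] ipow_1[OF subring ideal_Q] by (simp add: numeral_2_eq_2)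

lemma square_Q2: "a \<in> Q \<Longrightarrow> a\<^sup>2 \<in> ipow R Q 2"
  using mult_Q2[of a a] by (simp add: power2_eq_square)

lemma cancel_Q2: "u \<in> R \<Longrightarrow> u \<notin> Q \<Longrightarrow> a \<in> Q \<Longrightarrow> u * a \<in> ipow R Q 2 \<Longrightarrow> a \<in> ipow R Q 2"
  using ipow_cancel[OF Q q, of u a 1] ipow_1[OF subring ideal_Q] by (simp add: numeral_2_eq_2)

text \<open>\<open>\<delta>\<close> lies in \<open>Q\<close>, so its square \<open>q * d1\<close>
  lies in the square of \<open>Q\<close>, and \<open>d1\<close> is prime to
  \<open>q\<close>.\<close>

lemma ramified_of_dvd:
  assumes d: "\<delta> \<in> R" "\<delta>\<^sup>2 = of_int d" "int q dvd d" "\<not> (int q)\<^sup>2 dvd d"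
  shows "of_nat q \<in> ipow R Q 2"
proof -
  obtain d1 where d1: "d = int q * d1" using d(3) by (elim dvdE)
  then have n: "\<not> int q dvd d1" using d(4) by (auto simp: power2_eq_square)
  have "\<delta>\<^sup>2 \<in> Q" using d(2,3) of_int_Q by simp
  then have "\<delta>\<^sup>2 \<in> ipow R Q 2" by (intro square_Q2 is_prime_power[OF subring Q d(1)])
  then have "of_int d1 * of_nat q \<in> ipow R Q 2" by (simp add: d(2) d1 mult.commute)
  then show ?thesis using n of_int_Q by (intro cancel_Q2[OF is_subring_of_int[OF subring] _ q(2)]) auto
qed

context
  fixes N :: nat and \<omega> :: complex
  assumes w: "\<omega> \<in> R" "\<omega>\<^sup>2 = - of_nat N"
begin

text \<open>
  Membership in \<open>Q\<^sup>2\<close> of \<open>q\<close>, and of a uniformizer when \<open>q\<close> ramifies in the quadratic field, forces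
  all of \<open>Q \<inter> \<rat>(\<omega>)\<close> into \<open>Q\<^sup>2\<close>.
\<close>

lemma quadratic_in_Q2:
  assumes pi: "\<pi> \<in> R" "\<pi> \<in> Q" "2 * \<pi> = of_int a + of_int b * \<omega>" "4 dvd a\<^sup>2 + int N * b\<^sup>2"
    and q2: "of_nat q \<in> ipow R Q 2"
    and N: "squarefree N"
    and cases: "(odd q \<and> \<not> q dvd N) \<or> (q = 2 \<and> (1 + \<omega>) / 2 \<in> R) \<or>
      (q = 2 \<and> odd N \<and> 1 + \<omega> \<in> ipow R Q 2) \<or> (q = 2 \<and> even N \<and> \<omega> \<in> ipow R Q 2)"
  shows "\<pi> \<in> ipow R Q 2"
proof -
  note Ii = is_subring_of_int[OF subring]
  \<comment> \<open>\<open>of_int a - \<pi>\<close> is the conjugate of \<open>\<pi>\<close> in the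
    quadratic field, \<open>a\<close> its trace and \<open>n\<close> below its norm.\<close>
  have pib: "of_int a - \<pi> \<in> R" using pi(1) by (intro is_subringD(6)[OF subring] Ii)
  obtain n where n: "a\<^sup>2 + int N * b\<^sup>2 = 4 * n" using pi(4) by (elim dvdE)
  have "4 * ((of_int a - \<pi>) * \<pi>) = (2 * of_int a - 2 * \<pi>) * (2 * \<pi>)" by (simp add: algebra_simps)
  also have "\<dots> = (of_int a)\<^sup>2 - (of_int b)\<^sup>2 * \<omega>\<^sup>2"
    unfolding pi(3) by (simp add: algebra_simps power2_eq_square)
  also have "\<dots> = of_int (a\<^sup>2 + int N * b\<^sup>2)" by (simp add: w(2))
  also have "\<dots> = 4 * of_int n" by (simp add: n)
  finally have prod: "(of_int a - \<pi>) * \<pi> = of_int n" by simp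
  have nQ: "int q dvd n"
    using is_idealD(4)[OF ideal_Q pib pi(2)] of_int_Q unfolding prod by simp
  \<comment> \<open>If \<open>q\<close> does not divide the trace, the conjugate is outside
    \<open>Q\<close> and can be cancelled from the norm, a multiple of \<open>q\<close>. If it does,
    \<open>a\<close> and \<open>b\<close> turn out to be multiples of \<open>q\<close>.\<close>
  show ?thesis
  proof (cases "int q dvd a")
    case False
    then have "of_int a - \<pi> \<notin> Q"
      using is_idealD(3)[OF ideal_Q _ pi(2), of "of_int a - \<pi>"] of_int_Q by auto
    moreover have "of_int n \<in> ipow R Q 2"
    proof -
      obtain k where "n = int q * k" using nQ by (elim dvdE)
      then have "(of_int n :: complex) = of_int k * of_nat q" by simp
      then show ?thesis using is_idealD(4)[OF ideal_Q2 Ii q2] by simp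
    qed
    ultimately show ?thesis using cancel_Q2[OF pib _ pi(2)] unfolding prod by blast
  next
    case True
    show ?thesis
    proof (cases "odd q")
      case odd: True
      then have nd: "\<not> q dvd N" using cases by auto
      have "int q dvd int N * b\<^sup>2"
      proof -
        have "int q dvd a\<^sup>2 + int N * b\<^sup>2" using n nQ by simp
        moreover have "int q dvd a\<^sup>2" using True by (simp add: power2_eq_square)
        ultimately show ?thesis using dvd_add_right_iff by blast
      qed
      moreover have pq: "prime (int q)" using q(1) by simp
      ultimately have "int q dvd b" using nd pq by (simp add: prime_dvd_mult_iff prime_dvd_power_iff)
      then obtain a' b' where ab: "a = int q * a'" "b = int q * b'" using True by (elim dvdE)
      have "2 * \<pi> = (of_int a' + of_int b' * \<omega>) * of_nat q" unfolding pi(3) ab by (simp add: algebra_simps)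
      also have "\<dots> \<in> ipow R Q 2"
        by (intro is_idealD(4)[OF ideal_Q2 _ q2] is_subringD(4,5)[OF subring] Ii w)
      finally have "of_int 2 * \<pi> \<in> ipow R Q 2" by simp
      moreover have "of_int 2 \<notin> Q" unfolding of_int_Q
      proof
        assume "int q dvd 2"
        then have "int q dvd int 2" by simp
        then have "q dvd 2" by (simp only: int_dvd_int_iff)
        then have "q \<le> 2" by (rule dvd_imp_le) simp
        then show False using odd prime_ge_2_nat[OF q(1)] by auto
      qed
      ultimately show ?thesis using cancel_Q2[OF Ii _ pi(2), of 2] by blast
    next
      case False
      then have q_eq: "q = 2" using q(1) prime_odd_nat[OF q(1)] prime_ge_2_nat[OF q(1)] by linarith
      have two: "2 \<in> ipow R Q 2" using q2 q_eq by simp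
      have "even a" using True q_eq by simp
      moreover have "even b"
      proof (rule ccontr)
        assume "odd b"
        have "4 dvd a\<^sup>2" using \<open>even a\<close> by (auto simp: power2_eq_square elim!: evenE)
        then have "4 dvd int N * b\<^sup>2" using pi(4) by (simp add: dvd_add_right_iff)
        moreover have "coprime 4 (b\<^sup>2)"
        proof -
          have "coprime (2 ^ 2) (b\<^sup>2)" using \<open>odd b\<close> by (simp only: coprime_power_left_iff coprime_power_right_iff) simp
          then show ?thesis by simp
        qed
        ultimately have "4 dvd int N" by (simp add: coprime_dvd_mult_left_iff)
        then have "int (2\<^sup>2) dvd int N" by simp
        then have "2\<^sup>2 dvd N" by (simp only: int_dvd_int_iff)
        then show False using N by (metis squarefreeD nat_dvd_1_iff_1 numeral_eq_one_iff semiring_norm(85))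
      qed
      ultimately obtain a' b' where ab: "a = 2 * a'" "b = 2 * b'" by (elim evenE)
      have "2 * \<pi> = 2 * (of_int a' + of_int b' * \<omega>)" using pi(3) by (simp add: ab distrib_left mult.assoc)
      then have pi': "\<pi> = of_int a' + of_int b' * \<omega>" by (simp only: mult_cancel_left) simp
      have n': "n = a'\<^sup>2 + int N * b'\<^sup>2" using n by (simp add: ab power_mult_distrib)
      then have ev: "even (a'\<^sup>2 + int N * b'\<^sup>2)" using nQ q_eq by simp
      have ev2: "of_int k \<in> ipow R Q 2" if "even k" for k
      proof -
        obtain l where "k = 2 * l" using \<open>even k\<close> by (elim evenE)
        then have "(of_int k :: complex) = of_int l * 2" by simp
        then show ?thesis using is_idealD(4)[OF ideal_Q2 Ii two] by simp
      qed
      \<comment> \<open>In each case the parity of the norm allows \<open>\<pi>\<close> to be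
        written as an even integer plus a multiple of the element known to be in the square of
        \<open>Q\<close>: twice \<open>(1 + \<omega>) / 2\<close>, \<open>1 + \<omega>\<close> or
        \<open>\<omega>\<close>.\<close>
      consider "(1 + \<omega>) / 2 \<in> R" | "odd N" "1 + \<omega> \<in> ipow R Q 2" | "even N" "\<omega> \<in> ipow R Q 2"
        using cases q_eq by auto
      then show ?thesis
      proof cases
        case 3
        then have "even a'" using ev by simp
        then show ?thesis
          unfolding pi' using 3 by (intro is_idealD(3,4)[OF ideal_Q2] ev2 Ii)
      next
        case 2
        then have "even (a' - b')" using ev by simp
        then have "of_int (a' - b') + of_int b' * (1 + \<omega>) \<in> ipow R Q 2"
          by (intro is_idealD(3)[OF ideal_Q2 _ is_idealD(4)[OF ideal_Q2 Ii 2(2)]] ev2)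
        then show ?thesis unfolding pi' by (simp add: algebra_simps)
      next
        case 1
        have "odd N"
        proof
          assume "even N"
          then obtain M where M: "N = 2 * M" by (elim evenE)
          have "algebraic_int ((1 + \<omega>) / 2 * ((1 + \<omega>) / 2) - (1 + \<omega>) / 2)"
            using integral[OF 1] by (intro algebraic_int_diff algebraic_int_times)
          also have "(1 + \<omega>) / 2 * ((1 + \<omega>) / 2) - (1 + \<omega>) / 2 = (\<omega>\<^sup>2 - 1) / 4"
            by (simp add: field_simps power2_eq_square)
          also have "\<dots> = of_int (- int N - 1) / 4" by (simp add: w(2))
          finally have "of_int (- int N - 1) / 4 \<in> (\<int> :: complex set)"
            by (rule rational_algebraic_int_is_int) auto
          then obtain k where "of_int (- int N - 1) / 4 = (of_int k :: complex)" by (elim Ints_cases)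
          then have "(of_int (- int N - 1) :: complex) = of_int (4 * k)" by (simp add: field_simps)
          then have "- int N - 1 = 4 * k" by (simp only: of_int_eq_iff)
          then show False using M by presburger
        qed
        then have "even (a' - b')" using ev by simp
        moreover have "(of_int b' * ((1 + \<omega>) / 2)) * 2 \<in> ipow R Q 2"
          using 1 two by (intro is_idealD(4)[OF ideal_Q2] is_subringD(5)[OF subring] Ii)
        ultimately have "of_int (a' - b') + (of_int b' * ((1 + \<omega>) / 2)) * 2 \<in> ipow R Q 2"
          by (intro is_idealD(3)[OF ideal_Q2] ev2)
        then show ?thesis unfolding pi' by (simp add: algebra_simps)
      qed
    qed
  qed
qed

text \<open>\<open>1 + \<delta>\<close> is a local generator at 2 in the field of
  \<open>\<delta>\<close>: its square is 2 times an element outside \<open>Q\<close>. All the data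
  are handed out, because \<open>ramified_3_mod_4_even\<close> builds a further extension on
  them.\<close>

lemma ramified_3_mod_4:
  assumes q_eq: "q = 2" and d: "\<delta> \<in> R" "\<delta>\<^sup>2 = of_int d" "d mod 4 = 3"
  obtains k where "1 + d = 4 * k" "(1 + \<delta>)\<^sup>2 = (\<delta> + of_int (2 * k)) * 2" "1 + \<delta> \<in> Q"
    "\<delta> + of_int (2 * k) \<notin> Q" "2 \<in> ipow R Q 2"
proof -
  have two: "2 \<in> Q" using q(2) q_eq by simp
  have "4 dvd 1 + d" using d(3) by presburger
  then obtain k where k: "1 + d = 4 * k" by (elim dvdE)
  have "of_int (1 + d) = (of_int (4 * k) :: complex)" using k by simp
  then have k': "1 + \<delta>\<^sup>2 = 4 * of_int k" by (simp add: d(2))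
  then have sq: "(1 + \<delta>)\<^sup>2 = (\<delta> + of_int (2 * k)) * 2" by (simp add: power2_eq_square algebra_simps)
  have uR: "\<delta> + of_int (2 * k) \<in> R" by (intro is_subringD(4)[OF subring] d is_subring_of_int[OF subring])
  have "(1 + \<delta>)\<^sup>2 \<in> Q" unfolding sq by (rule is_idealD(4)[OF ideal_Q uR two])
  then have v: "1 + \<delta> \<in> Q"
    using is_prime_power[OF subring Q _ \<open>(1 + \<delta>)\<^sup>2 \<in> Q\<close>] is_subringD(2,4)[OF subring] d(1) by blast
  have u: "\<delta> + of_int (2 * k) \<notin> Q"
  proof
    assume "\<delta> + of_int (2 * k) \<in> Q"
    moreover have "of_int (2 * k) \<in> Q" using of_int_Q[of "2 * k"] q_eq by (simp del: of_int_mult)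
    ultimately have "\<delta> + of_int (2 * k) - of_int (2 * k) \<in> Q" by (rule is_ideal_diff[OF subring ideal_Q])
    then have "1 + \<delta> - \<delta> \<in> Q" using v by (intro is_ideal_diff[OF subring ideal_Q]) simp_all
    then show False using one_notin_Q by simp
  qed
  have "2 \<in> ipow R Q 2" using square_Q2[OF v] unfolding sq by (rule cancel_Q2[OF uR u two])
  then show ?thesis using that k sq v u by blast
qed

text \<open>Here 2 ramifies already in the field of \<open>\<omega>\<close>, with local generator
  \<open>1 + \<omega>\<close>, whose norm is twice the odd number \<open>M\<close>. Adjoining
  \<open>\<delta>\<close> ramifies once more: up to factors outside \<open>Q\<close>,
  \<open>1 + \<omega>\<close> is the square of \<open>\<eta> + 1\<close>.\<close>

lemma ramified_even_1_mod_4: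
  assumes q_eq: "q = 2" and N: "N mod 4 = 1" and d: "\<delta> \<in> R" "\<delta>\<^sup>2 = of_int d" "even d" "\<not> 4 dvd d"
  shows "2 \<in> ipow R Q 2 \<and> 1 + \<omega> \<in> ipow R Q 2"
proof -
  note Ii = is_subring_of_int[OF subring]
  note R_intros = is_subringD(4,5,6,2)[OF subring] Ii w(1) d(1)
  have two: "2 \<in> Q" using q(2) q_eq by simp
  obtain d1 where d1: "d = 2 * d1" using d(3) by (elim evenE)
  then have "odd d1" using d(4) by auto
  then have "\<exists>e. d1 = 2 * e - 1" by presburger
  then obtain e where e: "d1 = 2 * e - 1" by blast
  define m where "m = N div 4"
  have m: "N = 4 * m + 1" using N div_mult_mod_eq[of N 4] by (simp add: m_def)
  define M :: int where "M = 2 * int m + 1"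
  have MQ: "of_int M \<notin> Q" using of_int_Q[of M] q_eq by (simp add: M_def del: of_int_add of_int_mult)
  have w2: "\<omega> * \<omega> = - 4 * of_nat m - 1" using w(2) by (simp add: m power2_eq_square)
  have norm: "(1 + \<omega>) * (1 - \<omega>) = of_int M * 2" by (simp add: algebra_simps w2 M_def)
  have dd: "\<delta> * \<delta> = 2 * of_int d1" using d(2) by (simp add: d1 power2_eq_square)
  \<comment> \<open>With 2 of valuation 1, both \<open>\<delta>\<close> and
    \<open>1 - \<omega>\<close> have valuation 1/2, so \<open>\<eta>\<close> is a local unit. Its
    residue is 1, and \<open>\<eta> + 1\<close> has half the valuation of
    \<open>1 + \<omega>\<close>.\<close>
  define \<eta> where "\<eta> = \<delta> * (1 - \<omega>) / 2"
  have "4 * \<eta>\<^sup>2 = (\<delta> * \<delta>) * ((1 - \<omega>) * (1 - \<omega>))" by (simp add: \<eta>_def power2_eq_square)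
  also have "(1 - \<omega>) * (1 - \<omega>) = - 4 * of_nat m - 2 * \<omega>" by (simp add: algebra_simps w2)
  finally have "4 * \<eta>\<^sup>2 = 4 * (of_int d1 * (- 2 * of_nat m - \<omega>))" unfolding dd by (simp add: algebra_simps)
  then have eta2: "\<eta>\<^sup>2 = of_int d1 * (- 2 * of_nat m - \<omega>)" by simp
  have "- 2 * of_nat m - \<omega> = of_int (- 2 * int m) - \<omega>" by simp
  also have "\<dots> \<in> R" by (intro R_intros)
  finally have "- 2 * of_nat m - \<omega> \<in> R" .
  then have "\<eta>\<^sup>2 \<in> R" unfolding eta2 by (intro is_subringD(5)[OF subring] Ii)
  then have "algebraic_int \<eta>" using algebraic_int_square_root integral by blast
  moreover have "\<delta> * (1 - \<omega>) \<in> R" by (intro R_intros)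
  ultimately have etaR: "\<eta> \<in> R" using saturated[of "\<delta> * (1 - \<omega>)" 2] by (simp add: \<eta>_def)
  \<comment> \<open>\<open>x\<close> is read off from
    \<open>(\<eta> + 1)\<^sup>2 = (1 + \<omega>) + 2 * x\<close>. Multiplying by \<open>M\<close>
    and replacing \<open>M * 2\<close> by the norm of \<open>1 + \<omega>\<close> makes the right
    side divisible by \<open>1 + \<omega>\<close>, with quotient \<open>u\<close>.\<close>
  define x where "x = \<eta> - of_int e * \<omega> - of_int (int m * d1)"
  define u where "u = of_int M + (1 - \<omega>) * x"
  have xR: "x \<in> R" unfolding x_def by (intro R_intros etaR)
  have eq: "of_int M * (\<eta> + 1)\<^sup>2 = u * (1 + \<omega>)"
  proof -
    have "(\<eta> + 1)\<^sup>2 = \<eta>\<^sup>2 + 1 + 2 * \<eta>" by (simp add: power2_eq_square algebra_simps)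
    also have "\<dots> = (1 + \<omega>) + 2 * x" unfolding eta2 x_def e by (simp add: algebra_simps)
    finally have "of_int M * (\<eta> + 1)\<^sup>2 = of_int M * (1 + \<omega>) + of_int M * 2 * x" by (simp add: algebra_simps)
    also have "\<dots> = u * (1 + \<omega>)" unfolding norm[symmetric] u_def by (simp add: algebra_simps)
    finally show ?thesis .
  qed
  have "(1 + \<omega>) * (1 - \<omega>) \<in> Q" unfolding norm by (rule is_idealD(4)[OF ideal_Q Ii two])
  then have "1 + \<omega> \<in> Q \<or> 1 - \<omega> \<in> Q" by (intro prime_Q R_intros)
  moreover have "(1 + \<omega>) + (1 - \<omega>) = 2" by simp
  ultimately have pQ: "1 + \<omega> \<in> Q" "1 - \<omega> \<in> Q"
    using is_ideal_diff[OF subring ideal_Q two, of "1 + \<omega>"] is_ideal_diff[OF subring ideal_Q two, of "1 - \<omega>"]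
    by auto
  have uQ: "u \<notin> Q"
  proof
    assume "u \<in> Q"
    moreover have "(1 - \<omega>) * x \<in> Q" using is_idealD(5)[OF ideal_Q xR pQ(2)] .
    ultimately have "u - (1 - \<omega>) * x \<in> Q" by (rule is_ideal_diff[OF subring ideal_Q])
    then show False using MQ by (simp add: u_def)
  qed
  have uR: "u \<in> R" unfolding u_def by (intro R_intros xR)
  have "of_int M * (\<eta> + 1)\<^sup>2 \<in> Q" unfolding eq by (rule is_idealD(4)[OF ideal_Q uR pQ(1)])
  moreover have e1R: "\<eta> + 1 \<in> R" by (intro R_intros etaR)
  ultimately have "(\<eta> + 1)\<^sup>2 \<in> Q"
    using prime_Q[OF Ii is_subring_power[OF subring e1R]] MQ by blast
  then have "(\<eta> + 1)\<^sup>2 \<in> ipow R Q 2" by (intro square_Q2 is_prime_power[OF subring Q e1R])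
  then have "u * (1 + \<omega>) \<in> ipow R Q 2" unfolding eq[symmetric] by (rule is_idealD(4)[OF ideal_Q2 Ii])
  then have p2: "1 + \<omega> \<in> ipow R Q 2" by (rule cancel_Q2[OF uR uQ pQ(1)])
  have "1 - \<omega> \<in> R" by (intro R_intros)
  then have "of_int M * 2 \<in> ipow R Q 2" unfolding norm[symmetric] by (rule is_idealD(5)[OF ideal_Q2 _ p2])
  then show ?thesis using cancel_Q2[OF Ii MQ two] p2 by blast
qed

text \<open>The roles are exchanged compared with \<open>ramified_even_1_mod_4\<close>:
  \<open>v = 1 + \<delta>\<close> generates locally in the field of \<open>\<delta>\<close>, and
  \<open>\<eta> = v * \<omega> / 2\<close> has \<open>(\<eta> + 1)\<^sup>2 = v + 2 * x\<close>. This
  puts \<open>v\<close> into the square of \<open>Q\<close>, and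
  \<open>u * \<omega> = v * \<eta>\<close> transfers it to \<open>\<omega>\<close>.\<close>

lemma ramified_3_mod_4_even:
  assumes q_eq: "q = 2" and N: "even N" and d: "\<delta> \<in> R" "\<delta>\<^sup>2 = of_int d" "d mod 4 = 3"
    and N4: "\<not> 4 dvd N"
  shows "2 \<in> ipow R Q 2 \<and> \<omega> \<in> ipow R Q 2"
proof -
  note Ii = is_subring_of_int[OF subring]
  note R_intros = is_subringD(4,5,6,2)[OF subring] Ii w(1) d(1)
  have two: "2 \<in> Q" using q(2) q_eq by simp
  obtain k where k: "1 + d = 4 * k" "(1 + \<delta>)\<^sup>2 = (\<delta> + of_int (2 * k)) * 2" "1 + \<delta> \<in> Q"
    "\<delta> + of_int (2 * k) \<notin> Q" "2 \<in> ipow R Q 2"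
    using ramified_3_mod_4[OF q_eq d] .
  obtain N1 where N1: "N = 2 * N1" using N by (elim evenE)
  then have "odd N1" using N4 by auto
  then obtain n1 where n1: "N1 = 2 * n1 + 1" by (elim oddE)
  define v where "v = 1 + \<delta>"
  define u where "u = \<delta> + of_int (2 * k)"
  define \<eta> where "\<eta> = v * \<omega> / 2"
  have uR: "u \<in> R" unfolding u_def by (intro R_intros)
  have vR: "v \<in> R" unfolding v_def by (intro R_intros)
  have w2: "\<omega> * \<omega> = - 2 * of_nat N1" using w(2) by (simp add: N1 power2_eq_square)
  have v2: "v * v = u * 2" using k(2) by (simp add: v_def u_def power2_eq_square)
  have "4 * \<eta>\<^sup>2 = (v * v) * (\<omega> * \<omega>)" by (simp add: \<eta>_def power2_eq_square)
  then have eta2: "\<eta>\<^sup>2 = of_int (- int N1) * u" unfolding v2 w2 by simp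
  have "\<eta>\<^sup>2 \<in> R" unfolding eta2 by (intro R_intros uR)
  then have "algebraic_int \<eta>" using algebraic_int_square_root integral by blast
  moreover have "v * \<omega> \<in> R" by (intro R_intros vR)
  ultimately have etaR: "\<eta> \<in> R" using saturated[of "v * \<omega>" 2] by (simp add: \<eta>_def)
  define x where "x = \<eta> - of_int (int n1 + 1) * \<delta> - of_int (k * int N1)"
  have xR: "x \<in> R" unfolding x_def by (intro R_intros etaR)
  have "(\<eta> + 1)\<^sup>2 = \<eta>\<^sup>2 + 1 + 2 * \<eta>" by (simp add: power2_eq_square algebra_simps)
  also have "\<dots> = v + x * 2" unfolding eta2 x_def u_def v_def by (simp add: n1 algebra_simps)
  finally have eq: "(\<eta> + 1)\<^sup>2 = v + x * 2" .
  have vQ: "v \<in> Q" using k(3) by (simp add: v_def)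
  have uQ: "u \<notin> Q" using k(4) by (simp add: u_def)
  have "(\<eta> + 1)\<^sup>2 \<in> Q" unfolding eq by (intro is_idealD(3)[OF ideal_Q vQ] is_idealD(4)[OF ideal_Q xR two])
  moreover have e1R: "\<eta> + 1 \<in> R" by (intro R_intros etaR)
  ultimately have "(\<eta> + 1)\<^sup>2 \<in> ipow R Q 2" by (intro square_Q2 is_prime_power[OF subring Q e1R])
  then have "v + x * 2 - x * 2 \<in> ipow R Q 2"
    unfolding eq by (rule is_ideal_diff[OF subring ideal_Q2 _ is_idealD(4)[OF ideal_Q2 xR k(5)]])
  then have v2': "v \<in> ipow R Q 2" by simp
  have v0: "v \<noteq> 0" using v2 uQ is_idealD(2)[OF ideal_Q] by auto
  have "v * (u * \<omega>) = v * (v * \<eta>)"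
  proof -
    have "v * (u * \<omega>) = u * (v * \<omega>)" by (simp add: algebra_simps)
    also have "\<dots> = (u * 2) * \<eta>" by (simp add: \<eta>_def)
    also have "\<dots> = v * (v * \<eta>)" unfolding v2[symmetric] by (simp add: mult.assoc)
    finally show ?thesis .
  qed
  then have "u * \<omega> = v * \<eta>" using v0 by simp
  also have "\<dots> \<in> ipow R Q 2" by (rule is_idealD(5)[OF ideal_Q2 etaR v2'])
  finally have uw: "u * \<omega> \<in> ipow R Q 2" .
  have "\<omega>\<^sup>2 = of_int (- int N1) * 2" by (simp add: power2_eq_square w2)
  also have "\<dots> \<in> Q" by (rule is_idealD(4)[OF ideal_Q Ii two])
  finally have "\<omega> \<in> Q" by (rule is_prime_power[OF subring Q w(1)])
  then show ?thesis using cancel_Q2[OF uR uQ _ uw] k(5) by blast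
qed

end

end

end

section \<open>Minkowski's theorem on linear forms\<close>

context
  fixes n :: nat and B :: "nat \<Rightarrow> nat \<Rightarrow> int"
begin

definition lattice_of :: "(nat \<Rightarrow> int) set" where
  "lattice_of = {x. \<exists>z. \<forall>i<n. x i = (\<Sum>j<n. B i j * z j)}"

lemma lattice_ofI: "(\<And>i. i < n \<Longrightarrow> x i = (\<Sum>j<n. B i j * z j)) \<Longrightarrow> x \<in> lattice_of"
  unfolding lattice_of_def mem_Collect_eq by (intro exI[of _ z]) simp

lemma lattice_of_diff:
  assumes "x \<in> lattice_of" "y \<in> lattice_of" shows "(\<lambda>i. x i - c * y i) \<in> lattice_of"
proof -
  obtain u v where "\<forall>i<n. x i = (\<Sum>j<n. B i j * u j)" "\<forall>i<n. y i = (\<Sum>j<n. B i j * v j)"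
    using assms by (auto simp: lattice_of_def)
  then have "\<forall>i<n. x i - c * y i = (\<Sum>j<n. B i j * (u j - c * v j))"
    by (simp add: right_diff_distrib sum_subtractf sum_distrib_left mult.left_commute)
  then show ?thesis by (intro lattice_ofI[of _ "\<lambda>j. u j - c * v j"]) blast
qed

lemma lattice_of_uminus_cong:
  assumes "x \<in> lattice_of" "\<And>i. i < n \<Longrightarrow> y i = x i" shows "y \<in> lattice_of"
  using assms by (auto simp: lattice_of_def)

context
  assumes det: "det (mat n n (\<lambda>(i, j). B i j)) \<noteq> 0"
begin

text \<open>The columns of the adjugate matrix are the coefficients: the product of a matrix with
  its adjugate is the determinant times the identity.\<close>

lemma lattice_of_det: "i < n \<Longrightarrow> (\<lambda>k. if k = i then det (mat n n (\<lambda>(i, j). B i j)) else 0) \<in> lattice_of"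
proof -
  assume i: "i < n"
  define A where "A = mat n n (\<lambda>(i, j). B i j)"
  have A: "A \<in> carrier_mat n n" by (simp add: A_def)
  note adj = adj_mat[OF A]
  have "(\<Sum>j<n. B k j * adj_mat A $$ (j, i)) = (if k = i then det A else 0)" if k: "k < n" for k
  proof -
    have "(A * adj_mat A) $$ (k, i) = (\<Sum>j<n. B k j * adj_mat A $$ (j, i))"
      using k i A adj(1) by (simp add: scalar_prod_def A_def atLeast0LessThan)
    moreover have "(A * adj_mat A) $$ (k, i) = (if k = i then det A else 0)"
      unfolding adj(2) using k i by simp
    ultimately show ?thesis by simp
  qed
  then show ?thesis unfolding lattice_of_def A_def by (auto intro!: exI[of _ "\<lambda>j. adj_mat A $$ (j, i)"] simp: A_def)
qed

text \<open>The vectors with least positive leading entries span the lattice, so the given matrix is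
  \<open>T * W\<close> with \<open>T\<close> triangular and \<open>W\<close> integral. Hence the
  determinant of \<open>T\<close> divides the given one, which is the bound claimed.\<close>

lemma lattice_of_triangular_basis:
  obtains t where "\<And>i. i < n \<Longrightarrow> t i \<in> lattice_of" "\<And>i. i < n \<Longrightarrow> t i i > 0"
    "\<And>i k. i < n \<Longrightarrow> k < i \<Longrightarrow> t i k = 0" "(\<Prod>i<n. t i i) \<le> \<bar>det (mat n n (\<lambda>(i, j). B i j))\<bar>"
proof -
  define A where "A = mat n n (\<lambda>(i, j). B i j)"
  \<comment> \<open>The possible positive entries at \<open>i\<close> of lattice vectors that vanish
    before \<open>i\<close>. By division with remainder the least one divides all such
    entries.\<close>
  define S where "S i = {m :: nat. m > 0 \<and> (\<exists>x\<in>lattice_of. (\<forall>k<i. x k = 0) \<and> x i = int m)}" for i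
  have ne: "\<exists>m. m \<in> S i" if "i < n" for i
  proof -
    define x where "x = (\<lambda>k. if k = i then det A else 0)"
    have x: "x \<in> lattice_of" unfolding x_def A_def by (rule lattice_of_det[OF that])
    have zero: "(\<lambda>k. 0) \<in> lattice_of" using lattice_of_diff[OF x x, of 1] by simp
    have "(\<lambda>k. - x k) \<in> lattice_of" using lattice_of_diff[OF zero x, of 1] by simp
    then have "(\<lambda>k. \<bar>x k\<bar>) \<in> lattice_of"
      using x lattice_of_uminus_cong[of _ "\<lambda>k. \<bar>x k\<bar>"] by (cases "det A \<ge> 0") (auto simp: x_def)
    then show ?thesis using det
      by (intro exI[of _ "nat \<bar>det A\<bar>"]) (auto simp: S_def x_def A_def intro!: bexI[of _ "\<lambda>k. \<bar>x k\<bar>"])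
  qed
  define d where "d i = (LEAST m. m \<in> S i)" for i
  have dS: "d i \<in> S i" if "i < n" for i using LeastI_ex[OF ne[OF that]] by (simp add: d_def)
  then have "\<forall>i. \<exists>x. i < n \<longrightarrow> x \<in> lattice_of \<and> (\<forall>k<i. x k = 0) \<and> x i = int (d i)"
    by (auto simp: S_def)
  then obtain t where t: "\<And>i. i < n \<Longrightarrow> t i \<in> lattice_of" "\<And>i k. i < n \<Longrightarrow> k < i \<Longrightarrow> t i k = 0"
    "\<And>i. i < n \<Longrightarrow> t i i = int (d i)" by metis
  have dpos: "d i > 0" if "i < n" for i using dS[OF that] by (simp add: S_def)
  have ddvd: "int (d i) dvd x i" if i: "i < n" and x: "x \<in> lattice_of" "\<And>k. k < i \<Longrightarrow> x k = 0" for i x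
  proof (rule ccontr)
    assume nd: "\<not> int (d i) dvd x i"
    define y where "y = (\<lambda>k. x k - (x i div int (d i)) * t i k)"
    have y: "y \<in> lattice_of" unfolding y_def by (rule lattice_of_diff[OF x(1) t(1)[OF i]])
    have yi: "y i = x i mod int (d i)"
      unfolding y_def t(3)[OF i] by (simp add: minus_div_mult_eq_mod)
    have "y i > 0" using nd dpos[OF i] unfolding yi
      by (metis dvd_eq_mod_eq_0 of_nat_0_less_iff order_le_less pos_mod_sign)
    moreover have "\<forall>k<i. y k = 0" using x(2) t(2)[OF i] by (simp add: y_def)
    ultimately have "nat (y i) \<in> S i" using y by (auto simp: S_def intro!: bexI[of _ y])
    then have "d i \<le> nat (y i)" unfolding d_def by (rule Least_le)
    moreover have "y i < int (d i)" unfolding yi using dpos[OF i] by simp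
    ultimately show False using \<open>y i > 0\<close> by linarith
  qed
  have span: "\<exists>c. \<forall>k<n. x k = (\<Sum>i<n. c i * t i k)"
    if "m \<le> n" "x \<in> lattice_of" "\<And>k. k < n - m \<Longrightarrow> x k = 0" for m x
    using that
  proof (induction m arbitrary: x)
    case 0
    then show ?case by (intro exI[of _ "\<lambda>_. 0"]) auto
  next
    case (Suc m)
    define i where "i = n - Suc m"
    have i: "i < n" "n - m = Suc i" using Suc.prems(1) by (auto simp: i_def)
    obtain a where a: "x i = int (d i) * a" using ddvd[OF i(1) Suc.prems(2)] Suc.prems(3) i_def by auto
    define y where "y = (\<lambda>k. x k - a * t i k)"
    have "y \<in> lattice_of" unfolding y_def by (rule lattice_of_diff[OF Suc.prems(2) t(1)[OF i(1)]])
    moreover have "y k = 0" if "k < n - m" for k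
      using that Suc.prems(3)[of k] t(2)[OF i(1), of k] t(3)[OF i(1)] a i(2)
      by (cases "k = i") (auto simp: y_def i_def)
    ultimately obtain c where c: "\<forall>k<n. y k = (\<Sum>l<n. c l * t l k)" using Suc.IH Suc.prems(1) by fastforce
    have "x k = (\<Sum>l<n. (c l + (if l = i then a else 0)) * t l k)" if "k < n" for k
    proof -
      have "(\<Sum>l<n. (if l = i then a else 0) * t l k) = a * t i k"
        using i(1) by (subst sum.remove[of _ i]) auto
      moreover have "x k = y k + a * t i k" by (simp add: y_def)
      ultimately show ?thesis using c that by (simp add: distrib_right sum.distrib)
    qed
    then show ?case by (intro exI[of _ "\<lambda>l. c l + (if l = i then a else 0)"]) simp
  qed
  have "\<exists>c. \<forall>k<n. B k j = (\<Sum>i<n. c i * t i k)" if j: "j < n" for j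
  proof (rule span[of n])
    have "B k j = (\<Sum>l<n. B k l * (if l = j then 1 else 0))" for k
      using j by (subst sum.remove[of _ j]) auto
    then show "(\<lambda>k. B k j) \<in> lattice_of" by (rule lattice_ofI)
  qed auto
  then obtain V where V: "\<And>j k. j < n \<Longrightarrow> k < n \<Longrightarrow> B k j = (\<Sum>i<n. V j i * t i k)" by metis
  define T where "T = mat n n (\<lambda>(k, i). t i k)"
  define W where "W = mat n n (\<lambda>(i, j). V j i)"
  have TW: "T \<in> carrier_mat n n" "W \<in> carrier_mat n n" by (simp_all add: T_def W_def)
  have "A = T * W"
    by (rule eq_matI) (auto simp: A_def T_def W_def scalar_prod_def V atLeast0LessThan mult.commute)
  then have detA: "det A = det T * det W" using det_mult[OF TW] by simp
  have "det T = prod_list (diag_mat T)"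
    by (rule det_lower_triangular[OF _ TW(1)]) (auto simp: T_def t(2))
  also have "\<dots> = (\<Prod>i<n. t i i)"
    by (simp add: diag_mat_def T_def prod.list_conv_set_nth atLeast0LessThan)
  finally have detT: "det T = (\<Prod>i<n. t i i)" .
  have "\<bar>det T\<bar> \<le> \<bar>det A\<bar>"
    using det detA unfolding A_def[symmetric] by (intro dvd_imp_le_int) auto
  then have "(\<Prod>i<n. t i i) \<le> \<bar>det A\<bar>" unfolding detT by linarith
  moreover have "t i i > 0" if "i < n" for i using t(3)[OF that] dpos[OF that] by simp
  ultimately show ?thesis using that t(1,2) unfolding A_def by blast
qed

text \<open>Counting replaces volume: every integer vector is congruent modulo the lattice to one of
  the box \<open>Rd\<close>, whose size is at most the determinant, and the box \<open>P\<close> has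
  more points. Two points of \<open>P\<close> with the same representative differ by a lattice
  vector of the required size.\<close>

lemma integer_linear_forms:
  fixes b :: "nat \<Rightarrow> nat"
  assumes b: "\<bar>det (mat n n (\<lambda>(i, j). B i j))\<bar> < (\<Prod>i<n. int (b i))"
  obtains z where "\<exists>j<n. z j \<noteq> 0" "\<And>i. i < n \<Longrightarrow> \<bar>\<Sum>j<n. B i j * z j\<bar> < int (b i)"
proof -
  obtain t where t: "\<And>i. i < n \<Longrightarrow> t i \<in> lattice_of" "\<And>i. i < n \<Longrightarrow> t i i > 0"
    "\<And>i k. i < n \<Longrightarrow> k < i \<Longrightarrow> t i k = 0" "(\<Prod>i<n. t i i) \<le> \<bar>det (mat n n (\<lambda>(i, j). B i j))\<bar>"
    using lattice_of_triangular_basis by blast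
  \<comment> \<open>Coordinates are reduced in increasing order; by the triangular shape, reducing
    coordinate \<open>m\<close> leaves the earlier ones untouched.\<close>
  have red: "\<exists>r. (\<forall>i<m. 0 \<le> r i \<and> r i < t i i) \<and> (\<lambda>i. x i - r i) \<in> lattice_of" if "m \<le> n" for m x
    using that
  proof (induction m)
    case 0
    have "(\<lambda>i. x i - x i) \<in> lattice_of" by (auto simp: lattice_of_def intro!: exI[of _ "\<lambda>_. 0"])
    then show ?case by blast
  next
    case (Suc m)
    then obtain r where r: "\<forall>i<m. 0 \<le> r i \<and> r i < t i i" "(\<lambda>i. x i - r i) \<in> lattice_of" by auto
    have m: "m < n" using Suc.prems by simp
    define a where "a = r m div t m m"
    define r' where "r' = (\<lambda>i. r i - a * t m i)"
    have "(\<lambda>i. (x i - r i) - (- a) * t m i) \<in> lattice_of" by (rule lattice_of_diff[OF r(2) t(1)[OF m]])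
    then have "(\<lambda>i. x i - r' i) \<in> lattice_of" by (simp add: r'_def algebra_simps)
    moreover have "0 \<le> r' i \<and> r' i < t i i" if "i < Suc m" for i
    proof (cases "i = m")
      case True
      then have "r' i = r m mod t m m" by (simp add: r'_def a_def minus_div_mult_eq_mod)
      then show ?thesis using t(2)[OF m] True by simp
    next
      case False
      then show ?thesis using that r(1) t(3)[OF m, of i] by (simp add: r'_def)
    qed
    ultimately show ?case by blast
  qed
  define P where "P = (\<Pi>\<^sub>E i\<in>{..<n}. {0..<int (b i)})"
  define Rd where "Rd = (\<Pi>\<^sub>E i\<in>{..<n}. {0..<t i i})"
  have "\<exists>r. r \<in> Rd \<and> (\<lambda>i. x i - r i) \<in> lattice_of" for x
  proof -
    obtain r where r: "\<forall>i<n. 0 \<le> r i \<and> r i < t i i" "(\<lambda>i. x i - r i) \<in> lattice_of"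
      using red[of n x] by auto
    have "(\<lambda>i. x i - restrict r {..<n} i) \<in> lattice_of" by (rule lattice_of_uminus_cong[OF r(2)]) simp
    moreover have "restrict r {..<n} \<in> Rd" using r(1) by (auto simp: Rd_def)
    ultimately show ?thesis by blast
  qed
  then obtain \<rho> where rho: "\<And>x. \<rho> x \<in> Rd" "\<And>x. (\<lambda>i. x i - \<rho> x i) \<in> lattice_of" by metis
  have "int (card Rd) = (\<Prod>i<n. t i i)"
    unfolding Rd_def using t(2) by (simp add: card_PiE less_imp_le)
  moreover have "int (card P) = (\<Prod>i<n. int (b i))" unfolding P_def by (simp add: card_PiE)
  ultimately have "card Rd < card P" using t(4) b by linarith
  moreover have "finite Rd" unfolding Rd_def by (intro finite_PiE) auto
  ultimately have "\<not> inj_on \<rho> P"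
    using card_inj_on_le[of \<rho> P Rd] rho(1) by fastforce
  then obtain x y where xy: "x \<in> P" "y \<in> P" "x \<noteq> y" "\<rho> x = \<rho> y" by (auto simp: inj_on_def)
  have "(\<lambda>i. (x i - \<rho> x i) - 1 * (y i - \<rho> y i)) \<in> lattice_of" by (rule lattice_of_diff[OF rho(2) rho(2)])
  then have "(\<lambda>i. x i - y i) \<in> lattice_of" by (simp add: xy(4))
  then obtain z where z: "\<And>i. i < n \<Longrightarrow> x i - y i = (\<Sum>j<n. B i j * z j)" by (auto simp: lattice_of_def)
  have "\<exists>i<n. x i \<noteq> y i" using xy(1-3) unfolding P_def by (metis PiE_ext lessThan_iff)
  then obtain i where i: "i < n" "x i \<noteq> y i" by blast
  have "\<exists>j<n. z j \<noteq> 0"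
  proof (rule ccontr)
    assume "\<not> ?thesis"
    then have "(\<Sum>j<n. B i j * z j) = 0" by (intro sum.neutral) auto
    then show False using z[OF i(1)] i(2) by simp
  qed
  moreover have "\<bar>\<Sum>j<n. B i j * z j\<bar> < int (b i)" if "i < n" for i
  proof -
    have "x i \<in> {0..<int (b i)}" "y i \<in> {0..<int (b i)}" 
      using PiE_mem[OF xy(1)[unfolded P_def], of i] PiE_mem[OF xy(2)[unfolded P_def], of i] that by simp_all
    then have "\<bar>x i - y i\<bar> < int (b i)" by (simp add: abs_less_iff)
    then show ?thesis using z[OF that] by simp
  qed
  ultimately show ?thesis using that by blast
qed

end

end

section \<open>Real linear forms by approximation\<close>

lemma tendsto_det:
  fixes A :: "nat \<Rightarrow> 'a::real_normed_field mat"
  assumes "\<And>m. A m \<in> carrier_mat n n" "L \<in> carrier_mat n n"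
    and "\<And>i j. i < n \<Longrightarrow> j < n \<Longrightarrow> (\<lambda>m. A m $$ (i, j)) \<longlonglongrightarrow> L $$ (i, j)"
  shows "(\<lambda>m. det (A m)) \<longlonglongrightarrow> det L"
  unfolding det_def'[OF assms(1)] det_def'[OF assms(2)]
proof (intro tendsto_sum tendsto_mult tendsto_const tendsto_prod assms(3))
  fix p i assume "p \<in> {p. p permutes {0..<n}}" "i \<in> {0..<n}"
  then show "i < n" "p i < n" using permutes_in_image[of p "{0..<n}" i] by auto
qed

text \<open>The entries are approximated by \<open>\<lfloor>m * s i j\<rfloor> / m\<close>, to which
  the integer version applies after scaling. The constant \<open>c\<close> bounds a solution by the
  values of its forms; it controls the approximation error here and makes the set of candidates
  finite in \<open>trivial\<close>.\<close>

lemma real_linear_forms: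
  fixes s :: "nat \<Rightarrow> nat \<Rightarrow> real"
  assumes n: "n > 0" and det: "\<bar>det (mat n n (\<lambda>(i, j). s i j))\<bar> = 1"
  shows "\<exists>c. (\<forall>z. \<forall>j<n. \<bar>z j\<bar> \<le> c * (\<Sum>i<n. \<bar>\<Sum>j<n. s i j * z j\<bar>)) \<and>
    (\<forall>e. 0 < e \<and> e < 1 \<longrightarrow> (\<exists>z :: nat \<Rightarrow> int. (\<exists>j<n. z j \<noteq> 0) \<and>
       \<bar>\<Sum>j<n. s 0 j * z j\<bar> < 1 + e \<and> (\<forall>i. 0 < i \<and> i < n \<longrightarrow> \<bar>\<Sum>j<n. s i j * z j\<bar> < 1)))"
proof -
  define A where "A = mat n n (\<lambda>(i, j). s i j)"
  have A: "A \<in> carrier_mat n n" by (simp add: A_def)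
  note adj = adj_mat[OF A]
  \<comment> \<open>As the determinant is 1 or -1, the adjugate is the inverse up to sign; summing
    all its entries gives one constant for all coordinates.\<close>
  define c where "c = (\<Sum>j<n. \<Sum>i<n. \<bar>adj_mat A $$ (j, i)\<bar>)"
  have c0: "c \<ge> 0" by (simp add: c_def sum_nonneg)
  have bound: "\<bar>z j\<bar> \<le> c * (\<Sum>i<n. \<bar>\<Sum>j<n. s i j * z j\<bar>)" if j: "j < n" for z j
  proof -
    define v where "v = vec n z"
    have v: "v \<in> carrier_vec n" by (simp add: v_def)
    have "adj_mat A *\<^sub>v (A *\<^sub>v v) = (adj_mat A * A) *\<^sub>v v"
      using adj(1) A v by (simp add: assoc_mult_mat_vec[of _ n n _ n])
    also have "\<dots> = det A \<cdot>\<^sub>v v" unfolding adj(3) using v by auto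
    finally have "(adj_mat A *\<^sub>v (A *\<^sub>v v)) $ j = det A * z j" using j by (simp add: v_def)
    moreover have "(adj_mat A *\<^sub>v (A *\<^sub>v v)) $ j = (\<Sum>i<n. adj_mat A $$ (j, i) * (\<Sum>j<n. s i j * z j))"
      using j adj(1) by (simp add: A_def v_def scalar_prod_def atLeast0LessThan)
    ultimately have "\<bar>z j\<bar> = \<bar>\<Sum>i<n. adj_mat A $$ (j, i) * (\<Sum>j<n. s i j * z j)\<bar>"
      using det by (metis A_def abs_mult mult_1)
    also have "\<dots> \<le> (\<Sum>i<n. \<bar>adj_mat A $$ (j, i)\<bar> * \<bar>\<Sum>j<n. s i j * z j\<bar>)"
      by (rule order_trans[OF sum_abs]) (simp add: abs_mult)
    also have "\<dots> \<le> (\<Sum>i<n. c * \<bar>\<Sum>j<n. s i j * z j\<bar>)"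
    proof (intro sum_mono mult_right_mono)
      fix i assume i: "i \<in> {..<n}"
      have "\<bar>adj_mat A $$ (j, i)\<bar> \<le> (\<Sum>i<n. \<bar>adj_mat A $$ (j, i)\<bar>)"
        using i by (intro member_le_sum) auto
      also have "\<dots> \<le> c" unfolding c_def using j by (intro member_le_sum) (auto intro: sum_nonneg)
      finally show "\<bar>adj_mat A $$ (j, i)\<bar> \<le> c" .
    qed simp
    also have "\<dots> = c * (\<Sum>i<n. \<bar>\<Sum>j<n. s i j * z j\<bar>)" by (simp add: sum_distrib_left)
    finally show ?thesis .
  qed
  have "\<exists>z :: nat \<Rightarrow> int. (\<exists>j<n. z j \<noteq> 0) \<and>
       \<bar>\<Sum>j<n. s 0 j * z j\<bar> < 1 + e \<and> (\<forall>i. 0 < i \<and> i < n \<longrightarrow> \<bar>\<Sum>j<n. s i j * z j\<bar> < 1)"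
    if e: "0 < e" "e < 1" for e
  proof -
    \<comment> \<open>The first form gains \<open>e / 2\<close> and each other form gives up
      \<open>t\<close>. By Bernoulli's inequality the product of the bounds \<open>l i\<close> still
      exceeds 1, as the counting argument requires, and the reserve \<open>t\<close> later absorbs
      the error of approximation.\<close>
    define t where "t = e / (8 * n)"
    define l where "l i = (if i = 0 then 1 + e / 2 else 1 - t)" for i :: nat
    have n1: "real n \<ge> 1" using n by simp
    have t: "0 < t" "t \<le> e / 8" "t < 1"
    proof -
      show "0 < t" using e n by (simp add: t_def)
      have "e / (8 * n) \<le> e / (8 * 1)" using e n1 by (intro divide_left_mono) auto
      then show "t \<le> e / 8" by (simp add: t_def)
      then show "t < 1" using e by simp
    qed
    have l_pos: "l i > 0" "l i \<le> 2" for i using t e by (auto simp: l_def)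
    have "1 < (\<Prod>i<n. l i)"
    proof -
      have "(\<Prod>i<n. l i) = l 0 * (\<Prod>i\<in>{..<n} - {0}. l i)" using n by (subst prod.remove[of _ 0]) auto
      also have "(\<Prod>i\<in>{..<n} - {0}. l i) = (1 - t) ^ (n - 1)"
        using n by (subst prod.cong[OF refl, of _ _ "\<lambda>_. 1 - t"]) (auto simp: l_def)
      finally have pr: "(\<Prod>i<n. l i) = (1 + e / 2) * (1 - t) ^ (n - 1)" by (simp add: l_def)
      have "1 + real (n - 1) * (- t) \<le> (1 + (- t)) ^ (n - 1)" using t by (intro Bernoulli_inequality) auto
      moreover have "real (n - 1) * t \<le> e / 8"
      proof -
        have "real (n - 1) * t \<le> real n * t" using t by (intro mult_right_mono) auto
        also have "\<dots> = e / 8" using n by (simp add: t_def)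
        finally show ?thesis .
      qed
      ultimately have "1 - e / 8 \<le> (1 - t) ^ (n - 1)" by simp
      then have "(1 + e / 2) * (1 - e / 8) \<le> (\<Prod>i<n. l i)" unfolding pr using e by (intro mult_left_mono) auto
      moreover have "(1 + e / 2) * (1 - e / 8) = 1 + e * (3 / 8 - e / 16)" by (simp add: field_simps)
      moreover have "e * (3 / 8 - e / 16) > 0" using e by (intro mult_pos_pos) auto
      ultimately show ?thesis by linarith
    qed
    define Bm where "Bm m = (\<lambda>i j. \<lfloor>real m * s i j\<rfloor>)" for m :: nat
    define D where "D m = mat n n (\<lambda>(i, j). of_int (Bm m i j) / real m)" for m
    have approx: "\<bar>of_int (Bm m i j) / real m - s i j\<bar> \<le> 1 / m" if "m > 0" for m i j
    proof -
      have "\<bar>of_int (Bm m i j) - real m * s i j\<bar> \<le> 1" unfolding Bm_def by linarith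
      then have "\<bar>(of_int (Bm m i j) - real m * s i j) / m\<bar> \<le> 1 / m" using that by (simp add: divide_right_mono)
      moreover have "(of_int (Bm m i j) - real m * s i j) / m = of_int (Bm m i j) / real m - s i j"
        using that by (simp add: field_simps)
      ultimately show ?thesis by simp
    qed
    have "(\<lambda>m. of_int (Bm m i j) / real m) \<longlonglongrightarrow> s i j" for i j
    proof (rule metric_tendsto_imp_tendsto[OF lim_1_over_n])
      show "\<forall>\<^sub>F m in sequentially. dist (of_int (Bm m i j) / real m) (s i j) \<le> dist (1 / real m) 0"
        using approx by (auto simp: eventually_sequentially dist_real_def intro!: exI[of _ 1])
    qed
    then have "(\<lambda>m. det (D m)) \<longlonglongrightarrow> det A"
      by (intro tendsto_det[of _ n]) (auto simp: D_def A_def)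
    then have lim: "(\<lambda>m. \<bar>det (D m)\<bar>) \<longlonglongrightarrow> 1" using det tendsto_rabs unfolding A_def by fastforce
    have ev1: "\<forall>\<^sub>F m in sequentially. 0 < \<bar>det (D m)\<bar> \<and> \<bar>det (D m)\<bar> < (\<Prod>i<n. l i)"
    proof (rule eventually_conj)
      show "\<forall>\<^sub>F m in sequentially. 0 < \<bar>det (D m)\<bar>" by (rule order_tendstoD(1)[OF lim]) simp
      show "\<forall>\<^sub>F m in sequentially. \<bar>det (D m)\<bar> < (\<Prod>i<n. l i)" by (rule order_tendstoD(2)[OF lim]) fact
    qed
    \<comment> \<open>\<open>m \<ge> 2 * C\<close> lets the estimate
      \<open>Z \<le> 3 * C + C / m * Z\<close> be solved to \<open>Z \<le> 6 * C\<close>, and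
      \<open>m > (1 + 6 * C) / t\<close> then pushes the error \<open>(1 + Z) / m\<close> below
      \<open>t\<close>.\<close>
    define C where "C = c * n * n"
    have C0: "C \<ge> 0" using c0 by (simp add: C_def)
    have "\<forall>\<^sub>F m in sequentially. max (2 * C) ((1 + 6 * C) / t) + 1 \<le> real m"
      using filterlim_real_sequentially by (auto simp: filterlim_at_top)
    from eventually_happens'[OF _ eventually_conj[OF ev1 this]]
    obtain m where m: "0 < \<bar>det (D m)\<bar>" "\<bar>det (D m)\<bar> < (\<Prod>i<n. l i)"
      "max (2 * C) ((1 + 6 * C) / t) + 1 \<le> real m" by auto
    have m': "2 * C \<le> m" "(1 + 6 * C) / t < m" "1 \<le> real m"
      using m(3) C0 t by (auto simp: max_def split: if_splits)
    have m0: "real m > 0" using m'(3) by simp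
    define BM where "BM = mat n n (\<lambda>(i, j). Bm m i j)"
    have detB: "of_int (det BM) = real m ^ n * det (D m)"
    proof -
      have "map_mat of_int BM = real m \<cdot>\<^sub>m D m" using m0 by (intro eq_matI) (auto simp: BM_def D_def)
      then have "det (map_mat of_int BM) = det (real m \<cdot>\<^sub>m D m)" by simp
      also have "\<dots> = real m ^ n * det (D m)" by (simp add: D_def)
      finally show ?thesis by (simp flip: of_int_hom.hom_det)
    qed
    define b where "b i = nat \<lceil>l i * m\<rceil>" for i
    have b: "l i * m \<le> real (b i)" "real (b i) \<le> l i * m + 1" for i
    proof -
      have "l i * m > 0" using l_pos m0 by simp
      then show "l i * m \<le> real (b i)" "real (b i) \<le> l i * m + 1" unfolding b_def by linarith+
    qed
    have "real_of_int \<bar>det BM\<bar> < (\<Prod>i<n. real (b i))"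
    proof -
      have "real_of_int \<bar>det BM\<bar> = real m ^ n * \<bar>det (D m)\<bar>" using m0 by (simp add: detB abs_mult)
      also have "\<dots> < real m ^ n * (\<Prod>i<n. l i)" using m(2) m0 by simp
      also have "\<dots> = (\<Prod>i<n. l i * m)" by (simp add: prod.distrib mult.commute)
      also have "\<dots> \<le> (\<Prod>i<n. real (b i))" using b(1) less_imp_le[OF l_pos(1)] less_imp_le[OF m0] by (intro prod_mono conjI mult_nonneg_nonneg)
      finally show ?thesis .
    qed
    then have "real_of_int \<bar>det BM\<bar> < real_of_int (\<Prod>i<n. int (b i))" by simp
    then have "\<bar>det BM\<bar> < (\<Prod>i<n. int (b i))" by (simp only: of_int_less_iff)
    moreover have "det BM \<noteq> 0" using detB m(1) m0 by auto
    ultimately obtain z where z: "\<exists>j<n. z j \<noteq> 0" "\<And>i. i < n \<Longrightarrow> \<bar>\<Sum>j<n. Bm m i j * z j\<bar> < int (b i)"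
      using integer_linear_forms[of n "Bm m" b] unfolding BM_def by blast
    define Z where "Z = (\<Sum>j<n. \<bar>real_of_int (z j)\<bar>)"
    have S: "\<bar>\<Sum>j<n. s i j * z j\<bar> < l i + (1 + Z) / m" if i: "i < n" for i
    proof -
      have "\<bar>\<Sum>j<n. real_of_int (Bm m i j) * z j\<bar> < real (b i)"
      proof -
        have "real_of_int \<bar>\<Sum>j<n. Bm m i j * z j\<bar> < real_of_int (int (b i))"
          using z(2)[OF i] by (simp only: of_int_less_iff)
        then show ?thesis by simp
      qed
      then have "\<bar>\<Sum>j<n. real_of_int (Bm m i j) * z j\<bar> / m < real (b i) / m" using m0 by (rule divide_strict_right_mono)
      also have "real (b i) / m \<le> (l i * m + 1) / m" by (rule divide_right_mono[OF b(2)]) simp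
      also have "(l i * m + 1) / m = l i + 1 / m" using m0 by (simp add: add_divide_distrib)
      finally have 1: "\<bar>(\<Sum>j<n. real_of_int (Bm m i j) * z j) / m\<bar> < l i + 1 / m"
        unfolding abs_divide by simp
      have "\<bar>(\<Sum>j<n. s i j * z j) - (\<Sum>j<n. real_of_int (Bm m i j) * z j) / m\<bar> =
          \<bar>\<Sum>j<n. (s i j - real_of_int (Bm m i j) / m) * z j\<bar>"
        by (simp add: left_diff_distrib sum_subtractf sum_divide_distrib)
      also have "\<dots> \<le> (\<Sum>j<n. \<bar>s i j - real_of_int (Bm m i j) / m\<bar> * \<bar>real_of_int (z j)\<bar>)"
        by (rule order_trans[OF sum_abs]) (simp add: abs_mult)
      also have "\<dots> \<le> (\<Sum>j<n. 1 / m * \<bar>real_of_int (z j)\<bar>)"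
        using approx[of m i] m0 by (intro sum_mono mult_right_mono) (auto simp: abs_minus_commute)
      also have "\<dots> = Z / m" by (simp add: Z_def sum_divide_distrib)
      finally have "\<bar>(\<Sum>j<n. s i j * z j) - (\<Sum>j<n. real_of_int (Bm m i j) * z j) / m\<bar> \<le> Z / m" .
      with 1 have "\<bar>\<Sum>j<n. s i j * z j\<bar> < l i + 1 / m + Z / m" by linarith
      then show ?thesis by (simp add: add_divide_distrib)
    qed
    have Z0: "Z \<ge> 0" by (simp add: Z_def sum_nonneg)
    have "Z \<le> 6 * C"
    proof -
      have "(\<Sum>i<n. \<bar>\<Sum>j<n. s i j * z j\<bar>) \<le> (\<Sum>i<n. 3 + Z / m)"
      proof (intro sum_mono)
        fix i assume "i \<in> {..<n}"
        then have "\<bar>\<Sum>j<n. s i j * z j\<bar> < l i + (1 + Z) / m" using S by simp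
        moreover have "1 / m \<le> 1" using m'(3) by simp
        ultimately show "\<bar>\<Sum>j<n. s i j * z j\<bar> \<le> 3 + Z / m" using l_pos(2)[of i] by (simp add: add_divide_distrib)
      qed
      then have cz: "c * (\<Sum>i<n. \<bar>\<Sum>j<n. s i j * z j\<bar>) \<le> c * (n * (3 + Z / m))"
        using c0 by (intro mult_left_mono) auto
      have "\<bar>real_of_int (z j)\<bar> \<le> c * (n * (3 + Z / m))" if "j < n" for j
        using order_trans[OF bound[OF that, of "\<lambda>j. real_of_int (z j)"] cz] .
      then have "Z \<le> (\<Sum>j<n. c * (n * (3 + Z / m)))" unfolding Z_def by (intro sum_mono) auto
      also have "\<dots> = 3 * C + C / m * Z" by (simp add: C_def algebra_simps)
      also have "C / m * Z \<le> 1 / 2 * Z"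
        using m'(1) m0 Z0 by (intro mult_right_mono) (auto simp: field_simps)
      finally show ?thesis by simp
    qed
    have "(1 + Z) / m < t"
    proof -
      have "(1 + 6 * C) < t * m" using m'(2) t(1) by (simp add: field_simps)
      then have "1 + Z < t * m" using \<open>Z \<le> 6 * C\<close> by simp
      then show ?thesis using m0 by (simp add: field_simps)
    qed
    then have fin: "\<bar>\<Sum>j<n. s i j * z j\<bar> < l i + t" if "i < n" for i using S[OF that] by simp
    have "\<bar>\<Sum>j<n. s 0 j * z j\<bar> < 1 + e" using fin[OF n] t e by (simp add: l_def)
    moreover have "\<bar>\<Sum>j<n. s i j * z j\<bar> < 1" if "0 < i" "i < n" for i
      using fin[OF that(2)] that(1) by (simp add: l_def)
    ultimately show ?thesis using z(1) by blast
  qed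
  then show ?thesis using bound by (intro exI[of _ c] conjI allI impI) auto
qed

section \<open>Unramified totally real extensions of the rationals\<close>

context integer_action
begin

text \<open>
  The functions \<open>g \<mapsto> \<Sum>k. y k * g (z k)\<close> on \<open>G\<close> with algebraic integers \<open>y k\<close> and with
  \<open>z k\<close> in \<open>R\<close>. That the indicator function of \<open>id\<close> is one of them says that \<open>R\<close> is a Galois
  extension of the integers in the sense of ring theory.
\<close>

inductive_set twisted :: "((complex \<Rightarrow> complex) \<Rightarrow> complex) set" where
  base: "algebraic_int y \<Longrightarrow> z \<in> R \<Longrightarrow> (\<And>g. g \<in> G \<Longrightarrow> f g = y * g z) \<Longrightarrow> f \<in> twisted"
| add: "f1 \<in> twisted \<Longrightarrow> f2 \<in> twisted \<Longrightarrow> (\<And>g. g \<in> G \<Longrightarrow> f g = f1 g + f2 g) \<Longrightarrow> f \<in> twisted"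

lemma twisted_integral: "f \<in> twisted \<Longrightarrow> g \<in> G \<Longrightarrow> algebraic_int (f g)"
proof (induction rule: twisted.induct)
  case (base y z f)
  then show ?case using algebraic_int_times[OF base(1) integral[OF action_closed[OF base(4) base(2)]]] by simp
next
  case (add f1 f2 f)
  then show ?case by (simp add: algebraic_int_plus)
qed

lemma twisted_const: "algebraic_int y \<Longrightarrow> (\<lambda>_. y) \<in> twisted"
  by (rule twisted.base[of y 1]) (auto simp: action_1 is_subringD(2)[OF subring])

lemma twisted_mult:
  assumes "f1 \<in> twisted" "f2 \<in> twisted" shows "(\<lambda>g. f1 g * f2 g) \<in> twisted"
  using assms(1)
proof induction
  case (base y z f)
  from assms(2) show ?case
  proof induction
    case (base y' z' f')
    show ?case
      by (rule twisted.base[of "y * y'" "z * z'"])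
        (use base \<open>algebraic_int y\<close> \<open>z \<in> R\<close> \<open>\<And>g. g \<in> G \<Longrightarrow> f g = y * g z\<close> in
          \<open>auto simp: action_mult algebraic_int_times is_subringD(5)[OF subring]\<close>)
  next
    case (add f1 f2 f')
    show ?case by (rule twisted.add[OF add.IH]) (simp add: add.hyps(3) distrib_left)
  qed
next
  case (add f1 f1' f)
  show ?case by (rule twisted.add[OF add.IH]) (simp add: add.hyps(3) distrib_right)
qed

lemma twisted_translate:
  assumes "f \<in> twisted" "k \<in> G" shows "(\<lambda>g. f (g \<circ> k)) \<in> twisted"
  using assms(1)
proof induction
  case (base y z f)
  show ?case
  proof (rule twisted.base[OF base(1) action_closed[OF assms(2) base(2)]])
    fix g assume "g \<in> G"
    then show "f (g \<circ> k) = y * g (k z)" using base(3)[OF comp_mem[OF _ assms(2)]] by simp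
  qed
next
  case (add f1 f2 f)
  show ?case
  proof (rule twisted.add[OF add.IH])
    fix g assume "g \<in> G"
    then show "f (g \<circ> k) = f1 (g \<circ> k) + f2 (g \<circ> k)" by (intro add.hyps(3) comp_mem assms(2))
  qed
qed

lemma twisted_annihilator:
  assumes "\<And>z. z \<in> R \<Longrightarrow> (\<Sum>g\<in>G. c g * g z) = 0" "f \<in> twisted"
  shows "(\<Sum>g\<in>G. c g * f g) = 0"
  using assms(2)
proof induction
  case (base y z f)
  have "(\<Sum>g\<in>G. c g * f g) = y * (\<Sum>g\<in>G. c g * g z)"
    unfolding sum_distrib_left by (intro sum.cong) (simp_all add: base)
  then show ?case using assms(1)[OF base(2)] by simp
next
  case (add f1 f2 f)
  have "(\<Sum>g\<in>G. c g * f g) = (\<Sum>g\<in>G. c g * f1 g) + (\<Sum>g\<in>G. c g * f2 g)"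
    unfolding sum.distrib[symmetric] by (intro sum.cong) (simp_all add: add.hyps(3) distrib_left)
  then show ?case using add.IH by simp
qed

end

text \<open>For a sum of terms \<open>y * g z\<close>, the difference of the values at
  \<open>id\<close> and \<open>g\<close> is the sum of the \<open>y * (z - g z)\<close>. Thus
  \<open>separated\<close> says that the differences \<open>z - g z\<close> generate the unit ideal
  over the algebraic integers, so that \<open>g\<close> is in no inertia group.\<close>

locale unramified_action = integer_action R G for R :: "complex set" and G +
  assumes separated: "g \<in> G \<Longrightarrow> g \<noteq> id \<Longrightarrow> \<exists>f\<in>twisted. f id - f g = 1"
    and real: "R \<subseteq> \<real>"
begin

text \<open>Interpolation at \<open>id\<close>: subtracting its value at \<open>g\<close> from a
  separating function gives a factor that is 1 at \<open>id\<close> and 0 at \<open>g\<close>. The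
  product of these factors is translated from \<open>id\<close> to \<open>h\<close>.\<close>

lemma twisted_delta:
  assumes "h \<in> G"
  shows "\<exists>f\<in>twisted. f h = 1 \<and> (\<forall>g\<in>G-{h}. f g = 0)"
proof -
  have "\<exists>f\<in>twisted. f id = 1 \<and> (\<forall>g\<in>S. f g = 0)" if "S \<subseteq> G - {id}" for S
    using finite_subset[OF that finite_Diff[OF fin]] that
  proof (induction S rule: finite_induct)
    case empty
    show ?case by (intro bexI[of _ "\<lambda>_. 1"] twisted_const) auto
  next
    case (insert g S)
    then obtain f where f: "f \<in> twisted" "f id = 1" "\<forall>g\<in>S. f g = 0" by blast
    obtain f' where f': "f' \<in> twisted" "f' id - f' g = 1" using separated[of g] insert.prems by blast
    have "algebraic_int (f' g)" using f'(1) twisted_integral insert.prems by auto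
    then have "(\<lambda>h. f' h + (- f' g)) \<in> twisted"
      by (intro twisted.add[OF f'(1) twisted_const]) auto
    then have "(\<lambda>h. f h * (f' h + (- f' g))) \<in> twisted" by (rule twisted_mult[OF f(1)])
    moreover have "f id * (f' id + (- f' g)) = 1" unfolding f(2) using f'(2) by simp
    moreover have "\<forall>h\<in>insert g S. f h * (f' h + (- f' g)) = 0" using f(3) by simp
    ultimately show ?case by (intro bexI conjI)
  qed
  then obtain f where f: "f \<in> twisted" "f id = 1" "\<forall>g\<in>G-{id}. f g = 0" by blast
  obtain k where k: "k \<in> G" "k \<circ> h = id" "h \<circ> k = id" using inverse_ex[OF assms] by blast
  have "g \<circ> k \<in> G - {id}" if "g \<in> G - {h}" for g
  proof -
    have "g = h" if "g \<circ> k = id" using that k(2) by (metis comp_assoc comp_id id_comp)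
    then show ?thesis using that k(1) by (auto intro: comp_mem)
  qed
  then show ?thesis
    using twisted_translate[OF f(1) k(1)] f(2,3) k(3) by (intro bexI[of _ "\<lambda>g. f (g \<circ> k)"]) auto
qed

text \<open>The relation extends to all twisted functions, in particular to the indicator function
  of \<open>h\<close>.\<close>

lemma characters_independent:
  assumes "\<And>z. z \<in> R \<Longrightarrow> (\<Sum>g\<in>G. c g * g z) = 0" "h \<in> G"
  shows "c h = 0"
proof -
  obtain f where f: "f \<in> twisted" "f h = 1" "\<forall>g\<in>G-{h}. f g = 0" using twisted_delta[OF assms(2)] by blast
  have "0 = (\<Sum>g\<in>G. c g * f g)" using twisted_annihilator[OF assms(1) f(1)] by simp
  also have "\<dots> = c h" using f by (subst sum.remove[OF fin assms(2)]) simp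
  finally show ?thesis by simp
qed

section \<open>Discriminants and integral bases\<close>

context
  fixes n :: nat and s :: "nat \<Rightarrow> complex \<Rightarrow> complex"
  assumes s: "bij_betw s {..<n} G"
begin

text \<open>The square of its determinant is the discriminant of the tuple \<open>x\<close>.\<close>

definition conj_mat :: "(nat \<Rightarrow> complex) \<Rightarrow> complex mat" where
  "conj_mat x = mat n n (\<lambda>(i, j). s i (x j))"

lemma conj_mat_carrier: "conj_mat x \<in> carrier_mat n n"
  by (simp add: conj_mat_def)

lemma s_mem: "i < n \<Longrightarrow> s i \<in> G"
  using s by (auto simp: bij_betw_def)

lemma trace_int: "x \<in> R \<Longrightarrow> \<exists>m. (\<Sum>i<n. s i x) = of_int m"
proof -
  assume x: "x \<in> R"
  have eq: "(\<Sum>i<n. s i x) = (\<Sum>g\<in>G. g x)" by (rule sum.reindex_bij_betw[OF s])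
  have "h (\<Sum>g\<in>G. g x) = (\<Sum>g\<in>G. g x)" if h: "h \<in> G" for h
  proof -
    have "h (\<Sum>g\<in>G. g x) = (\<Sum>g\<in>G. (h \<circ> g) x)"
      by (subst action_sum[OF h]) (auto simp: action_closed x)
    also have "\<dots> = (\<Sum>g\<in>G. g x)" by (rule sum.reindex_bij_betw[OF bij_left_mult[OF h]])
    finally show ?thesis .
  qed
  then have "(\<Sum>g\<in>G. g x) \<in> fixed"
    using action_closed x by (auto simp: fixed_def intro!: is_subring_sum[OF subring])
  then show ?thesis using fixed_Ints by (auto simp: eq elim: Ints_cases)
qed

text \<open>The product is the determinant of the matrix of traces of the
  \<open>x i * y j\<close>.\<close>

lemma conj_mat_det_mult_int:
  assumes "\<And>j. j < n \<Longrightarrow> x j \<in> R" "\<And>j. j < n \<Longrightarrow> y j \<in> R"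
  shows "\<exists>m. det (conj_mat x) * det (conj_mat y) = of_int m"
proof -
  have "\<exists>m. (\<Sum>k<n. s k (x i * y j)) = of_int m" if "i < n" "j < n" for i j
    using that assms by (intro trace_int is_subringD(5)[OF subring])
  then obtain T where T: "\<And>i j. i < n \<Longrightarrow> j < n \<Longrightarrow> (\<Sum>k<n. s k (x i * y j)) = of_int (T i j)" by metis
  have "transpose_mat (conj_mat x) * conj_mat y = map_mat of_int (mat n n (\<lambda>(i, j). T i j))"
  proof (rule eq_matI)
    fix i j assume ij: "i < dim_row (map_mat of_int (mat n n (\<lambda>(i, j). T i j)))"
      "j < dim_col (map_mat of_int (mat n n (\<lambda>(i, j). T i j)))"
    then have ij: "i < n" "j < n" by simp_all
    have "(transpose_mat (conj_mat x) * conj_mat y) $$ (i, j) = (\<Sum>k<n. s k (x i) * s k (y j))"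
      using ij by (simp add: conj_mat_def scalar_prod_def atLeast0LessThan)
    also have "\<dots> = (\<Sum>k<n. s k (x i * y j))"
      using ij assms s_mem by (intro sum.cong) (simp_all add: action_mult)
    finally show "(transpose_mat (conj_mat x) * conj_mat y) $$ (i, j) =
        map_mat of_int (mat n n (\<lambda>(i, j). T i j)) $$ (i, j)" using T ij by simp
  qed (simp_all add: conj_mat_def)
  then have "det (transpose_mat (conj_mat x) * conj_mat y) = of_int (det (mat n n (\<lambda>(i, j). T i j)))"
    by simp
  moreover have "det (transpose_mat (conj_mat x) * conj_mat y) = det (conj_mat x) * det (conj_mat y)"
    using conj_mat_carrier by (subst det_mult[of _ n]) (auto simp: det_transpose[of _ n])
  ultimately show ?thesis by auto
qed

text \<open>The tuple grows by one element at a time. If every choice of the new element gave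
  determinant 0, the Laplace expansion along its column would be a relation between the elements of
  \<open>G\<close> with the nonzero coefficient \<open>c k\<close>, the determinant of the previous
  stage.\<close>

lemma nonsingular_ex:
  "\<exists>x. (\<forall>j. x j \<in> R) \<and> det (conj_mat x) \<noteq> 0"
proof -
  have "\<exists>x. (\<forall>j. x j \<in> R) \<and> det (mat k k (\<lambda>(i, j). s i (x j))) \<noteq> 0" if "k \<le> n" for k
    using that
  proof (induction k)
    case 0
    show ?case by (intro exI[of _ "\<lambda>_. 0"]) (simp add: is_subringD(1)[OF subring])
  next
    case (Suc k)
    then obtain x where x: "\<And>j. x j \<in> R" "det (mat k k (\<lambda>(i, j). s i (x j))) \<noteq> 0" by auto
    define A where "A z = mat (Suc k) (Suc k) (\<lambda>(i, j). s i ((x(k := z)) j))" for z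
    have A: "A z \<in> carrier_mat (Suc k) (Suc k)" for z by (simp add: A_def)
    define c where "c i = cofactor (A 0) i k" for i
    have cof: "cofactor (A z) i k = c i" if "i < Suc k" for i z
    proof -
      have "mat_delete (A z) i k = mat_delete (A 0) i k"
        unfolding mat_delete_def by (rule eq_matI) (auto simp: A_def)
      then show ?thesis by (simp add: c_def cofactor_def)
    qed
    have detA: "det (A z) = (\<Sum>i<Suc k. s i z * c i)" for z
    proof -
      have "det (A z) = (\<Sum>i<Suc k. A z $$ (i, k) * cofactor (A z) i k)"
        by (rule laplace_expansion_column[OF A]) simp
      also have "\<dots> = (\<Sum>i<Suc k. s i z * c i)"
        by (intro sum.cong) (simp_all add: cof, simp_all add: A_def)
      finally show ?thesis .
    qed
    have "mat_delete (A 0) k k = mat k k (\<lambda>(i, j). s i (x j))"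
      unfolding mat_delete_def by (rule eq_matI) (auto simp: A_def)
    then have ck: "c k \<noteq> 0" using x(2) by (simp add: c_def cofactor_def)
    have "\<exists>z\<in>R. det (A z) \<noteq> 0"
    proof (rule ccontr)
      assume "\<not> ?thesis"
      then have z0: "det (A z) = 0" if "z \<in> R" for z using that by blast
      define ix where "ix g = the_inv_into {..<n} s g" for g
      have ix: "ix (s i) = i" if "i < n" for i
        using s that by (auto simp: ix_def bij_betw_def the_inv_into_f_f)
      define e where "e g = (if ix g < Suc k then c (ix g) else 0)" for g
      have "(\<Sum>g\<in>G. e g * g z) = 0" if "z \<in> R" for z
      proof -
        have "(\<Sum>g\<in>G. e g * g z) = (\<Sum>i<n. e (s i) * s i z)" by (rule sum.reindex_bij_betw[OF s, symmetric])
        also have "\<dots> = (\<Sum>i<n. if i < Suc k then s i z * c i else 0)"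
          by (intro sum.cong) (auto simp: e_def ix)
        also have "\<dots> = (\<Sum>i<Suc k. s i z * c i)"
          using Suc.prems by (intro sum.mono_neutral_cong_right) auto
        also have "\<dots> = 0" using z0[OF that] detA by simp
        finally show ?thesis .
      qed
      from characters_independent[OF this s_mem[of k]] have "e (s k) = 0" using Suc.prems by simp
      then show False using ck Suc.prems by (simp add: e_def ix)
    qed
    then obtain z where z: "z \<in> R" "det (A z) \<noteq> 0" by blast
    show ?case using x(1) z unfolding A_def by (intro exI[of _ "x(k := z)"]) auto
  qed
  then show ?thesis unfolding conj_mat_def by blast
qed

text \<open>A tuple with minimal discriminant is an integral basis.\<close>

lemma integral_basis_ex:
  "\<exists>x. (\<forall>j. x j \<in> R) \<and> det (conj_mat x) \<noteq> 0 \<and>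
    (\<forall>z\<in>R. \<exists>c. \<forall>i<n. s i z = (\<Sum>j<n. of_int (c j) * s i (x j)))"
proof -
  define P where "P x \<longleftrightarrow> (\<forall>j. x j \<in> R) \<and> det (conj_mat x) \<noteq> 0" for x
  have "\<exists>m. det (conj_mat x) * det (conj_mat x) = of_int m" if "P x" for x
    using that by (intro conj_mat_det_mult_int) (auto simp: P_def)
  then obtain d where d: "\<And>x. P x \<Longrightarrow> det (conj_mat x) * det (conj_mat x) = of_int (d x)" by metis
  obtain x0 where "P x0" using nonsingular_ex unfolding P_def by blast
  then obtain x where x: "P x" "\<And>y. P y \<Longrightarrow> nat \<bar>d x\<bar> \<le> nat \<bar>d y\<bar>"
    using ex_has_least_nat[of P x0 "\<lambda>x. nat \<bar>d x\<bar>"] by blast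
  have xR: "x j \<in> R" for j using x(1) by (simp add: P_def)
  define A where "A = conj_mat x"
  have A: "A \<in> carrier_mat n n" by (simp add: A_def conj_mat_carrier)
  have D0: "det A \<noteq> 0" using x(1) by (simp add: P_def A_def)
  have "\<exists>c. \<forall>i<n. s i z = (\<Sum>j<n. of_int (c j) * s i (x j))" if z: "z \<in> R" for z
  proof -
    define b where "b = vec n (\<lambda>i. s i z)"
    define v where "v = (1 / det A) \<cdot>\<^sub>v (adj_mat A *\<^sub>v b)"
    have b: "b \<in> carrier_vec n" by (simp add: b_def)
    have adj: "adj_mat A \<in> carrier_mat n n" "A * adj_mat A = det A \<cdot>\<^sub>m 1\<^sub>m n" using adj_mat[OF A] by auto
    have v: "v \<in> carrier_vec n" using adj b by (simp add: v_def)
    have "A *\<^sub>v v = (1 / det A) \<cdot>\<^sub>v (A *\<^sub>v (adj_mat A *\<^sub>v b))"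
      unfolding v_def using A adj(1) b by (subst mult_mat_vec[of _ n n]) auto
    also have "A *\<^sub>v (adj_mat A *\<^sub>v b) = det A \<cdot>\<^sub>v b"
    proof -
      have "(det A \<cdot>\<^sub>m 1\<^sub>m n) *\<^sub>v b = det A \<cdot>\<^sub>v b" using b by auto
      then show ?thesis using assoc_mult_mat_vec[OF A adj(1) b] unfolding adj(2) by simp
    qed
    finally have Av: "A *\<^sub>v v = b" using D0 b by (auto simp: smult_smult_assoc)
    have rep: "det (conj_mat (x(k := w))) = det (replace_col A (vec n (\<lambda>i. s i w)) k)" if "k < n" for k w
      by (rule arg_cong[of _ _ det], rule eq_matI)
        (auto simp: conj_mat_def replace_col_def A_def)
    have cramer: "det (conj_mat (x(k := z))) = v $ k * det A" if "k < n" for k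
      using cramer_lemma_mat[OF A v that] rep[OF that, of z] unfolding Av b_def by simp
    have "\<exists>c. v $ k = of_int c" if k: "k < n" for k
    proof -
      obtain m where m: "det (conj_mat (x(k := z))) * det A = of_int m"
        using conj_mat_det_mult_int[of "x(k := z)" x] xR z unfolding A_def fun_upd_apply by metis
      then have vk: "v $ k * of_int (d x) = of_int m"
        using cramer[OF k] d[OF x(1)] unfolding A_def by (simp add: mult.assoc)
      have d0: "d x \<noteq> 0" using d[OF x(1)] D0 by (auto simp: A_def)
      \<comment> \<open>The coordinate \<open>v $ k\<close> is the fraction \<open>m / d x\<close>.
        Replacing \<open>x k\<close> by \<open>w\<close> multiplies the discriminant by the square
        of its fractional part, so minimality forces that part to be 0.\<close>
      define c where "c = m div d x"
      define w where "w = z - of_int c * x k"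
      have wR: "w \<in> R" unfolding w_def using xR z
        by (intro is_subringD(6,5)[OF subring] is_subring_of_int[OF subring])
      have "vec n (\<lambda>i. s i w) = b + (- of_int c) \<cdot>\<^sub>v col A k"
      proof (rule eq_vecI)
        fix i assume "i < dim_vec (b + (- of_int c) \<cdot>\<^sub>v col A k)"
        then have i: "i < n" using A by simp
        have "s i w = s i z - of_int c * s i (x k)"
          using s_mem[OF i] xR z
          by (simp add: w_def action_diff action_mult action_of_int is_subringD(5)[OF subring] is_subring_of_int[OF subring])
        then show "vec n (\<lambda>i. s i w) $ i = (b + (- of_int c) \<cdot>\<^sub>v col A k) $ i"
          using i k A by (simp add: b_def A_def conj_mat_def)
      qed (use A in auto)
      also have "col A k = A *\<^sub>v unit_vec n k"
        using A k by (intro eq_vecI) (auto simp: scalar_prod_right_unit)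
      also have "b + (- of_int c) \<cdot>\<^sub>v (A *\<^sub>v unit_vec n k) = A *\<^sub>v (v + (- of_int c) \<cdot>\<^sub>v unit_vec n k)"
        using A v k Av by (simp add: mult_add_distrib_mat_vec[of _ n n] mult_mat_vec[of _ n n])
      finally have wv: "vec n (\<lambda>i. s i w) = A *\<^sub>v (v + (- of_int c) \<cdot>\<^sub>v unit_vec n k)" .
      have "det (conj_mat (x(k := w))) = (v + (- of_int c) \<cdot>\<^sub>v unit_vec n k) $ k * det A"
        unfolding rep[OF k] wv using v by (intro cramer_lemma_mat[OF A _ k]) auto
      also have "\<dots> = (v $ k - of_int c) * det A" using k v by simp
      finally have dw: "det (conj_mat (x(k := w))) = (v $ k - of_int c) * det A" .
      show ?thesis
      proof (rule ccontr)
        assume no: "\<not> ?thesis"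
        then have vc: "v $ k - of_int c \<noteq> 0" by auto
        then have Pw: "P (x(k := w))" unfolding P_def using dw D0 xR wR by auto
        have "of_int (d (x(k := w))) = (v $ k - of_int c)\<^sup>2 * of_int (d x)"
          unfolding d[OF Pw, symmetric] dw d[OF x(1), symmetric] A_def by (simp add: power2_eq_square)
        then have "of_int (d (x(k := w)) * d x) = ((v $ k - of_int c) * of_int (d x))\<^sup>2"
          by (simp add: power2_eq_square)
        also have "(v $ k - of_int c) * of_int (d x) = of_int (m mod d x)"
          using vk by (simp add: c_def left_diff_distrib minus_div_mult_eq_mod flip: of_int_mult of_int_diff)
        finally have "of_int (d (x(k := w)) * d x) = (of_int ((m mod d x)\<^sup>2) :: complex)"
          by (simp only: of_int_power)
        then have eq: "d (x(k := w)) * d x = (m mod d x)\<^sup>2" by (simp only: of_int_eq_iff)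
        have "\<bar>m mod d x\<bar> < \<bar>d x\<bar>" using abs_mod_less[OF d0] .
        then have "\<bar>m mod d x\<bar>\<^sup>2 < \<bar>d x\<bar>\<^sup>2" by (intro power_strict_mono) auto
        then have "\<bar>d (x(k := w))\<bar> * \<bar>d x\<bar> < \<bar>d x\<bar> * \<bar>d x\<bar>"
          using eq by (simp add: power2_eq_square flip: abs_mult)
        then have "\<bar>d (x(k := w))\<bar> < \<bar>d x\<bar>" by (rule mult_right_less_imp_less) simp
        then show False using x(2)[OF Pw] by simp
      qed
    qed
    then obtain c where c: "\<And>k. k < n \<Longrightarrow> v $ k = of_int (c k)" by metis
    have "s i z = (\<Sum>j<n. of_int (c j) * s i (x j))" if i: "i < n" for i
    proof -
      have "s i z = (A *\<^sub>v v) $ i" using Av i by (simp add: b_def)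
      also have "\<dots> = (\<Sum>j<n. s i (x j) * v $ j)"
        using i v by (simp add: A_def conj_mat_def scalar_prod_def atLeast0LessThan)
      finally show ?thesis using c by (simp add: mult.commute)
    qed
    then show ?thesis by blast
  qed
  then show ?thesis using xR D0 unfolding A_def by (intro exI[of _ x] conjI allI ballI)
qed

lemma algebraic_int_det:
  fixes A :: "complex mat"
  assumes "A \<in> carrier_mat n n" "\<And>i j. i < n \<Longrightarrow> j < n \<Longrightarrow> algebraic_int (A $$ (i, j))"
  shows "algebraic_int (det A)"
  unfolding det_def'[OF assms(1)]
proof (intro algebraic_int_sum algebraic_int_times algebraic_int_prod assms(2))
  fix p i assume "p \<in> {p. p permutes {0..<n}}" "i \<in> {0..<n}"
  then show "i < n" "p i < n" using permutes_in_image[of p "{0..<n}" i] by auto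
qed (auto simp: sign_def)

text \<open>Expanding the indicator functions in the basis inverts \<open>conj_mat x\<close> by a
  matrix \<open>U\<close> over the algebraic integers. The discriminant is thus an integer whose
  inverse, the square of \<open>det U\<close>, is a rational algebraic integer, so it is 1 or
  -1.\<close>

lemma unimodular_basis_ex:
  "\<exists>x. (\<forall>j. x j \<in> R) \<and> det (conj_mat x) * det (conj_mat x) \<in> {1, -1}"
proof -
  obtain x where x: "\<And>j. x j \<in> R" "det (conj_mat x) \<noteq> 0"
    "\<And>z. z \<in> R \<Longrightarrow> \<exists>c. \<forall>i<n. s i z = (\<Sum>j<n. of_int (c j) * s i (x j))"
    using integral_basis_ex by metis
  have tw: "\<exists>u. (\<forall>j. algebraic_int (u j)) \<and> (\<forall>i<n. f (s i) = (\<Sum>j<n. u j * s i (x j)))"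
    if "f \<in> twisted" for f
    using that
  proof induction
    case (base y z f)
    obtain c where c: "\<forall>i<n. s i z = (\<Sum>j<n. of_int (c j) * s i (x j))" using x(3)[OF base(2)] by blast
    have "f (s i) = (\<Sum>j<n. (y * of_int (c j)) * s i (x j))" if "i < n" for i
      using c that base(3)[OF s_mem[OF that]] by (simp add: sum_distrib_left mult.assoc)
    then show ?case
      using base(1) by (intro exI[of _ "\<lambda>j. y * of_int (c j)"]) (auto intro: algebraic_int_times)
  next
    case (add f1 f2 f)
    then obtain u1 u2 where u: "\<forall>j. algebraic_int (u1 j)" "\<forall>i<n. f1 (s i) = (\<Sum>j<n. u1 j * s i (x j))"
      "\<forall>j. algebraic_int (u2 j)" "\<forall>i<n. f2 (s i) = (\<Sum>j<n. u2 j * s i (x j))" by blast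
    have "f (s i) = (\<Sum>j<n. (u1 j + u2 j) * s i (x j))" if "i < n" for i
      using u(2,4) that add.hyps(3)[OF s_mem[OF that]] by (simp add: distrib_right sum.distrib)
    then show ?case
      using u(1,3) by (intro exI[of _ "\<lambda>j. u1 j + u2 j"]) (auto intro: algebraic_int_plus)
  qed
  have "\<exists>u. (\<forall>j. algebraic_int (u j)) \<and> (\<forall>i<n. (\<Sum>j<n. u j * s i (x j)) = (if i = h then 1 else 0))"
    if h: "h < n" for h
  proof -
    obtain f where f: "f \<in> twisted" "f (s h) = 1" "\<forall>g\<in>G-{s h}. f g = 0" using twisted_delta[OF s_mem[OF h]] by blast
    obtain u where u: "\<forall>j. algebraic_int (u j)" "\<forall>i<n. f (s i) = (\<Sum>j<n. u j * s i (x j))"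
      using tw[OF f(1)] by blast
    have "s i \<noteq> s h" if "i < n" "i \<noteq> h" for i using s that h by (auto simp: bij_betw_def inj_on_def)
    then show ?thesis using u f s_mem by (intro exI[of _ u]) auto
  qed
  then obtain u where u: "\<And>h j. h < n \<Longrightarrow> algebraic_int (u h j)"
    "\<And>h i. h < n \<Longrightarrow> i < n \<Longrightarrow> (\<Sum>j<n. u h j * s i (x j)) = (if i = h then 1 else 0)" by metis
  define U where "U = mat n n (\<lambda>(j, h). u h j)"
  have U: "U \<in> carrier_mat n n" by (simp add: U_def)
  have "conj_mat x * U = 1\<^sub>m n"
  proof (rule eq_matI)
    fix i h assume "i < dim_row (1\<^sub>m n)" "h < dim_col (1\<^sub>m n)"
    then have ih: "i < n" "h < n" by simp_all
    then have "(conj_mat x * U) $$ (i, h) = (\<Sum>j<n. u h j * s i (x j))"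
      by (simp add: conj_mat_def U_def scalar_prod_def atLeast0LessThan mult.commute)
    then show "(conj_mat x * U) $$ (i, h) = 1\<^sub>m n $$ (i, h)" using u(2) ih by simp
  qed (simp_all add: conj_mat_def U_def)
  moreover have "det (conj_mat x * U) = det (conj_mat x) * det U" by (rule det_mult[OF conj_mat_carrier U])
  ultimately have 1: "det (conj_mat x) * det U = 1" by simp
  have "algebraic_int (det U)" using u(1) by (intro algebraic_int_det[OF U]) (simp add: U_def)
  then have aU: "algebraic_int (det U * det U)" by (rule algebraic_int_times) fact
  obtain m where m: "det (conj_mat x) * det (conj_mat x) = of_int m"
    using conj_mat_det_mult_int[of x x] x(1) by auto
  have 2: "of_int m * (det U * det U) = 1"
  proof -
    have "of_int m * (det U * det U) = (det (conj_mat x) * det U) * (det (conj_mat x) * det U)"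
      unfolding m[symmetric] by (simp add: mult_ac)
    then show ?thesis using 1 by simp
  qed
  then have "of_int m \<noteq> (0 :: complex)" by auto
  then have "det U * det U = 1 / of_int m" using 2 by (simp add: eq_divide_eq mult.commute)
  then have "det U * det U \<in> \<rat>" by simp
  then have "det U * det U \<in> \<int>" by (rule rational_algebraic_int_is_int[OF aU])
  then obtain k where "det U * det U = of_int k" by (elim Ints_cases)
  then have "of_int (m * k) = (of_int 1 :: complex)" using 2 by simp
  then have "m * k = 1" by (simp only: of_int_eq_iff)
  then have "m = 1 \<or> m = -1" using zmult_eq_1_iff by blast
  then show ?thesis using x(1) m by (intro exI[of _ x]) auto
qed

end

text \<open>The forms are the conjugates of an element of \<open>R\<close>, and a nonzero element
  has norm at least 1 in absolute value. For \<open>n \<ge> 2\<close>, a solution whose other forms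
  are below 1 has \<open>\<bar>L 0 z\<bar>\<close> strictly above 1. Finitely many candidates keep
  this value away from 1, against the solvability for every small \<open>e\<close>.\<close>

theorem trivial: "G = {id}"
proof (rule ccontr)
  assume ne: "G \<noteq> {id}"
  define n where "n = card G"
  obtain s where s: "bij_betw s {..<n} G"
    using ex_bij_betw_nat_finite[OF fin] unfolding n_def atLeast0LessThan by blast
  have n2: "n \<ge> 2"
  proof -
    obtain g where "g \<in> G" "g \<noteq> id" using ne id_mem by blast
    then have "card {id, g} \<le> card G" using fin id_mem by (intro card_mono) auto
    then show ?thesis using \<open>g \<noteq> id\<close> by (simp add: n_def)
  qed
  obtain x where x: "\<And>j. x j \<in> R" "det (conj_mat n s x) * det (conj_mat n s x) \<in> {1, -1}"
    using unimodular_basis_ex[OF s] by metis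
  have sR: "s i (x j) \<in> R" if "i < n" for i j using action_closed[OF s_mem[OF s that] x(1)] .
  define r where "r i j = Re (s i (x j))" for i j
  have re: "of_real (r i j) = s i (x j)" if "i < n" for i j
    unfolding r_def by (rule of_real_Re[OF subsetD[OF real sR[OF that]]])
  define Rm where "Rm = mat n n (\<lambda>(i, j). r i j)"
  have "conj_mat n s x = map_mat of_real Rm"
    by (rule eq_matI) (auto simp: conj_mat_def[OF s] Rm_def re)
  then have dc: "det (conj_mat n s x) = of_real (det Rm)" by (simp add: of_real_hom.hom_det)
  have "\<bar>det Rm\<bar> = 1"
  proof -
    have "of_real (det Rm * det Rm) \<in> {of_real 1, of_real (-1) :: complex}" using x(2) unfolding dc by simp
    then have "det Rm * det Rm = 1 \<or> det Rm * det Rm = -1" by (simp only: insert_iff empty_iff of_real_eq_iff simp_thms)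
    moreover have "det Rm * det Rm \<ge> 0" by simp
    ultimately have "(det Rm)\<^sup>2 = 1" by (auto simp: power2_eq_square)
    then show ?thesis by (auto simp: power2_eq_1_iff)
  qed
  then have d1: "\<bar>det (mat n n (\<lambda>(i, j). r i j))\<bar> = 1" unfolding Rm_def .
  have n0: "n > 0" using n2 by simp
  obtain c where c': "\<forall>z. \<forall>j<n. \<bar>z j\<bar> \<le> c * (\<Sum>i<n. \<bar>\<Sum>j<n. r i j * z j\<bar>)"
    "\<forall>e. 0 < e \<and> e < 1 \<longrightarrow> (\<exists>z :: nat \<Rightarrow> int. (\<exists>j<n. z j \<noteq> 0) \<and>
       \<bar>\<Sum>j<n. r 0 j * z j\<bar> < 1 + e \<and> (\<forall>i. 0 < i \<and> i < n \<longrightarrow> \<bar>\<Sum>j<n. r i j * z j\<bar> < 1))"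
    using real_linear_forms[OF n0 d1] by blast
  note c = c'(1)[rule_format] c'(2)[rule_format, OF conjI]
  define L where "L i z = (\<Sum>j<n. r i j * real_of_int (z j))" for i and z :: "nat \<Rightarrow> int"
  have norm1: "1 \<le> (\<Prod>i<n. \<bar>L i z\<bar>)" if z: "\<exists>j<n. z j \<noteq> 0" for z
  proof -
    define y where "y = (\<Sum>j<n. of_int (z j) * x j)"
    have yR: "y \<in> R" unfolding y_def
      by (intro is_subring_sum[OF subring] is_subringD(5)[OF subring] is_subring_of_int[OF subring] x(1))
    have sy: "s i y = of_real (L i z)" if i: "i < n" for i
    proof -
      have "s i y = (\<Sum>j<n. s i (of_int (z j) * x j))" unfolding y_def
        by (intro action_sum[OF s_mem[OF s i]] is_subringD(5)[OF subring] is_subring_of_int[OF subring] x(1))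
      also have "\<dots> = (\<Sum>j<n. of_int (z j) * s i (x j))"
        by (intro sum.cong refl)
          (simp add: action_mult[OF s_mem[OF s i]] action_of_int[OF s_mem[OF s i]] is_subring_of_int[OF subring] x(1))
      also have "\<dots> = of_real (L i z)" using re[OF i] by (simp add: L_def mult.commute)
      finally show ?thesis .
    qed
    have "y \<noteq> 0"
    proof
      assume "y = 0"
      then have "L i z = 0" if "i < n" for i using sy[OF that] action_0[OF s_mem[OF s that]] by simp
      then have "\<bar>real_of_int (z j)\<bar> \<le> 0" if "j < n" for j
        using c(1)[OF that, of "\<lambda>j. real_of_int (z j)"] unfolding L_def[symmetric] by simp
      then show False using z by auto
    qed
    have "(\<Prod>g\<in>G. g y) \<in> \<int>" using orbit_prod_fixed[OF yR] fixed_Ints by blast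
    then obtain m where m: "(\<Prod>g\<in>G. g y) = of_int m" by (elim Ints_cases)
    have "g y \<noteq> 0" if "g \<in> G" for g using action_inj[OF that, of y 0] action_0[OF that] \<open>y \<noteq> 0\<close> by auto
    then have "(\<Prod>g\<in>G. g y) \<noteq> 0" using fin by simp
    then have m0: "m \<noteq> 0" using m by auto
    have "(\<Prod>g\<in>G. g y) = (\<Prod>i<n. s i y)" by (rule prod.reindex_bij_betw[OF s, symmetric])
    also have "\<dots> = of_real (\<Prod>i<n. L i z)" using sy by simp
    finally have "of_real (\<Prod>i<n. L i z) = (of_real (of_int m) :: complex)" using m by simp
    then have "(\<Prod>i<n. L i z) = of_int m" by (simp only: of_real_eq_iff)
    then have "(\<Prod>i<n. \<bar>L i z\<bar>) = \<bar>of_int m\<bar>" by (simp flip: abs_prod)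
    then show ?thesis using m0 by simp
  qed
  \<comment> \<open>As \<open>e < 1\<close>, all \<open>n\<close> forms of a solution are at most 2
    in absolute value, whence the bound \<open>\<bar>c\<bar> * (2 * n)\<close> for the coordinates.
    Functions fixed outside \<open>{..<n}\<close> make the set finite.\<close>
  define B where "B = {z \<in> {..<n} \<rightarrow>\<^sub>E {- \<lfloor>\<bar>c\<bar> * (2 * n)\<rfloor>..\<lfloor>\<bar>c\<bar> * (2 * n)\<rfloor>}. \<bar>L 0 z\<bar> > 1}"
  have finB: "finite B" unfolding B_def by (rule finite_Collect_conjI[OF disjI1, folded Collect_conj_eq])
      (auto intro: finite_PiE)
  have main: "\<exists>z\<in>B. \<bar>L 0 z\<bar> < 1 + e" if e: "0 < e" "e < 1" for e
  proof -
    obtain z where z: "\<exists>j<n. z j \<noteq> 0" "\<bar>L 0 z\<bar> < 1 + e" "\<And>i. 0 < i \<Longrightarrow> i < n \<Longrightarrow> \<bar>L i z\<bar> < 1"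
      using c(2)[OF e] unfolding L_def by fastforce
    have "1 < \<bar>L 0 z\<bar>"
    proof -
      have "1 \<le> \<bar>L 0 z\<bar> * (\<Prod>i\<in>{..<n} - {0}. \<bar>L i z\<bar>)"
        using norm1[OF z(1)] n2 by (subst (asm) prod.remove[of _ 0]) auto
      moreover have "(\<Prod>i\<in>{..<n} - {0}. \<bar>L i z\<bar>) < 1"
      proof -
        have "{..<n} - {0} = insert 1 ({..<n} - {0, 1})" using n2 by auto
        then have "(\<Prod>i\<in>{..<n} - {0}. \<bar>L i z\<bar>) = \<bar>L 1 z\<bar> * (\<Prod>i\<in>{..<n} - {0, 1}. \<bar>L i z\<bar>)" by simp
        also have "\<dots> \<le> \<bar>L 1 z\<bar> * 1"
          using z(3) by (intro mult_left_mono prod_le_1) (auto intro: less_imp_le)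
        also have "\<dots> < 1" using z(3)[of 1] n2 by simp
        finally show ?thesis .
      qed
      moreover have "(\<Prod>i\<in>{..<n} - {0}. \<bar>L i z\<bar>) \<ge> 0" by (intro prod_nonneg) auto
      ultimately show ?thesis
        by (smt (verit) mult_left_le mult_less_cancel_left2 mult_le_cancel_right1 mult_nonneg_nonneg abs_ge_zero mult_left_mono)
    qed
    define z' where "z' = restrict z {..<n}"
    have L': "L i z' = L i z" for i unfolding L_def z'_def by (intro sum.cong) auto
    have "z' \<in> B"
    proof -
      have "\<bar>L i z\<bar> \<le> 2" if "i < n" for i
        using z(2) z(3)[OF _ that] e by (cases "i = 0") (auto intro: less_imp_le)
      then have S: "(\<Sum>i<n. \<bar>L i z\<bar>) \<le> (\<Sum>i<n. 2)" by (intro sum_mono) auto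
      have "z j \<in> {- \<lfloor>\<bar>c\<bar> * (2 * n)\<rfloor>..\<lfloor>\<bar>c\<bar> * (2 * n)\<rfloor>}" if "j < n" for j
      proof -
        have "\<bar>real_of_int (z j)\<bar> \<le> c * (\<Sum>i<n. \<bar>L i z\<bar>)"
          using c(1)[OF that, of "\<lambda>j. real_of_int (z j)"] unfolding L_def .
        also have "\<dots> \<le> \<bar>c\<bar> * (\<Sum>i<n. \<bar>L i z\<bar>)" by (intro mult_right_mono) (auto intro: sum_nonneg)
        also have "\<dots> \<le> \<bar>c\<bar> * (2 * n)" using S by (intro mult_left_mono) auto
        finally have "real_of_int \<bar>z j\<bar> \<le> \<bar>c\<bar> * (2 * n)" by simp
        then have "\<bar>z j\<bar> \<le> \<lfloor>\<bar>c\<bar> * (2 * n)\<rfloor>" by (simp only: le_floor_iff)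
        then show ?thesis by auto
      qed
      then show ?thesis using \<open>1 < \<bar>L 0 z\<bar>\<close> by (auto simp: B_def L' z'_def[symmetric]) (auto simp: z'_def)
    qed
    then show ?thesis by (rule bexI[rotated]) (simp add: L' z(2))
  qed
  define w where "w = Min ((\<lambda>z. \<bar>L 0 z\<bar>) ` B)"
  have "B \<noteq> {}" using main[of "1/2"] by auto
  then have "w \<in> (\<lambda>z. \<bar>L 0 z\<bar>) ` B" unfolding w_def using finB by (intro Min_in) auto
  then have "w > 1" by (auto simp: B_def)
  \<comment> \<open>Now \<open>1 + e \<le> w\<close>, while some member of \<open>B\<close> would
    have to lie below \<open>1 + e\<close>; the cap 1/2 keeps \<open>e\<close> in the admissible
    range.\<close>
  define e where "e = min (w - 1) (1 / 2)"
  have "0 < e" "e < 1" using \<open>w > 1\<close> by (auto simp: e_def)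
  then obtain z where "z \<in> B" "\<bar>L 0 z\<bar> < 1 + e" using main by blast
  moreover have "w \<le> \<bar>L 0 z\<bar>" unfolding w_def using finB \<open>z \<in> B\<close> by (intro Min_le) auto
  ultimately show False by (auto simp: e_def)
qed

end

section \<open>Legendre symbols\<close>

lemma Legendre_range: "Legendre a p \<in> {-1, 0, 1}"
  by (auto simp: Legendre_def)

lemma Legendre_eq_0_iff: "Legendre a p = 0 \<longleftrightarrow> p dvd a"
  by (simp add: Legendre_def cong_0_iff)

lemma sign_cong_imp_eq:
  fixes a b p :: int
  assumes "a \<in> {-1, 0, 1}" "b \<in> {-1, 0, 1}" "[a = b] (mod p)" "p > 2"
  shows "a = b"
proof (rule ccontr)
  assume "a \<noteq> b"
  moreover have "p dvd a - b" using assms(3) by (simp add: cong_iff_dvd_diff)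
  ultimately have "\<bar>p\<bar> \<le> \<bar>a - b\<bar>" by (intro dvd_imp_le_int) auto
  then show False using assms by auto
qed

lemma Legendre_mult:
  assumes p: "prime (p :: nat)" "p > 2"
  shows "Legendre (a * b) p = Legendre a p * Legendre b p"
proof (rule sign_cong_imp_eq)
  show "Legendre (a * b) p \<in> {-1, 0, 1}" by (rule Legendre_range)
  show "Legendre a p * Legendre b p \<in> {-1, 0, 1}"
    using Legendre_range[of a p] Legendre_range[of b p] by auto
  have "[Legendre (a * b) p = (a * b) ^ ((p - 1) div 2)] (mod p)" by (rule euler_criterion[OF p])
  also have "(a * b) ^ ((p - 1) div 2) = a ^ ((p - 1) div 2) * b ^ ((p - 1) div 2)"
    by (rule power_mult_distrib)
  also have "[\<dots> = Legendre a p * Legendre b p] (mod p)"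
    by (intro cong_mult cong_sym[OF euler_criterion[OF p]])
  finally show "[Legendre (a * b) p = Legendre a p * Legendre b p] (mod p)" .
  show "int p > 2" using p(2) by simp
qed

lemma Legendre_minus_1:
  assumes p: "prime (p :: nat)" "p > 2"
  shows "Legendre (- 1) p = (- 1) ^ ((p - 1) div 2)"
proof (rule sign_cong_imp_eq)
  show "Legendre (- 1) p \<in> {-1, 0, 1}" by (rule Legendre_range)
  show "(- 1) ^ ((p - 1) div 2) \<in> {-1, 0, 1 :: int}" by (simp add: minus_one_power_iff)
  show "[Legendre (- 1) p = (- 1) ^ ((p - 1) div 2)] (mod p)" by (rule euler_criterion[OF p])
  show "int p > 2" using p(2) by simp
qed

lemma Legendre_1:
  assumes "prime (p :: nat)" shows "Legendre 1 p = 1"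
proof -
  have "\<not> int p dvd 1" using prime_gt_1_nat[OF assms] by simp
  moreover have "QuadRes p 1" unfolding QuadRes_def by (intro exI[of _ 1]) simp
  ultimately show ?thesis by (simp add: Legendre_def cong_0_iff)
qed

context
  fixes p :: nat
  assumes p: "prime p" "p > 2"
begin

text \<open>For q* = q or -q, chosen to be 1 modulo 4, this says that the symbol of q* at
  \<open>p\<close> is the sign of q*. The form given depends on \<open>q\<close> only modulo 4 and
  is multiplicative, so it extends to products of such primes.\<close>

lemma Legendre_prime_of_neg:
  assumes q: "prime (q :: nat)" "odd q" and L: "Legendre (- int p) q = 1"
  shows "Legendre q p = (if q mod 4 = 1 then 1 else - Legendre (- 1) p)"
proof -
  have q2: "q > 2" using q prime_ge_2_nat[OF q(1)] by (cases "q = 2") auto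
  have pq: "p \<noteq> q"
  proof
    assume "p = q"
    then have "Legendre (- int p) q = 0" by (simp add: Legendre_eq_0_iff)
    then show False using L by simp
  qed
  have op: "odd p" using p prime_odd_nat by blast
  define ep eq where "ep = (p - 1) div 2" and "eq = (q - 1) div 2"
  have "Legendre (- 1) q * Legendre p q = 1"
    using L Legendre_mult[OF q(1) q2, of "-1" p] by simp
  then have 1: "(- 1) ^ eq * Legendre p q = 1" unfolding Legendre_minus_1[OF q(1) q2] eq_def .
  have "Legendre p q = (- 1) ^ eq * ((- 1) ^ eq * Legendre p q)"
    by (simp add: mult.assoc[symmetric] flip: power_add)
  then have 2: "Legendre p q = (- 1) ^ eq" unfolding 1 by simp
  have "Legendre p q * Legendre q p = (- 1) ^ (ep * eq)"
    unfolding ep_def eq_def using Quadratic_Reciprocity[OF p q(1) q2 pq] by simp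
  then have 3: "(- 1) ^ eq * Legendre q p = (- 1) ^ (ep * eq)" unfolding 2 .
  have "Legendre q p = (- 1) ^ eq * ((- 1) ^ eq * Legendre q p)"
    by (simp add: mult.assoc[symmetric] flip: power_add)
  then have 4: "Legendre q p = (- 1) ^ (eq + ep * eq)" unfolding 3 by (simp add: power_add)
  have 5: "Legendre (- 1) p = (- 1) ^ ep" unfolding Legendre_minus_1[OF p] ep_def ..
  show ?thesis
  proof (cases "q mod 4 = 1")
    case True
    then have "even eq" unfolding eq_def using q(2) by presburger
    then show ?thesis using True 4 by simp
  next
    case False
    then have "odd eq" unfolding eq_def using q(2) by presburger
    then have "(- 1 :: int) ^ (eq + ep * eq) = - ((- 1) ^ ep)" by (simp add: minus_one_power_iff)
    then show ?thesis using False 4 5 by simp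
  qed
qed

lemma Legendre_nat_of_neg:
  assumes "odd (m :: nat)" "\<And>q :: nat. prime q \<Longrightarrow> q dvd m \<Longrightarrow> Legendre (- int p) q = 1"
  shows "Legendre m p = (if m mod 4 = 1 then 1 else - Legendre (- 1) p)"
  using assms
proof (induction m rule: less_induct)
  case (less m)
  show ?case
  proof (cases "m = 1")
    case True
    then show ?thesis using Legendre_1[OF p(1)] by simp
  next
    case False
    then obtain q where q: "prime q" "q dvd m" using prime_factor_nat by blast
    then obtain k where k: "m = q * k" by (elim dvdE)
    have odd: "odd q" "odd k" using less.prems(1) k by auto
    have "k > 0" using odd(2) by (cases k) auto
    then have "k < m" using k prime_gt_1_nat[OF q(1)] by simp
    then have Lk: "Legendre k p = (if k mod 4 = 1 then 1 else - Legendre (- 1) p)"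
      using odd(2) less.prems(2) k by (intro less.IH) auto
    have Lq: "Legendre q p = (if q mod 4 = 1 then 1 else - Legendre (- 1) p)"
      by (rule Legendre_prime_of_neg[OF q(1) odd(1) less.prems(2)[OF q]])
    have "Legendre m p = Legendre q p * Legendre k p"
      using Legendre_mult[OF p, of q k] by (simp add: k)
    moreover have "Legendre (- 1) p * Legendre (- 1) p = 1"
      unfolding Legendre_minus_1[OF p] by (simp flip: power_add)
    moreover have "q mod 4 = 1 \<or> q mod 4 = 3" "k mod 4 = 1 \<or> k mod 4 = 3" using odd by presburger+
    moreover have "m mod 4 = (q mod 4) * (k mod 4) mod 4" by (simp add: k mod_mult_eq)
    ultimately show ?thesis using Lk Lq by (elim disjE) simp_all
  qed
qed

text \<open>For negative \<open>d\<close> the absolute value is 3 modulo 4, so its symbol contains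
  \<open>- Legendre (- 1) p\<close>; the sign of \<open>d\<close> contributes a second factor
  \<open>Legendre (- 1) p\<close>, and -1 remains.\<close>

lemma Legendre_eq_sgn:
  assumes d: "d mod 4 = (1 :: int)"
    "\<And>q :: nat. prime q \<Longrightarrow> int q dvd d \<Longrightarrow> Legendre (- int p) q = 1"
  shows "Legendre d p = sgn d"
proof -
  have "odd d" using d(1) by presburger
  then have "odd (nat \<bar>d\<bar>)" by (simp add: even_nat_iff)
  moreover have "Legendre (- int p) q = 1" if "prime q" "q dvd nat \<bar>d\<bar>" for q :: nat
    using d(2) that by (simp add: dvd_nat_abs_iff)
  ultimately have L: "Legendre (nat \<bar>d\<bar>) p = (if nat \<bar>d\<bar> mod 4 = 1 then 1 else - Legendre (- 1) p)"
    by (rule Legendre_nat_of_neg)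
  show ?thesis
  proof (cases "d > 0")
    case True
    then have "int (nat \<bar>d\<bar> mod 4) = 1" using d(1) by (simp add: zmod_int)
    then have "nat \<bar>d\<bar> mod 4 = 1" by simp
    then show ?thesis using L True by simp
  next
    case False
    have "d \<noteq> 0" using d(1) by auto
    then have neg: "d < 0" using False by simp
    have "(- d) mod 4 = 3" using d(1) by presburger
    then have "int (nat \<bar>d\<bar> mod 4) = 3" using neg by (simp add: zmod_int)
    then have "nat \<bar>d\<bar> mod 4 \<noteq> 1" by simp
    then have "Legendre (- d) p = - Legendre (- 1) p" using L neg by simp
    moreover have "Legendre d p = Legendre (- 1) p * Legendre (- d) p"
      using Legendre_mult[OF p, of "-1" "-d"] by simp
    moreover have "Legendre (- 1) p * Legendre (- 1) p = 1"
      unfolding Legendre_minus_1[OF p] by (simp flip: power_add)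
    ultimately show ?thesis using neg by simp
  qed
qed

end

section \<open>Subgroups\<close>

context ring_action
begin

lemma action_eqI: "g \<in> G \<Longrightarrow> h \<in> G \<Longrightarrow> (\<And>x. x \<in> R \<Longrightarrow> g x = h x) \<Longrightarrow> g = h"
  by (rule ext) (metis outside)

lemma subgroup_action:
  assumes "H \<subseteq> G" "id \<in> H" "\<And>g h. g \<in> H \<Longrightarrow> h \<in> H \<Longrightarrow> g \<circ> h \<in> H"
    "\<And>g h. g \<in> H \<Longrightarrow> h \<in> G \<Longrightarrow> h \<circ> g = id \<Longrightarrow> g \<circ> h = id \<Longrightarrow> h \<in> H"
  shows "ring_action R H"
proof
  show "is_subring R" by (rule subring)
  show "finite H" using finite_subset[OF assms(1) fin] .
  show "\<exists>h\<in>H. h \<circ> g = id \<and> g \<circ> h = id" if "g \<in> H" for g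
    using inverse_ex[of g] assms(1,4) that by blast
  show "hom_mod R {0} g" if "g \<in> H" for g using hom assms(1) that by blast
  show "g x = x" if "g \<in> H" "x \<notin> R" for g x using outside assms(1) that by blast
  show "id \<in> H" by (rule assms(2))
  show "g \<circ> h \<in> H" if "g \<in> H" "h \<in> H" for g h using that by (rule assms(3))
qed

lemma stabilizer_action: "ring_action R {g \<in> G. \<forall>x\<in>W. g x = x}"
proof (rule subgroup_action)
  fix g h assume g: "g \<in> {g \<in> G. \<forall>x\<in>W. g x = x}" and h: "h \<in> G" "h \<circ> g = id"
  have "h x = x" if "x \<in> W" for x
  proof -
    have "h (g x) = x" using h(2) by (metis comp_apply id_apply)
    then show ?thesis using g that by simp
  qed
  then show "h \<in> {g \<in> G. \<forall>x\<in>W. g x = x}" using h(1) by simp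
qed (auto simp: id_mem comp_mem)

text \<open>The Galois correspondence: \<open>hom_mod_is_action\<close>, applied to the action of
  \<open>H\<close> and the zero ideal, finds an element of \<open>H\<close> that agrees with
  \<open>c\<close>.\<close>

lemma mem_subgroupI:
  assumes H: "ring_action R H" "H \<subseteq> G" and c: "c \<in> G"
    and fix_c: "\<And>x. x \<in> R \<Longrightarrow> (\<And>h. h \<in> H \<Longrightarrow> h x = x) \<Longrightarrow> c x = x"
  shows "c \<in> H"
proof -
  interpret H: ring_action R H by (rule H(1))
  have "\<exists>h\<in>H. \<forall>x\<in>R. c x - h x \<in> {0}"
    by (rule H.hom_mod_is_action[OF is_prime_0[OF subring] hom[OF c]])
      (use fix_c in \<open>auto simp: H.fixed_def\<close>)
  then obtain h where h: "h \<in> H" "\<And>x. x \<in> R \<Longrightarrow> c x = h x" by auto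
  then have "c = h" using H(2) c by (intro action_eqI) auto
  then show ?thesis using h(1) by simp
qed

text \<open>Inertia of the ring of invariants of \<open>H\<close> lifts to inertia of
  \<open>R\<close>: an element trivial modulo \<open>Q\<close> on these invariants agrees modulo
  \<open>Q\<close> with some element of \<open>H\<close>, whose inverse is the required
  correction.\<close>

lemma inertia_mod_subgroup:
  assumes H: "ring_action R H" "H \<subseteq> G" and c: "c \<in> G" and Q: "is_prime R Q"
    and fix_c: "\<And>x. x \<in> R \<Longrightarrow> (\<And>h. h \<in> H \<Longrightarrow> h x = x) \<Longrightarrow> c x - x \<in> Q"
  shows "\<exists>h\<in>H. \<forall>x\<in>R. c (h x) - x \<in> Q"
proof -
  interpret H: ring_action R H by (rule H(1))
  note id = is_prime_ideal[OF Q]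
  have "hom_mod R Q c"
    unfolding hom_mod_def
    by (auto simp: action_0[OF c] action_1[OF c] action_add[OF c] action_mult[OF c] action_closed[OF c] is_idealD(2)[OF id])
  then have "\<exists>h\<in>H. \<forall>x\<in>R. c x - h x \<in> Q"
    by (rule H.hom_mod_is_action[OF Q]) (use fix_c in \<open>auto simp: H.fixed_def\<close>)
  then obtain h where h: "h \<in> H" "\<And>x. x \<in> R \<Longrightarrow> c x - h x \<in> Q" by blast
  obtain k where k: "k \<in> H" "h \<circ> k = id" using H.inverse_ex[OF h(1)] by blast
  have "c (k x) - x \<in> Q" if "x \<in> R" for x
    using h(2)[OF H.action_closed[OF k(1) that]] k(2) by (metis comp_apply id_apply)
  then show ?thesis using k(1) by blast
qed

end

lemma (in integer_action) action_divide:
  assumes g: "g \<in> G" and x: "x \<in> R" "x / of_nat n \<in> R"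
  shows "g (x / of_nat n) = g x / of_nat n"
proof (cases "n = 0")
  case True
  then show ?thesis using action_0[OF g] by simp
next
  case False
  have "of_nat n * g (x / of_nat n) = g (of_nat n * (x / of_nat n))"
    by (simp only: action_mult[OF g is_subring_of_nat[OF subring] x(2)] action_of_nat[OF g])
  also have "of_nat n * (x / of_nat n) = x" using False by simp
  finally show ?thesis using False by (simp add: field_simps)
qed

section \<open>Dihedral extensions\<close>

text \<open>
  \<open>R\<close> is the ring of integers of a Galois extension of \<open>\<rat>\<close> with group \<open>G\<close> which is abelian over the
  quadratic field of \<open>\<omega> = \<surd>-N\<close>, with group \<open>A\<close>; the set \<open>O\<^sub>K\<close> of invariants of \<open>A\<close> is described by
  \<open>quadratic\<close>, and \<open>unramified\<close> says that no prime of \<open>O\<^sub>K\<close> lies in the square of a prime above it.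
\<close>

locale quadratic_setting = integer_action R G
  for R :: "complex set" and G +
  fixes A :: "(complex \<Rightarrow> complex) set" and \<tau> :: "complex \<Rightarrow> complex" and N :: nat and \<omega> :: complex
  assumes A: "A \<subseteq> G" "id \<in> A" "\<And>a b. a \<in> A \<Longrightarrow> b \<in> A \<Longrightarrow> a \<circ> b \<in> A"
    "\<And>a. a \<in> A \<Longrightarrow> \<exists>b\<in>A. b \<circ> a = id \<and> a \<circ> b = id"
    and A_comm: "\<And>a b. a \<in> A \<Longrightarrow> b \<in> A \<Longrightarrow> a \<circ> b = b \<circ> a"
    and tau: "\<tau> \<in> G" "\<And>x. x \<in> R \<Longrightarrow> \<tau> x = cnj x" "\<And>a. a \<in> A \<Longrightarrow> \<tau> \<circ> a \<circ> \<tau> \<in> A"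
    and G_eq: "\<And>g. g \<in> G \<Longrightarrow> g \<in> A \<or> g \<circ> \<tau> \<in> A"
    and omega: "\<omega> \<in> R" "\<omega>\<^sup>2 = - of_nat N" "\<And>a. a \<in> A \<Longrightarrow> a \<omega> = \<omega>" "N mod 4 = 3 \<Longrightarrow> (1 + \<omega>) / 2 \<in> R"
    and N: "N > 0" "squarefree N"
    and quadratic: "\<And>x. x \<in> R \<Longrightarrow> (\<And>a. a \<in> A \<Longrightarrow> a x = x) \<Longrightarrow>
      \<exists>b c :: int. 2 * x = of_int b + of_int c * \<omega> \<and> 4 dvd b\<^sup>2 + int N * c\<^sup>2"
    and unramified: "\<And>Q q. is_prime R Q \<Longrightarrow> prime q \<Longrightarrow> of_nat q \<in> Q \<Longrightarrow>
      \<exists>x\<in>Q. x \<notin> ipow R Q 2 \<and> (\<forall>a\<in>A. a x = x)"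
begin

section \<open>The commutator subgroup and its ring of invariants\<close>

lemma tau_tau: "\<tau> \<circ> \<tau> = id"
proof (rule ext)
  fix x show "(\<tau> \<circ> \<tau>) x = id x"
    using tau(2)[of x] tau(2)[of "\<tau> x"] action_closed[OF tau(1), of x] outside[OF tau(1), of x]
    by (cases "x \<in> R") auto
qed

lemma tau_tau': "\<tau> (\<tau> x) = x"
  using fun_cong[OF tau_tau, of x] by simp

definition commutators :: "(complex \<Rightarrow> complex) set" where
  "commutators = {a \<circ> \<tau> \<circ> b \<circ> \<tau> | a b. a \<in> A \<and> b \<in> A \<and> a \<circ> b = id \<and> b \<circ> a = id}"

lemma commutatorsI:
  "a \<in> A \<Longrightarrow> b \<in> A \<Longrightarrow> a \<circ> b = id \<Longrightarrow> b \<circ> a = id \<Longrightarrow> a \<circ> \<tau> \<circ> b \<circ> \<tau> \<in> commutators"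
  unfolding commutators_def mem_Collect_eq by (intro exI conjI) (rule refl)

lemma commutatorsE:
  assumes "g \<in> commutators"
  obtains a b where "a \<in> A" "b \<in> A" "a \<circ> b = id" "b \<circ> a = id" "g = a \<circ> \<tau> \<circ> b \<circ> \<tau>"
  using assms unfolding commutators_def by blast

lemma commutators_subset_A: "commutators \<subseteq> A"
proof
  fix g assume "g \<in> commutators"
  then obtain a b where ab: "a \<in> A" "b \<in> A" "g = a \<circ> \<tau> \<circ> b \<circ> \<tau>" by (rule commutatorsE)
  have "a \<circ> (\<tau> \<circ> b \<circ> \<tau>) \<in> A" by (intro A(3) tau(3) ab)
  then show "g \<in> A" by (simp add: ab(3) comp_assoc)
qed

text \<open>As \<open>A\<close> is abelian and stable under conjugation by \<open>\<tau>\<close>,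
  the map sending \<open>a\<close> with inverse \<open>b\<close> to
  \<open>a \<circ> \<tau> \<circ> b \<circ> \<tau>\<close> is a homomorphism of \<open>A\<close>, so
  its image is a subgroup.\<close>

lemma commutators_action: "ring_action R commutators"
proof (rule subgroup_action)
  show "commutators \<subseteq> G" using commutators_subset_A A(1) by blast
  have "id \<circ> \<tau> \<circ> id \<circ> \<tau> = id" using tau_tau by simp
  then show "id \<in> commutators" using commutatorsI[OF A(2) A(2)] by simp
next
  fix g h assume "g \<in> commutators" "h \<in> commutators"
  then obtain a b c d where ab: "a \<in> A" "b \<in> A" "a \<circ> b = id" "b \<circ> a = id" "g = a \<circ> \<tau> \<circ> b \<circ> \<tau>"
    and cd: "c \<in> A" "d \<in> A" "c \<circ> d = id" "d \<circ> c = id" "h = c \<circ> \<tau> \<circ> d \<circ> \<tau>"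
    by (elim commutatorsE)
  have 1: "(\<tau> \<circ> b \<circ> \<tau>) \<circ> c = c \<circ> (\<tau> \<circ> b \<circ> \<tau>)" by (intro A_comm tau(3) ab cd)
  have "g \<circ> h = a \<circ> ((\<tau> \<circ> b \<circ> \<tau>) \<circ> c) \<circ> (\<tau> \<circ> d \<circ> \<tau>)" by (simp add: ab(5) cd(5) comp_assoc)
  also have "\<dots> = (a \<circ> c) \<circ> \<tau> \<circ> (b \<circ> (\<tau> \<circ> \<tau>) \<circ> d) \<circ> \<tau>" unfolding 1 by (simp only: comp_assoc)
  finally have gh: "g \<circ> h = (a \<circ> c) \<circ> \<tau> \<circ> (b \<circ> d) \<circ> \<tau>" by (simp add: tau_tau)
  have "(a \<circ> c) \<circ> (b \<circ> d) = a \<circ> (c \<circ> b) \<circ> d" by (simp only: comp_assoc)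
  also have "c \<circ> b = b \<circ> c" by (rule A_comm[OF cd(1) ab(2)])
  also have "a \<circ> (b \<circ> c) \<circ> d = (a \<circ> b) \<circ> (c \<circ> d)" by (simp only: comp_assoc)
  also have "\<dots> = id" unfolding ab(3) cd(3) by simp
  finally have 2: "(a \<circ> c) \<circ> (b \<circ> d) = id" .
  have "(b \<circ> d) \<circ> (a \<circ> c) = id" using A_comm[OF A(3)[OF ab(2) cd(2)] A(3)[OF ab(1) cd(1)]] 2 by simp
  then show "g \<circ> h \<in> commutators"
    unfolding gh by (intro commutatorsI 2 A(3) ab cd)
next
  fix g h assume "g \<in> commutators" and h: "h \<circ> g = id"
  then obtain a b where ab: "a \<in> A" "b \<in> A" "a \<circ> b = id" "b \<circ> a = id" "g = a \<circ> \<tau> \<circ> b \<circ> \<tau>"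
    by (elim commutatorsE)
  have "b \<circ> (\<tau> \<circ> a \<circ> \<tau>) = (\<tau> \<circ> a \<circ> \<tau>) \<circ> b" by (intro A_comm tau(3) ab)
  then have e: "b \<circ> \<tau> \<circ> a \<circ> \<tau> = \<tau> \<circ> a \<circ> \<tau> \<circ> b" by (simp add: comp_assoc)
  have "g \<circ> (b \<circ> \<tau> \<circ> a \<circ> \<tau>) = a \<circ> \<tau> \<circ> b \<circ> (\<tau> \<circ> \<tau>) \<circ> a \<circ> \<tau> \<circ> b"
    unfolding e ab(5) by (simp only: comp_assoc)
  also have "\<dots> = a \<circ> \<tau> \<circ> (b \<circ> a) \<circ> \<tau> \<circ> b" by (simp only: tau_tau comp_id comp_assoc)
  also have "\<dots> = a \<circ> (\<tau> \<circ> \<tau>) \<circ> b" by (simp only: ab(4) comp_id comp_assoc)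
  also have "\<dots> = id" by (simp only: tau_tau comp_id ab(3))
  finally have "g \<circ> (b \<circ> \<tau> \<circ> a \<circ> \<tau>) = id" .
  then have "h \<circ> (g \<circ> (b \<circ> \<tau> \<circ> a \<circ> \<tau>)) = h" by simp
  then have "(h \<circ> g) \<circ> (b \<circ> \<tau> \<circ> a \<circ> \<tau>) = h" by (simp only: comp_assoc)
  then have "h = b \<circ> \<tau> \<circ> a \<circ> \<tau>" using h by simp
  then show "h \<in> commutators" using commutatorsI ab by simp
qed

text \<open>When \<open>R\<close> is the ring of integers of the Hilbert class field, these are the
  integers of the genus field, on which \<open>G\<close> acts through an abelian group.\<close>

definition V :: "complex set" where
  "V = {x \<in> R. \<forall>g\<in>commutators. g x = x}"

lemma V_R: "x \<in> V \<Longrightarrow> x \<in> R"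
  by (simp add: V_def)

lemma V_fixed: "g \<in> commutators \<Longrightarrow> x \<in> V \<Longrightarrow> g x = x"
  by (simp add: V_def)

lemma V_A: "a \<in> A \<Longrightarrow> x \<in> V \<Longrightarrow> a x \<in> V"
proof -
  assume a: "a \<in> A" and x: "x \<in> V"
  have "g (a x) = a x" if g: "g \<in> commutators" for g
  proof -
    have "g \<circ> a = a \<circ> g" using commutators_subset_A g a by (intro A_comm) auto
    then have "g (a x) = a (g x)" by (metis comp_apply)
    then show ?thesis by (simp only: V_fixed[OF g x])
  qed
  then show ?thesis using action_closed[of a x] a A(1) x by (auto simp: V_def)
qed

lemma V_tau: "x \<in> V \<Longrightarrow> \<tau> x \<in> V"
proof -
  assume x: "x \<in> V"
  interpret X: ring_action R commutators by (rule commutators_action)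
  have "g (\<tau> x) = \<tau> x" if gc: "g \<in> commutators" for g
  proof -
    obtain a b where ab: "a \<in> A" "b \<in> A" "a \<circ> b = id" "b \<circ> a = id" "g = a \<circ> \<tau> \<circ> b \<circ> \<tau>"
      using gc by (elim commutatorsE)
    have "(b \<circ> \<tau> \<circ> a \<circ> \<tau>) x = x" using ab by (intro V_fixed[OF _ x] commutatorsI)
    then have "b (\<tau> (a (\<tau> x))) = x" by simp
    moreover have "(\<tau> \<circ> a \<circ> \<tau>) \<circ> b = b \<circ> (\<tau> \<circ> a \<circ> \<tau>)" by (intro A_comm tau(3) ab)
    from fun_cong[OF this, of x] have "\<tau> (a (\<tau> (b x))) = b (\<tau> (a (\<tau> x)))" by simp
    ultimately have "\<tau> (a (\<tau> (b x))) = x" by simp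
    then have "\<tau> (\<tau> (a (\<tau> (b x)))) = \<tau> x" by simp
    then have "a (\<tau> (b x)) = \<tau> x" by (simp only: tau_tau')
    then show ?thesis by (simp add: ab(5) tau_tau')
  qed
  then show ?thesis using action_closed[OF tau(1)] x by (auto simp: V_def)
qed

lemma V_comm_tau: "a \<in> A \<Longrightarrow> x \<in> V \<Longrightarrow> a (\<tau> x) = \<tau> (a x)"
proof -
  assume a: "a \<in> A" and x: "x \<in> V"
  obtain b where b: "b \<in> A" "b \<circ> a = id" "a \<circ> b = id" using A(4)[OF a] by blast
  have "a \<circ> \<tau> \<circ> b \<circ> \<tau> \<in> commutators" using a b by (intro commutatorsI)
  moreover have "\<tau> (a x) \<in> V" by (rule V_tau[OF V_A[OF a x]])
  ultimately have "(a \<circ> \<tau> \<circ> b \<circ> \<tau>) (\<tau> (a x)) = \<tau> (a x)" by (rule V_fixed)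
  then have "a (\<tau> (b (\<tau> (\<tau> (a x))))) = \<tau> (a x)" by simp
  moreover have "b (a x) = x" using b(2) by (metis comp_apply id_apply)
  ultimately show ?thesis by (simp add: tau_tau')
qed

lemma G_cases:
  assumes "g \<in> G" obtains "g \<in> A" | a where "a \<in> A" "g = a \<circ> \<tau>"
proof -
  have eq: "g = g \<circ> \<tau> \<circ> \<tau>" by (simp add: comp_assoc tau_tau)
  show ?thesis
  proof (cases "g \<in> A")
    case True
    then show ?thesis by (rule that(1))
  next
    case False
    then have "g \<circ> \<tau> \<in> A" using G_eq[OF assms] by blast
    then show ?thesis using eq by (rule that(2))
  qed
qed

lemma V_G:
  assumes "g \<in> G" and x: "x \<in> V" shows "g x \<in> V"
  using assms(1)
proof (cases rule: G_cases)
  case 1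
  then show ?thesis using V_A x by blast
next
  case (2 a)
  then show ?thesis using V_A[OF 2(1) V_tau[OF x]] by simp
qed

lemma V_comm: "g \<in> G \<Longrightarrow> h \<in> G \<Longrightarrow> x \<in> V \<Longrightarrow> g (h x) = h (g x)"
proof -
  assume g: "g \<in> G" and h: "h \<in> G" and x: "x \<in> V"
  have AA: "a (b y) = b (a y)" if "a \<in> A" "b \<in> A" for a b y
    using fun_cong[OF A_comm[OF that], of y] by simp
  show ?thesis
    using g
  proof (cases rule: G_cases)
    case 1
    show ?thesis
      using h
    proof (cases rule: G_cases)
      case 1
      then show ?thesis using AA \<open>g \<in> A\<close> by blast
    next
      case (2 b)
      then show ?thesis
        using AA[OF \<open>g \<in> A\<close> 2(1), of "\<tau> x"] V_comm_tau[OF \<open>g \<in> A\<close> x] by simp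
    qed
  next
    case (2 a)
    show ?thesis
      using h
    proof (cases rule: G_cases)
      case 1
      then have "a (\<tau> (h x)) = h (a (\<tau> x))"
        using AA[OF 2(1) 1, of "\<tau> x"] V_comm_tau[OF 1 x] by simp
      then show ?thesis by (simp add: 2(2))
    next
      case (2 b)
      have ga: "a \<in> A" "g = a \<circ> \<tau>" by fact+
      have "a (\<tau> (b (\<tau> x))) = a (b x)"
        using V_comm_tau[OF 2(1) V_tau[OF x]] by (simp add: tau_tau')
      also have "\<dots> = b (a x)" by (rule AA[OF ga(1) 2(1)])
      also have "\<dots> = b (\<tau> (a (\<tau> x)))"
        using V_comm_tau[OF ga(1) V_tau[OF x]] by (simp add: tau_tau')
      finally show ?thesis by (simp add: ga(2) 2(2))
    qed
  qed
qed

lemma V_subring: "is_subring V"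
proof -
  interpret X: ring_action R commutators by (rule commutators_action)
  show ?thesis unfolding is_subring_def V_def
    by (auto simp: X.action_0 X.action_1 X.action_minus X.action_add X.action_mult
        is_subringD(1,2)[OF subring] is_subringD(3)[OF subring] is_subringD(4)[OF subring] is_subringD(5)[OF subring])
qed

section \<open>Inertia groups, and the ring fixed by them and by complex conjugation\<close>

definition inertia :: "complex set \<Rightarrow> (complex \<Rightarrow> complex) set" where
  "inertia Q = {g \<in> G. \<forall>x\<in>R. g x - x \<in> Q}"

definition all_inertia :: "(complex \<Rightarrow> complex) set" where
  "all_inertia = {g. \<exists>Q q. is_prime R Q \<and> prime (q :: nat) \<and> of_nat q \<in> Q \<and> g \<in> inertia Q}"

lemma all_inertia_G: "g \<in> all_inertia \<Longrightarrow> g \<in> G"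
  by (auto simp: all_inertia_def inertia_def)

lemma inertia_A_trivial:
  assumes "is_prime R Q" "prime (q :: nat)" "of_nat q \<in> Q" "g \<in> inertia Q" "g \<in> A"
  shows "g = id"
proof -
  obtain x where "x \<in> Q" "x \<notin> ipow R Q 2" "\<forall>a\<in>A. a x = x" using unramified[OF assms(1-3)] by blast
  then show ?thesis using assms by (intro inertia_trivial[OF assms(1-3), of x]) (auto simp: inertia_def)
qed

text \<open>An element of an inertia group outside \<open>A\<close> has its square in
  \<open>A\<close> and still in the inertia group, and by \<open>unramified\<close> that
  intersection is trivial.\<close>

lemma all_inertia_square: "g \<in> all_inertia \<Longrightarrow> g (g x) = x"
proof -
  assume "g \<in> all_inertia"
  then obtain Q q where Q: "is_prime R Q" "prime (q :: nat)" "of_nat q \<in> Q" and g: "g \<in> inertia Q"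
    by (auto simp: all_inertia_def)
  note id = is_prime_ideal[OF Q(1)]
  have gG: "g \<in> G" using g by (simp add: inertia_def)
  show ?thesis
    using gG
  proof (cases rule: G_cases)
    case 1
    then show ?thesis using inertia_A_trivial[OF Q g] by simp
  next
    case (2 a)
    have "a \<circ> (\<tau> \<circ> a \<circ> \<tau>) \<in> A" by (intro A(3) tau(3) 2)
    then have ggA: "g \<circ> g \<in> A" by (simp add: 2(2) comp_assoc)
    have "g (g x) - x \<in> Q" if "x \<in> R" for x
    proof (rule is_ideal_trans_diff[OF subring id])
      show "g (g x) - g x \<in> Q" "g x - x \<in> Q"
        using g that action_closed[OF gG that] by (auto simp: inertia_def)
    qed
    then have "g \<circ> g \<in> inertia Q" using gG by (auto simp: inertia_def intro: comp_mem)
    then have "g \<circ> g = id" using inertia_A_trivial[OF Q] ggA by blast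
    then show ?thesis by (metis comp_apply id_apply)
  qed
qed

text \<open>The ring to which Minkowski's theorem is applied: fixing by \<open>\<tau>\<close> makes
  it real, and fixing by all inertia makes it unramified over the integers.\<close>

definition W :: "complex set" where
  "W = {x \<in> V. \<tau> x = x \<and> (\<forall>g\<in>all_inertia. g x = x)}"

lemma W_VD: "x \<in> W \<Longrightarrow> x \<in> V"
  by (simp add: W_def)

lemma W_R: "x \<in> W \<Longrightarrow> x \<in> R"
  by (simp add: W_def V_def)

lemma W_fixed: "x \<in> W \<Longrightarrow> \<tau> x = x" "g \<in> all_inertia \<Longrightarrow> x \<in> W \<Longrightarrow> g x = x"
  by (auto simp: W_def)

lemma W_G:
  assumes g: "g \<in> G" and x: "x \<in> W" shows "g x \<in> W"
proof -
  note xV = W_VD[OF x]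
  have "\<tau> (g x) = g x" using V_comm[OF tau(1) g xV] W_fixed(1)[OF x] by simp
  moreover have "h (g x) = g x" if "h \<in> all_inertia" for h
    using V_comm[OF all_inertia_G[OF that] g xV] W_fixed(2)[OF that x] by simp
  ultimately show ?thesis using V_G[OF g xV] by (simp add: W_def)
qed

lemma W_subring: "is_subring W"
proof -
  have g0: "g 0 = 0" "g 1 = 1" if "g \<in> G" for g using that by (auto simp: action_0 action_1)
  have g1: "g (- x) = - g x" if "g \<in> G" "x \<in> V" for g x using that V_R by (auto simp: action_minus)
  have g2: "g (x + y) = g x + g y" "g (x * y) = g x * g y" if "g \<in> G" "x \<in> V" "y \<in> V" for g x y
    using that V_R by (auto simp: action_add action_mult)
  show ?thesis unfolding is_subring_def W_def
    using is_subringD(1-5)[OF V_subring] by (auto simp: g0 g1 g2 tau(1) all_inertia_G)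
qed

text \<open>The restriction to \<open>W\<close> is meaningful because the elements of
  \<open>G\<close> commute on \<open>V\<close> and therefore preserve the conditions that define
  \<open>W\<close>.\<close>

definition res :: "(complex \<Rightarrow> complex) \<Rightarrow> complex \<Rightarrow> complex" where
  "res g = (\<lambda>x. if x \<in> W then g x else x)"

lemma res_comp: "g \<in> G \<Longrightarrow> h \<in> G \<Longrightarrow> res g \<circ> res h = res (g \<circ> h)"
  by (rule ext) (auto simp: res_def W_G)

lemma res_id: "res id = id"
  by (rule ext) (simp add: res_def)

lemma W_ring_action: "ring_action W (res ` G)"
proof
  show "is_subring W" by (rule W_subring)
  show "finite (res ` G)" using fin by simp
  show "id \<in> res ` G" using res_id id_mem by (metis imageI)
  show "g \<circ> h \<in> res ` G" if "g \<in> res ` G" "h \<in> res ` G" for g h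
    using that res_comp comp_mem by (auto simp del: comp_apply)
  show "\<exists>h\<in>res ` G. h \<circ> g = id \<and> g \<circ> h = id" if gG: "g \<in> res ` G" for g
  proof -
    obtain g' where g': "g' \<in> G" "g = res g'" using gG by blast
    then obtain h where h: "h \<in> G" "h \<circ> g' = id" "g' \<circ> h = id" using inverse_ex by blast
    then show ?thesis using g' res_comp res_id by (intro bexI[of _ "res h"]) auto
  qed
  show "hom_mod W {0} g" if gG: "g \<in> res ` G" for g
  proof -
    obtain g' where g': "g' \<in> G" "g = res g'" using gG by blast
    note rw = is_subringD[OF W_subring]
    show ?thesis unfolding g'(2) hom_mod_def res_def
      using g'(1) rw W_G W_R by (auto simp: action_0 action_1 action_add action_mult)
  qed
  show "g x = x" if "g \<in> res ` G" "x \<notin> W" for g x using that by (auto simp: res_def)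
qed

lemma W_action: "integer_action W (res ` G)"
proof -
  interpret RA: ring_action W "res ` G" by (rule W_ring_action)
  show ?thesis
  proof
    show "algebraic_int x" if "x \<in> W" for x using integral W_R that by blast
    show "RA.fixed \<subseteq> \<int>"
    proof -
      have "RA.fixed \<subseteq> fixed" using W_R unfolding RA.fixed_def fixed_def by (auto simp: res_def)
      then show ?thesis using fixed_Ints by blast
    qed
    show "x / of_nat n \<in> W" if x: "x \<in> W" "n > 0" "algebraic_int (x / of_nat n)" for x n
    proof -
      have R: "x / of_nat n \<in> R" using saturated[OF W_R[OF x(1)] x(2,3)] .
      have "g (x / of_nat n) = x / of_nat n" if "g \<in> G" "g x = x" for g
        using action_divide[OF that(1) W_R[OF x(1)] R] that(2) by simp
      then show ?thesis using x(1) R tau(1) all_inertia_G commutators_subset_A A(1) unfolding W_def V_def by auto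
    qed
  qed
qed

text \<open>If the differences \<open>z - g z\<close> generated a proper ideal, a prime
  \<open>Q\<close> would contain them. By \<open>inertia_mod_subgroup\<close>, \<open>g\<close>
  times an element trivial on \<open>W\<close> would then be in an inertia group of
  \<open>R\<close>, and so would fix \<open>W\<close>; hence \<open>g\<close> would fix
  \<open>W\<close> too.\<close>

lemma W_separated:
  assumes g: "g \<in> G" "res g \<noteq> id"
  shows "\<exists>f\<in>integer_action.twisted W (res ` G). f id - f (res g) = 1"
proof -
  interpret WA: integer_action W "res ` G" by (rule W_action)
  obtain z0 where z0: "z0 \<in> W" "g z0 \<noteq> z0"
  proof -
    have "\<exists>x. res g x \<noteq> x" using g(2) by (metis ext id_apply)
    then show ?thesis using that by (auto simp: res_def split: if_splits)
  qed
  \<comment> \<open>The values of \<open>f\<close> are restricted to \<open>R\<close>, since the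
    coefficients of twisted functions range over all algebraic integers while \<open>I\<close> has
    to be an ideal of \<open>R\<close>.\<close>
  define I where "I = {t. \<exists>f\<in>WA.twisted. t = f id - f (res g) \<and> (\<forall>h\<in>res ` G. f h \<in> R)}"
  have base: "y * (z - g z) \<in> I" if "y \<in> R" "z \<in> W" for y z
  proof -
    have "(\<lambda>h. y * h z) \<in> WA.twisted" using that integral by (intro WA.twisted.base[of y z]) auto
    moreover have "y * h z \<in> R" if "h \<in> res ` G" for h
      using WA.action_closed[OF that \<open>z \<in> W\<close>] W_R \<open>y \<in> R\<close> by (intro is_subringD(5)[OF subring])
    ultimately show ?thesis unfolding I_def
      by (intro CollectI bexI[of _ "\<lambda>h. y * h z"]) (auto simp: res_def that right_diff_distrib)
  qed
  have idG: "id \<in> res ` G" "res g \<in> res ` G" using WA.id_mem g(1) by auto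
  have I: "is_ideal R I"
    unfolding is_ideal_def
  proof (intro conjI ballI)
    show "I \<subseteq> R"
    proof
      fix t assume "t \<in> I"
      then obtain f where f: "t = f id - f (res g)" "\<forall>h\<in>res ` G. f h \<in> R" unfolding I_def by blast
      show "t \<in> R" unfolding f(1) using f(2) idG by (intro is_subringD(6)[OF subring]) blast+
    qed
    show "0 \<in> I" using base[OF is_subringD(1)[OF subring] z0(1)] by simp
    show "x + y \<in> I" if "x \<in> I" "y \<in> I" for x y
    proof -
      obtain f1 f2 where f: "f1 \<in> WA.twisted" "x = f1 id - f1 (res g)" "\<forall>h\<in>res ` G. f1 h \<in> R"
        "f2 \<in> WA.twisted" "y = f2 id - f2 (res g)" "\<forall>h\<in>res ` G. f2 h \<in> R"
        using \<open>x \<in> I\<close> \<open>y \<in> I\<close> unfolding I_def by blast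
      have "(\<lambda>h. f1 h + f2 h) \<in> WA.twisted" by (rule WA.twisted.add[OF f(1,4)]) simp
      then show ?thesis unfolding I_def using f is_subringD(4)[OF subring]
        by (intro CollectI bexI[of _ "\<lambda>h. f1 h + f2 h"]) auto
    qed
    show "x * y \<in> I" if x: "x \<in> R" and "y \<in> I" for x y
    proof -
      obtain f where f: "f \<in> WA.twisted" "y = f id - f (res g)" "\<forall>h\<in>res ` G. f h \<in> R"
        using \<open>y \<in> I\<close> unfolding I_def by blast
      have "(\<lambda>h. x * f h) \<in> WA.twisted" by (rule WA.twisted_mult[OF WA.twisted_const[OF integral[OF x]] f(1)])
      then show ?thesis unfolding I_def using f x is_subringD(5)[OF subring]
        by (intro CollectI bexI[of _ "\<lambda>h. x * f h"]) (auto simp: right_diff_distrib)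
    qed
  qed
  have "1 \<in> I"
  proof (rule ccontr)
    assume "1 \<notin> I"
    then obtain Q where Q: "is_prime R Q" "I \<subseteq> Q" using prime_ideal_ex[OF subring I] by blast
    note id = is_prime_ideal[OF Q(1)]
    have zQ: "z - g z \<in> Q" if "z \<in> W" for z
      using base[OF is_subringD(2)[OF subring] that] Q(2) by auto
    have "z0 - g z0 \<noteq> 0" using z0(2) by auto
    then obtain q where q: "prime (q :: nat)" "of_nat q \<in> Q"
      using prime_contains_prime[OF Q(1) zQ[OF z0(1)]] by blast
    define H where "H = {h \<in> G. \<forall>x\<in>W. h x = x}"
    have HA: "ring_action R H" unfolding H_def by (rule stabilizer_action)
    have "\<exists>h\<in>H. \<forall>x\<in>R. g (h x) - x \<in> Q"
    proof (rule inertia_mod_subgroup[OF HA _ g(1) Q(1)])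
      show "H \<subseteq> G" by (auto simp: H_def)
      fix x assume x: "x \<in> R" "\<And>h. h \<in> H \<Longrightarrow> h x = x"
      have "commutators \<subseteq> H" "\<tau> \<in> H" "all_inertia \<subseteq> H"
        using commutators_subset_A A(1) tau(1) all_inertia_G by (auto simp: H_def W_def V_def)
      then have "x \<in> W" using x by (auto simp: W_def V_def)
      then show "g x - x \<in> Q" using is_ideal_minus[OF subring id zQ] by fastforce
    qed
    then obtain h where h: "h \<in> H" "\<And>x. x \<in> R \<Longrightarrow> g (h x) - x \<in> Q" by blast
    have "g \<circ> h \<in> inertia Q" unfolding inertia_def using h g(1) by (auto simp: H_def intro: comp_mem)
    then have "g \<circ> h \<in> all_inertia" unfolding all_inertia_def using Q(1) q by blast
    then have "(g \<circ> h) z0 = z0" using z0(1) by (rule W_fixed(2))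
    moreover have "h z0 = z0" using h(1) z0(1) by (simp add: H_def)
    ultimately show False using z0(2) by simp
  qed
  then show ?thesis unfolding I_def by (auto intro: sym)
qed

lemma W_Ints: "W \<subseteq> \<int>"
proof -
  interpret WA: integer_action W "res ` G" by (rule W_action)
  interpret UA: unramified_action W "res ` G"
  proof
    show "\<exists>f\<in>WA.twisted. f id - f g = 1" if "g \<in> res ` G" "g \<noteq> id" for g
      using that W_separated by blast
    show "W \<subseteq> \<real>"
    proof
      fix x assume x: "x \<in> W"
      then have "cnj x = x" using tau(2)[OF W_R[OF x]] by (simp add: W_def)
      then show "x \<in> \<real>" by (simp add: Reals_cnj_iff)
    qed
  qed
  have "g x = x" if "g \<in> G" "x \<in> W" for g x
  proof -
    have "res g = id" using UA.trivial that(1) by blast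
    then show ?thesis using that(2) by (metis id_apply res_def)
  qed
  then have "W \<subseteq> fixed" using W_R by (auto simp: fixed_def)
  then show ?thesis using fixed_Ints by blast
qed

text \<open>
  The group of \<open>V\<close> over the rationals is generated by the images of \<open>\<tau>\<close> and of the inertia groups,
  all of order at most 2.
\<close>

lemma V_involution: "g \<in> G \<Longrightarrow> x \<in> V \<Longrightarrow> g (g x) = x"
proof -
  assume g: "g \<in> G" and x: "x \<in> V"
  define H where "H = {h \<in> G. \<forall>x\<in>V. h (h x) = x}"
  have HA: "ring_action R H"
  proof (rule subgroup_action)
    fix g h assume "g \<in> H" "h \<in> H"
    then have gh: "g \<in> G" "h \<in> G" "\<And>x. x \<in> V \<Longrightarrow> g (g x) = x" "\<And>x. x \<in> V \<Longrightarrow> h (h x) = x"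
      unfolding H_def mem_Collect_eq by blast+
    have "g (h (g (h x))) = x" if "x \<in> V" for x
    proof -
      have "h (g (h x)) = g (h (h x))" using V_comm[OF gh(2,1) V_G[OF gh(2) that]] .
      then show ?thesis using gh that by simp
    qed
    then show "g \<circ> h \<in> H" using gh by (auto simp: H_def intro: comp_mem)
  next
    fix g h assume g: "g \<in> H" and h: "h \<in> G" "h \<circ> g = id"
    have gG: "g \<in> G" "\<And>x. x \<in> V \<Longrightarrow> g (g x) = x" using g unfolding H_def mem_Collect_eq by blast+
    have hg: "h (g x) = x" for x using fun_cong[OF h(2), of x] by simp
    have "h x = g x" if "x \<in> V" for x using hg[of "g x"] gG(2)[OF that] by simp
    then have "h (h x) = x" if "x \<in> V" for x using that gG V_G by simp
    then show "h \<in> H" using h(1) by (simp add: H_def)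
  qed (auto simp: H_def id_mem)
  \<comment> \<open>\<open>H\<close> contains the commutators, \<open>\<tau>\<close> and all
    inertia, so an invariant of \<open>H\<close> lies in \<open>W\<close> and is an integer, which
    \<open>g\<close> fixes; the Galois correspondence then places \<open>g\<close> in
    \<open>H\<close>.\<close>
  have "g \<in> H"
  proof (rule mem_subgroupI[OF HA _ g])
    show "H \<subseteq> G" by (auto simp: H_def)
    fix x assume x: "x \<in> R" "\<And>h. h \<in> H \<Longrightarrow> h x = x"
    have "commutators \<subseteq> H" "\<tau> \<in> H" "all_inertia \<subseteq> H"
      using commutators_subset_A A(1) tau(1) all_inertia_G tau_tau' all_inertia_square
      by (auto simp: H_def V_def)
    then have "x \<in> W" using x by (auto simp: W_def V_def)
    then obtain n where "x = of_int n" using W_Ints by (auto elim: Ints_cases)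
    then show "g x = x" using action_of_int[OF g] by simp
  qed
  then show ?thesis using x by (simp add: H_def)
qed

text \<open>Simultaneous diagonalization of commuting involutions: for each further
  \<open>g\<close>, either \<open>d\<close> already has eigenvalue -1, or \<open>d + g d\<close> is
  a nonzero vector with eigenvalue 1 that keeps the earlier eigenvalues.\<close>

lemma eigenvector_ex:
  assumes c: "c \<in> G" and y: "y \<in> V" "y \<noteq> 0" "c y = - y"
  shows "\<exists>\<delta>\<in>V. \<delta> \<noteq> 0 \<and> c \<delta> = - \<delta> \<and> (\<forall>g\<in>G. g \<delta> = \<delta> \<or> g \<delta> = - \<delta>)"
proof -
  have "\<exists>\<delta>\<in>V. \<delta> \<noteq> 0 \<and> c \<delta> = - \<delta> \<and> (\<forall>g\<in>S. g \<delta> = \<delta> \<or> g \<delta> = - \<delta>)" if "S \<subseteq> G" for S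
    using finite_subset[OF that fin] that
  proof (induction S rule: finite_induct)
    case empty
    then show ?case using y by blast
  next
    case (insert g S)
    then obtain d where d: "d \<in> V" "d \<noteq> 0" "c d = - d" "\<forall>g\<in>S. g d = d \<or> g d = - d" by auto
    have g: "g \<in> G" using insert.prems by simp
    show ?case
    proof (cases "g d = - d")
      case True
      then show ?thesis using d by blast
    next
      case False
      define e where "e = d + g d"
      have gd: "g d \<in> V" by (rule V_G[OF g d(1)])
      have e: "e \<in> V" unfolding e_def by (rule is_subringD(4)[OF V_subring d(1) gd])
      have he: "h e = h d + g (h d)" if "h \<in> G" for h
        using action_add[OF that V_R[OF d(1)] V_R[OF gd]] V_comm[OF that g d(1)] by (simp add: e_def)
      have gm: "g (- d) = - g d" by (rule action_minus[OF g V_R[OF d(1)]])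
      have "e \<noteq> 0" using False by (auto simp: e_def add_eq_0_iff)
      moreover have "c e = - e" using he[OF c] d(3) gm by (simp add: e_def)
      moreover have "g e = e" using he[OF g] V_involution[OF g d(1)] by (simp add: e_def)
      moreover have "h e = e \<or> h e = - e" if "h \<in> S" for h
      proof -
        have h: "h e = h d + g (h d)" using he that insert.prems by blast
        have "h d = d \<or> h d = - d" using d(4) that by blast
        then show ?thesis
        proof
          assume "h d = d"
          then show ?thesis unfolding h by (simp add: e_def)
        next
          assume "h d = - d"
          then show ?thesis unfolding h by (simp add: gm) (simp add: e_def)
        qed
      qed
      ultimately show ?thesis using e by blast
    qed
  qed
  then show ?thesis by blast
qed

text \<open>Starting from \<open>y - c y\<close>, on which \<open>c\<close> acts as -1, a
  simultaneous eigenvector \<open>e\<close> has an invariant square, hence an integer. Dividing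
  \<open>e\<close> by the root of the square part leaves a squarefree radicand and stays in
  \<open>R\<close> by \<open>saturated\<close>.\<close>

lemma square_root_ex:
  assumes c: "c \<in> G" and y: "y \<in> V" "c y \<noteq> y"
  obtains \<delta> d where "\<delta> \<in> R" "\<delta>\<^sup>2 = of_int d" "squarefree d" "c \<delta> = - \<delta>" "\<And>g. g \<in> G \<Longrightarrow> g \<delta> = \<delta> \<or> g \<delta> = - \<delta>"
proof -
  define y' where "y' = y - c y"
  have cy: "c y \<in> V" by (rule V_G[OF c y(1)])
  have "y' \<in> V" unfolding y'_def by (rule is_subringD(6)[OF V_subring y(1) cy])
  moreover have "y' \<noteq> 0" using y(2) by (simp add: y'_def)
  moreover have "c y' = - y'"
    using action_diff[OF c V_R[OF y(1)] V_R[OF cy]] V_involution[OF c y(1)] by (simp add: y'_def)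
  ultimately obtain e where e: "e \<in> V" "e \<noteq> 0" "c e = - e" "\<forall>g\<in>G. g e = e \<or> g e = - e"
    using eigenvector_ex[OF c] by blast
  have eR: "e \<in> R" by (rule V_R[OF e(1)])
  have "g (e\<^sup>2) = e\<^sup>2" if "g \<in> G" for g
    using action_power[OF that eR, of 2] e(4) that by auto
  then have "e\<^sup>2 \<in> fixed" using is_subring_power[OF subring eR] by (simp add: fixed_def)
  then obtain D where D: "e\<^sup>2 = of_int D" using fixed_Ints by (auto elim: Ints_cases)
  have D0: "D \<noteq> 0" using D e(2) by auto
  define d where "d = squarefree_part D"
  define m where "m = nat \<bar>square_part D\<bar>"
  have Ddm: "D = d * int m ^ 2"
    using squarefree_decompose[of D] by (simp add: d_def m_def)
  have m0: "m > 0" using D0 Ddm by (cases "m = 0") auto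
  have sq: "(e / of_nat m)\<^sup>2 = of_int d" using D m0 by (simp add: Ddm power_divide)
  then have "algebraic_int (e / of_nat m)"
    using algebraic_int_square_root[of "e / of_nat m"] by simp
  then have emR: "e / of_nat m \<in> R" by (rule saturated[OF eR m0])
  have g: "g (e / of_nat m) = g e / of_nat m" if "g \<in> G" for g
    by (rule action_divide[OF that eR emR])
  show ?thesis
  proof (rule that[OF emR sq])
    show "squarefree d" unfolding d_def by (rule squarefree_squarefree_part)
    show "c (e / of_nat m) = - (e / of_nat m)" by (simp add: g[OF c] e(3))
    show "g (e / of_nat m) = e / of_nat m \<or> g (e / of_nat m) = - (e / of_nat m)" if "g \<in> G" for g
    proof -
      have "g e = e \<or> g e = - e" using e(4) that by blast
      then show ?thesis by (auto simp: g[OF that])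
    qed
  qed
qed

end

section \<open>Conditions on the squarefree numbers that have a square root in
  \<open>R\<close>\<close>

context quadratic_setting
begin

lemma not_all_in_Q2:
  assumes Q: "is_prime R Q" "prime q" "of_nat q \<in> Q" and q2: "of_nat q \<in> ipow R Q 2"
    and cases: "(odd q \<and> \<not> q dvd N) \<or> (q = 2 \<and> (1 + \<omega>) / 2 \<in> R) \<or>
      (q = 2 \<and> odd N \<and> 1 + \<omega> \<in> ipow R Q 2) \<or> (q = 2 \<and> even N \<and> \<omega> \<in> ipow R Q 2)"
  shows False
proof -
  obtain x where x: "x \<in> Q" "x \<notin> ipow R Q 2" "\<And>a. a \<in> A \<Longrightarrow> a x = x"
    using unramified[OF Q] by blast
  have xR: "x \<in> R" using is_idealD(1)[OF is_prime_ideal[OF Q(1)] x(1)] .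
  obtain b c :: int where "2 * x = of_int b + of_int c * \<omega>" "4 dvd b\<^sup>2 + int N * c\<^sup>2"
    using quadratic[OF xR] x(3) by blast
  then have "x \<in> ipow R Q 2"
    by (rule quadratic_in_Q2[OF Q omega(1,2) xR x(1) _ _ q2 N(2) cases])
  then show False using x(2) by blast
qed

text \<open>Otherwise \<open>q\<close> would ramify through \<open>\<delta>\<close> without
  ramifying in the quadratic field, so that \<open>Q\<close> would keep no fixed element outside its
  square.\<close>

lemma odd_prime_dvd:
  assumes d: "\<delta> \<in> R" "\<delta>\<^sup>2 = of_int d" "squarefree d" and q: "prime (q :: nat)" "odd q" "int q dvd d"
  shows "q dvd N"
proof (rule ccontr)
  assume n: "\<not> q dvd N"
  obtain Q where Q: "is_prime R Q" "of_nat q \<in> Q" using prime_over_ex[OF q(1)] .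
  have "\<not> (int q)\<^sup>2 dvd d"
  proof
    assume "(int q)\<^sup>2 dvd d"
    then have "int q dvd 1" using d(3) by (rule squarefreeD[rotated])
    then show False using prime_gt_1_nat[OF q(1)] by simp
  qed
  then have "of_nat q \<in> ipow R Q 2" by (rule ramified_of_dvd[OF Q(1) q(1) Q(2) d(1,2) q(3)])
  then show False using not_all_in_Q2[OF Q(1) q(1) Q(2)] n q(2) by blast
qed

lemma squarefree_not_4_dvd:
  fixes d :: int assumes "squarefree d" shows "\<not> 4 dvd d"
proof
  assume "4 dvd d"
  then have "2\<^sup>2 dvd d" by simp
  then have "(2 :: int) dvd 1" using assms by (rule squarefreeD[rotated])
  then show False by simp
qed

lemma N_not_4_dvd: "\<not> 4 dvd N"
proof
  assume "4 dvd N"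
  then have "2\<^sup>2 dvd N" by simp
  then have "(2 :: nat) dvd 1" using N(2) by (rule squarefreeD[rotated])
  then show False by simp
qed

lemma prime_2_ex:
  obtains Q where "is_prime R Q" "of_nat 2 \<in> Q" "2 \<in> Q"
  using prime_over_ex[OF two_is_prime_nat] by force

text \<open>The three cases exclude the residues of \<open>d\<close> for which 2 would ramify
  further than in the field of \<open>\<omega>\<close>. There 2 is unramified if
  \<open>N mod 4 = 3\<close>, and ramified with local generator \<open>1 + \<omega>\<close> or
  \<open>\<omega>\<close> if \<open>N mod 4 = 1\<close> or \<open>N\<close> is even.\<close>

lemma mod_4_case_3:
  assumes d: "\<delta> \<in> R" "\<delta>\<^sup>2 = of_int d" "\<not> 4 dvd d" and N3: "N mod 4 = 3"
  shows "d mod 4 = 1"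
proof (rule ccontr)
  assume "d mod 4 \<noteq> 1"
  then have ev: "even d \<or> d mod 4 = 3" by presburger
  obtain Q where Q: "is_prime R Q" "of_nat 2 \<in> Q" "2 \<in> Q" using prime_2_ex .
  have "of_nat 2 \<in> ipow R Q 2"
    using ev
  proof
    assume "even d"
    then show ?thesis
      using ramified_of_dvd[OF Q(1) two_is_prime_nat Q(2) d(1,2)] d(3) by simp
  next
    assume "d mod 4 = 3"
    then show ?thesis
      using ramified_3_mod_4[OF Q(1) two_is_prime_nat Q(2) omega(1,2) refl d(1,2)] by auto
  qed
  then show False using not_all_in_Q2[OF Q(1) two_is_prime_nat Q(2)] omega(4)[OF N3] by blast
qed

lemma mod_4_case_1:
  assumes d: "\<delta> \<in> R" "\<delta>\<^sup>2 = of_int d" "\<not> 4 dvd d" and N1: "N mod 4 = 1"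
  shows "odd d"
proof
  assume "even d"
  obtain Q where Q: "is_prime R Q" "of_nat 2 \<in> Q" "2 \<in> Q" using prime_2_ex .
  have "2 \<in> ipow R Q 2 \<and> 1 + \<omega> \<in> ipow R Q 2"
    by (rule ramified_even_1_mod_4[OF Q(1) two_is_prime_nat Q(2) omega(1,2) refl N1 d(1,2)]) fact+
  moreover have "odd N" using N1 by presburger
  ultimately show False using not_all_in_Q2[OF Q(1) two_is_prime_nat Q(2)] by simp
qed

lemma mod_4_case_even:
  assumes d: "\<delta> \<in> R" "\<delta>\<^sup>2 = of_int d" and N2: "even N"
  shows "d mod 4 \<noteq> 3"
proof
  assume d3: "d mod 4 = 3"
  obtain Q where Q: "is_prime R Q" "of_nat 2 \<in> Q" "2 \<in> Q" using prime_2_ex .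
  have "2 \<in> ipow R Q 2 \<and> \<omega> \<in> ipow R Q 2"
    by (rule ramified_3_mod_4_even[OF Q(1) two_is_prime_nat Q(2) omega(1,2) refl N2 d d3 N_not_4_dvd])
  then show False using not_all_in_Q2[OF Q(1) two_is_prime_nat Q(2)] N2 by simp
qed

section \<open>Quadratic reciprocity and the Frobenius element at \<open>p\<close>\<close>

context
  fixes p :: nat
  assumes p: "prime p" "p > 2" and Lp: "Legendre (- int N) p = - 1"
    and Lq: "\<And>q :: nat. prime q \<Longrightarrow> odd q \<Longrightarrow> q dvd N \<Longrightarrow> Legendre (- int p) q = 1"
begin

text \<open>One of \<open>d\<close>, \<open>- N * d\<close> and \<open>- N * d / 4\<close> is 1
  modulo 4 with all prime factors dividing \<open>N\<close>, and \<open>Legendre_eq_sgn\<close>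
  applies to it. A factor \<open>- N\<close> changes the sign on both sides, by \<open>Lp\<close>
  and because \<open>N\<close> is positive.\<close>

lemma Legendre_square_root:
  assumes d: "\<delta> \<in> R" "\<delta>\<^sup>2 = of_int d" "squarefree d"
  shows "Legendre d p = sgn d"
proof -
  note d4 = squarefree_not_4_dvd[OF d(3)]
  have good: "Legendre e p = sgn e"
    if "e mod 4 = 1" "\<And>q. prime q \<Longrightarrow> q dvd e \<Longrightarrow> q dvd d \<or> q dvd int N" for e
  proof (rule Legendre_eq_sgn[OF p that(1)])
    fix q :: nat assume q: "prime q" "int q dvd e"
    have "odd q"
    proof
      assume "even q"
      then have "even e" using q(2) by (meson dvd_trans even_of_nat)
      then show False using that(1) by presburger
    qed
    moreover have "int q dvd d \<or> int q dvd int N" using that(2)[of "int q"] q by simp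
    then have "q dvd N" using odd_prime_dvd[OF d q(1) \<open>odd q\<close>] by auto
    ultimately show "Legendre (- int p) q = 1" using Lq q(1) by blast
  qed
  have d0: "d \<noteq> 0" using d4 by auto
  have LNd: "Legendre (- int N * d) p = - Legendre d p"
    using Legendre_mult[OF p, of "- int N" d] Lp by simp
  have sNd: "sgn (- int N * d) = - sgn d" using N(1) by (simp add: sgn_mult)
  have "N mod 4 = 3 \<or> N mod 4 = 1 \<or> even N" by presburger
  then consider "N mod 4 = 3" | "N mod 4 = 1" | "even N" by blast
  then show ?thesis
  proof cases
    case 1
    then show ?thesis using mod_4_case_3[OF d(1,2) d4] by (intro good) auto
  next
    case 2
    then have "odd d" using mod_4_case_1[OF d(1,2) d4] by blast
    then have "d mod 4 = 1 \<or> d mod 4 = 3" by presburger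
    then show ?thesis
    proof
      assume "d mod 4 = 1"
      then show ?thesis by (intro good) auto
    next
      assume d3: "d mod 4 = 3"
      have "(- int N * d) mod 4 = 1"
      proof -
        obtain k l where "int N = 4 * k + 1" "d = 4 * l + 3"
          using d3 2 by (metis mult_div_mod_eq of_nat_1 of_nat_mod of_nat_numeral)
        then have "- int N * d = 4 * (- 4 * k * l - 3 * k - l - 1) + 1" by (simp add: algebra_simps)
        then show ?thesis by presburger
      qed
      then have "Legendre (- int N * d) p = sgn (- int N * d)"
        by (intro good) (auto simp: prime_dvd_mult_iff)
      then show ?thesis using LNd sNd by simp
    qed
  next
    case 3
    show ?thesis
    proof (cases "even d")
      case False
      moreover have "d mod 4 \<noteq> 3" using mod_4_case_even[OF d(1,2) 3] .
      ultimately have "d mod 4 = 1" by presburger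
      then show ?thesis by (intro good) auto
    next
      case True
      obtain N1 where N1: "N = 2 * N1" using 3 by (elim evenE)
      obtain d1 where d1: "d = 2 * d1" using True by (elim evenE)
      have "odd N1" using N_not_4_dvd N1 by auto
      have "odd d1" using d4 d1 by auto
      \<comment> \<open>\<open>e\<close> is \<open>- N * d\<close> without its factor 4. It has the
        square root \<open>\<omega> * \<delta> / 2\<close> in \<open>R\<close>, so
        \<open>mod_4_case_even\<close> can be applied a second time, to \<open>e\<close>.\<close>
      define e where "e = - int N1 * d1"
      have e: "- int N * d = 2 * 2 * e" by (simp add: N1 d1 e_def)
      have "(\<omega> * \<delta> / of_nat 2)\<^sup>2 = of_int (- int N * d) / 4"
        by (simp add: power_mult_distrib power_divide omega(2) d(2))
      also have "\<dots> = of_int e" unfolding e by simp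
      finally have sq: "(\<omega> * \<delta> / of_nat 2)\<^sup>2 = of_int e" .
      then have al: "algebraic_int (\<omega> * \<delta> / of_nat 2)"
        using algebraic_int_square_root[of "\<omega> * \<delta> / of_nat 2"] by simp
      have "\<omega> * \<delta> / of_nat 2 \<in> R"
        by (rule saturated[OF _ _ al]) (simp_all add: is_subringD(5)[OF subring omega(1) d(1)])
      then have "e mod 4 \<noteq> 3" using mod_4_case_even[OF _ sq 3] by blast
      moreover have "odd e" unfolding e_def using \<open>odd N1\<close> \<open>odd d1\<close> by simp
      ultimately have e1: "e mod 4 = 1" by presburger
      have "Legendre e p = sgn e"
      proof (rule good[OF e1])
        fix q :: int assume "prime q" "q dvd e"
        then show "q dvd d \<or> q dvd int N" by (auto simp: e_def prime_dvd_mult_iff d1 N1)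
      qed
      moreover have "Legendre (- int N * d) p = Legendre 2 p * Legendre 2 p * Legendre e p"
        unfolding e by (simp only: Legendre_mult[OF p] mult.assoc)
      moreover have "Legendre 2 p * Legendre 2 p = 1"
      proof -
        have "\<not> int p dvd 2" using p(2) zdvd_imp_le[of "int p" 2] by auto
        then have "Legendre 2 p \<noteq> 0" by (simp add: Legendre_eq_0_iff)
        then show ?thesis using Legendre_range[of 2 p] by auto
      qed
      moreover have "sgn e = sgn (- int N * d)" unfolding e by (simp add: sgn_mult)
      ultimately show ?thesis using LNd sNd by simp
    qed
  qed
qed

theorem frobenius_conjugate:
  obtains P where "is_prime R P" "of_nat p \<in> P" "\<And>x. x \<in> R \<Longrightarrow> x ^ p - cnj x \<in> P"
proof -
  obtain P where P: "is_prime R P" "of_nat p \<in> P" using prime_over_ex[OF p(1)] .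
  note id = is_prime_ideal[OF P(1)]
  have P1: "1 \<notin> P" using P(1) by (simp add: is_prime_def)
  note intP = is_ideal_of_int_dvd[OF subring id P1 p(1) P(2)]
  obtain \<phi> where phi: "\<phi> \<in> G" "\<And>x. x \<in> R \<Longrightarrow> x ^ p - \<phi> x \<in> P"
    using frobenius_ex[OF P(1) p(1) P(2)] by blast
  have "\<phi> \<circ> \<tau> \<in> commutators"
  proof (rule mem_subgroupI[OF commutators_action])
    show "commutators \<subseteq> G" using commutators_subset_A A(1) by blast
    show cG: "\<phi> \<circ> \<tau> \<in> G" using phi(1) tau(1) by (rule comp_mem)
    fix x assume x: "x \<in> R" "\<And>h. h \<in> commutators \<Longrightarrow> h x = x"
    then have xV: "x \<in> V" by (simp add: V_def)
    show "(\<phi> \<circ> \<tau>) x = x"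
    proof (rule ccontr)
      assume "(\<phi> \<circ> \<tau>) x \<noteq> x"
      then obtain \<delta> d where d: "\<delta> \<in> R" "\<delta>\<^sup>2 = of_int d" "squarefree d" "(\<phi> \<circ> \<tau>) \<delta> = - \<delta>"
        "\<And>g. g \<in> G \<Longrightarrow> g \<delta> = \<delta> \<or> g \<delta> = - \<delta>"
        using square_root_ex[OF cG xV] by metis
      have L: "Legendre d p = sgn d" by (rule Legendre_square_root[OF d(1-3)])
      have d0: "d \<noteq> 0" using squarefree_not_4_dvd[OF d(3)] by auto
      then have "Legendre d p \<noteq> 0" using L by (simp add: sgn_0_0)
      then have pd: "\<not> int p dvd d" by (simp add: Legendre_eq_0_iff)
      have dP: "\<delta> \<notin> P"
      proof
        assume "\<delta> \<in> P"
        then have "\<delta>\<^sup>2 \<in> P" using is_idealD(4)[OF id d(1)] by (simp add: power2_eq_square)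
        then show False using pd intP d(2) by simp
      qed
      \<comment> \<open>Complex conjugation fixes the square root of a positive number and negates
        that of a negative one.\<close>
      have tau_d: "\<tau> \<delta> = of_int (sgn d) * \<delta>"
      proof -
        have "\<delta> = csqrt (of_int d) \<or> \<delta> = - csqrt (of_int d)"
          using d(2) by (metis power2_csqrt power2_eq_iff)
        moreover have "cnj (csqrt (of_int d)) = of_int (sgn d) * csqrt (of_int d)"
        proof (cases "d > 0")
          case True
          then have "csqrt (of_int d) = of_real (sqrt d)"
            by (metis csqrt_of_real_nonneg of_real_of_int_eq of_int_0_le_iff of_real_0 less_imp_le Re_complex_of_real Im_complex_of_real)
          then show ?thesis using True by simp
        next
          case False
          then have "d < 0" using d0 by simp
          then have "csqrt (of_int d) = \<i> * sqrt \<bar>d\<bar>"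
            using csqrt_of_real_nonpos[of "of_int d"] by simp
          then show ?thesis using \<open>d < 0\<close> by simp
        qed
        ultimately show ?thesis using tau(2)[OF d(1)] by auto
      qed
      \<comment> \<open>\<open>\<delta> ^ p\<close> is
        \<open>d ^ ((p - 1) div 2) * \<delta>\<close>, so Euler's criterion shows that Frobenius
        acts on \<open>\<delta>\<close> by the symbol of \<open>d\<close>, which \<open>L\<close>
        identifies with the sign.\<close>
      have "\<delta> ^ p - of_int (sgn d) * \<delta> \<in> P"
      proof -
        have op: "odd p" using p prime_odd_nat by blast
        then have "p = Suc (2 * ((p - 1) div 2))" using p(2) by presburger
        then have "\<delta> ^ p = (\<delta>\<^sup>2) ^ ((p - 1) div 2) * \<delta>" by (metis power_Suc power_mult mult.commute)
        then have "\<delta> ^ p - of_int (sgn d) * \<delta> = of_int (d ^ ((p - 1) div 2) - sgn d) * \<delta>"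
          by (simp add: d(2) left_diff_distrib)
        moreover have "int p dvd d ^ ((p - 1) div 2) - sgn d"
          using euler_criterion[OF p, of d] unfolding L by (metis cong_iff_dvd_diff cong_sym)
        then have "of_int (d ^ ((p - 1) div 2) - sgn d) \<in> P" using intP by blast
        ultimately show ?thesis using is_idealD(5)[OF id d(1)] by simp
      qed
      then have phiP: "\<phi> \<delta> - of_int (sgn d) * \<delta> \<in> P"
        using is_ideal_diff[OF subring id _ phi(2)[OF d(1)], of "\<delta> ^ p - of_int (sgn d) * \<delta>"] by simp
      have s2: "of_int (sgn d) * of_int (sgn d) = (1 :: complex)" using d0 by (simp add: sgn_if)
      have sg: "sgn d = 1 \<or> sgn d = - 1" using d0 by (simp add: sgn_if)
      have "\<phi> \<delta> = of_int (sgn d) * \<delta>"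
      proof (rule ccontr)
        assume ne: "\<phi> \<delta> \<noteq> of_int (sgn d) * \<delta>"
        then have "\<phi> \<delta> = - (of_int (sgn d) * \<delta>)" using d(5)[OF phi(1)] sg by auto
        then have "of_int (- 2 * sgn d) * \<delta> \<in> P" using phiP by (simp add: algebra_simps)
        then have "of_int (- 2 * sgn d) \<in> P"
          using P(1) dP d(1) is_subring_of_int[OF subring] unfolding is_prime_def by blast
        then have "int p dvd - 2 * sgn d" using intP by blast
        then have "int p dvd 2" using sg by auto
        then show False using p(2) zdvd_imp_le[of "int p" 2] by auto
      qed
      then have "(\<phi> \<circ> \<tau>) \<delta> = of_int (sgn d) * (of_int (sgn d) * \<delta>)"
        using tau_d action_mult[OF phi(1) is_subring_of_int[OF subring] d(1)] action_of_int[OF phi(1)] by simp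
      also have "\<dots> = \<delta>" unfolding mult.assoc[symmetric] s2 by simp
      finally have "\<delta> = - \<delta>" using d(4) by simp
      then show False using dP is_idealD(2)[OF id] by simp
    qed
  qed
  then obtain a b where ab: "a \<in> A" "b \<in> A" "a \<circ> b = id" "b \<circ> a = id" "\<phi> \<circ> \<tau> = a \<circ> \<tau> \<circ> b \<circ> \<tau>"
    by (rule commutatorsE)
  have aG: "a \<in> G" using ab(1) A(1) by blast
  have conj: "\<phi> (a x) = a (\<tau> x)" for x
  proof -
    have "\<phi> (a x) = (\<phi> \<circ> \<tau>) (\<tau> (a x))" by (simp add: tau_tau')
    also have "\<dots> = a (\<tau> (b (a x)))" unfolding ab(5) by (simp add: tau_tau')
    also have "b (a x) = x" using fun_cong[OF ab(4), of x] by simp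
    finally show ?thesis .
  qed
  \<comment> \<open>\<open>\<phi>\<close> is the conjugate of \<open>\<tau>\<close> by
    \<open>a\<close>, so the preimage of \<open>P\<close> under \<open>a\<close> is a prime whose
    Frobenius element is \<open>\<tau>\<close>.\<close>
  define P' where "P' = {x \<in> R. a x \<in> P}"
  have aR: "a x \<in> R" if "x \<in> R" for x using action_closed[OF aG that] .
  have "is_ideal R P'"
    unfolding is_ideal_def P'_def
    using is_subringD(1,4,5)[OF subring] is_idealD(2,3,4)[OF id] aR
    by (auto simp: action_0[OF aG] action_add[OF aG] action_mult[OF aG])
  moreover have "1 \<notin> P'" using P1 action_1[OF aG] by (simp add: P'_def)
  moreover have "x \<in> P' \<or> y \<in> P'" if "x \<in> R" "y \<in> R" "x * y \<in> P'" for x y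
    using that P(1) aR unfolding is_prime_def P'_def by (auto simp: action_mult[OF aG])
  ultimately have "is_prime R P'" by (auto simp: is_prime_def)
  moreover have "of_nat p \<in> P'"
    using P(2) is_subring_of_nat[OF subring] action_of_nat[OF aG] by (simp add: P'_def)
  moreover have "x ^ p - cnj x \<in> P'" if x: "x \<in> R" for x
  proof -
    have tx: "\<tau> x \<in> R" using action_closed[OF tau(1) x] .
    have xp: "x ^ p \<in> R" by (rule is_subring_power[OF subring x])
    have "a (x ^ p - \<tau> x) = (a x) ^ p - \<phi> (a x)"
      unfolding conj action_diff[OF aG xp tx] action_power[OF aG x] ..
    also have "\<dots> \<in> P" by (rule phi(2)[OF aR[OF x]])
    finally show ?thesis using is_subringD(6)[OF subring xp tx] tau(2)[OF x] by (simp add: P'_def)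
  qed
  ultimately show ?thesis by (rule that)
qed

end

end

section \<open>Subfields of the complex numbers\<close>

lemma CC_simps:
  "carrier CC = UNIV" "x \<otimes>\<^bsub>CC\<^esub> y = x * y" "x \<oplus>\<^bsub>CC\<^esub> y = x + y" "\<zero>\<^bsub>CC\<^esub> = 0" "\<one>\<^bsub>CC\<^esub> = 1"
  by (simp_all add: ring_of_type_algebra_def)

lemma field_CC: "field CC"
  by (rule field_from_type_algebra)

lemma CC_minus: "\<ominus>\<^bsub>CC\<^esub> x = - x"
proof -
  interpret field CC by (rule field_CC)
  show ?thesis using minus_equality[of "- x" x] by (simp add: CC_simps)
qed

lemma CC_inverse: "x \<noteq> 0 \<Longrightarrow> inv\<^bsub>CC\<^esub> x = inverse x"
proof -
  interpret field CC by (rule field_CC)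
  show "x \<noteq> 0 \<Longrightarrow> ?thesis" using comm_inv_char[of x "inverse x"] by (simp add: CC_simps)
qed

lemma subfield_CC_iff: "subfield L CC \<longleftrightarrow> is_subring L \<and> (\<forall>x\<in>L. x \<noteq> 0 \<longrightarrow> inverse x \<in> L)"
proof -
  interpret field CC by (rule field_CC)
  show ?thesis
  proof
    assume L: "subfield L CC"
    note E = subringE[OF subfieldE(1)[OF L], unfolded CC_simps CC_minus]
    have "inverse x \<in> L" if "x \<in> L" "x \<noteq> 0" for x
      using subfield_m_inv(1)[OF L, of x] that by (auto simp: CC_inverse CC_simps)
    moreover have "is_subring L" unfolding is_subring_def by (intro conjI ballI E(2,3,5,6,7))
    ultimately show "is_subring L \<and> (\<forall>x\<in>L. x \<noteq> 0 \<longrightarrow> inverse x \<in> L)" by simp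
  next
    assume L: "is_subring L \<and> (\<forall>x\<in>L. x \<noteq> 0 \<longrightarrow> inverse x \<in> L)"
    then have R: "is_subring L" by blast
    show "subfield L CC"
    proof (rule subfieldI')
      show "subring L CC"
        using is_subringD(1-5)[OF R] by (intro subringI) (auto simp: CC_simps CC_minus)
      show "inv\<^bsub>CC\<^esub> k \<in> L" if "k \<in> L - {\<zero>\<^bsub>CC\<^esub>}" for k
        using L that by (auto simp: CC_simps CC_inverse)
    qed
  qed
qed

lemma subfield_divide:
  assumes "subfield L CC" "x \<in> L" "y \<in> L" shows "x / y \<in> L"
proof (cases "y = 0")
  case True
  then show ?thesis using assms is_subringD(1) by (auto simp: subfield_CC_iff)
next
  case False
  then have "x * inverse y \<in> L" using assms by (intro is_subringD(5)) (auto simp: subfield_CC_iff)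
  then show ?thesis by (simp add: divide_inverse)
qed

lemma subfield_Rats: "subfield L CC \<Longrightarrow> \<rat> \<subseteq> L"
proof
  fix x :: complex assume L: "subfield L CC" and "x \<in> \<rat>"
  then obtain a b where "x = of_int a / of_int b" by (auto elim: Rats_cases')
  moreover have "is_subring L" using L by (simp add: subfield_CC_iff)
  ultimately show "x \<in> L" using subfield_divide[OF L] is_subring_of_int by metis
qed

inductive_set qspan :: "complex set \<Rightarrow> complex set" for U where
  zero: "0 \<in> qspan U"
| base: "q \<in> \<rat> \<Longrightarrow> u \<in> U \<Longrightarrow> q * u \<in> qspan U"
| add: "a \<in> qspan U \<Longrightarrow> b \<in> qspan U \<Longrightarrow> a + b \<in> qspan U"

lemma qspan_mono: "U \<subseteq> U' \<Longrightarrow> x \<in> qspan U \<Longrightarrow> x \<in> qspan U'"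
  by (rotate_tac, induction rule: qspan.induct) (auto intro: qspan.intros)

lemma CC_line_extension: "ring.line_extension CC K v E = {k * v + e | k e. k \<in> K \<and> e \<in> E}"
proof -
  interpret field CC by (rule field_CC)
  show ?thesis
    unfolding line_extension_def set_add_def' r_coset_def by (auto simp: CC_simps)
qed

lemma CC_line_extensionI: "k \<in> K \<Longrightarrow> e \<in> E \<Longrightarrow> k * v + e \<in> ring.line_extension CC K v E"
  unfolding CC_line_extension mem_Collect_eq by (intro exI conjI) (rule refl)

lemma CC_line_extensionE:
  assumes "x \<in> ring.line_extension CC K v E"
  obtains k e where "k \<in> K" "e \<in> E" "x = k * v + e"
  using assms unfolding CC_line_extension by auto

lemma dimension_qspan:
  assumes "ring.dimension CC n \<rat> E"
  shows "\<exists>U. finite U \<and> U \<subseteq> E \<and> 0 \<in> E \<and> E \<subseteq> qspan U"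
proof -
  interpret field CC by (rule field_CC)
  define Q where "Q = (\<rat> :: complex set)"
  have "dimension n Q E" using assms by (simp add: Q_def)
  then have "Q = \<rat> \<longrightarrow> (\<exists>U. finite U \<and> U \<subseteq> E \<and> 0 \<in> E \<and> E \<subseteq> qspan U)"
  proof induction
    case (zero_dim K)
    show ?case by (auto simp: CC_simps intro!: exI[of _ "{}"] qspan.zero)
  next
    case (Suc_dim v E n K)
    show ?case
    proof
      assume K: "K = \<rat>"
      then obtain U where U: "finite U" "U \<subseteq> E" "0 \<in> E" "E \<subseteq> qspan U" using Suc_dim.IH by blast
      have sub: "E \<subseteq> line_extension K v E"
      proof
        fix e assume "e \<in> E"
        then have "0 * v + e \<in> line_extension K v E" unfolding K by (intro CC_line_extensionI) auto
        then show "e \<in> line_extension K v E" by simp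
      qed
      have "1 * v + 0 \<in> line_extension K v E" unfolding K using U(3) by (intro CC_line_extensionI) auto
      then have v: "v \<in> line_extension K v E" by simp
      have "line_extension K v E \<subseteq> qspan (insert v U)"
      proof
        fix x assume "x \<in> line_extension K v E"
        then obtain k e where "k \<in> \<rat>" "e \<in> E" "x = k * v + e" unfolding K by (rule CC_line_extensionE)
        then show "x \<in> qspan (insert v U)"
          using U(4) qspan_mono[of U "insert v U" e] by (auto intro!: qspan.add qspan.base)
      qed
      then show "\<exists>U. finite U \<and> U \<subseteq> line_extension K v E \<and> 0 \<in> line_extension K v E \<and>
          line_extension K v E \<subseteq> qspan U"
        using U sub v by (intro exI[of _ "insert v U"]) auto
    qed
  qed
  then show ?thesis by (simp add: Q_def)
qed

lemma number_field_qspan: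
  assumes "number_field L"
  obtains U where "finite U" "U \<subseteq> L" "L \<subseteq> qspan U"
proof -
  interpret field CC by (rule field_CC)
  obtain n where "dimension n \<rat> L" using assms unfolding number_field_def finite_dimension_def by blast
  then show ?thesis using dimension_qspan[of n L] that by blast
qed

lemma qspan_multiple_zspan:
  assumes "x \<in> qspan U"
  shows "\<exists>D>0. of_nat D * x \<in> zspan U"
  using assms
proof induction
  case zero
  show ?case by (intro exI[of _ 1]) (simp add: zspan.zero)
next
  case (base q u)
  then obtain a b where q: "q = of_int a / of_int b" "b > 0" by (auto elim: Rats_cases')
  then have "of_nat (nat b) * (q * u) = of_int a * u" by simp
  then show ?case using base q zspan_int_mult[OF zspan.base, of u U a] by (intro exI[of _ "nat b"]) auto
next
  case (add a b)
  then obtain D E where DE: "D > 0" "of_nat D * a \<in> zspan U" "E > 0" "of_nat E * b \<in> zspan U" by blast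
  have "of_nat (D * E) * (a + b) = of_nat E * (of_nat D * a) + of_nat D * (of_nat E * b)"
    by (simp add: algebra_simps)
  also have "\<dots> \<in> zspan U" by (rule zspan.add[OF zspan_nat_mult[OF DE(2)] zspan_nat_mult[OF DE(4)]])
  finally show ?case using DE by (intro exI[of _ "D * E"]) auto
qed

text \<open>Multiplication by \<open>x\<close> sends each generator into the rational span of
  \<open>U\<close>; with \<open>D\<close> clearing all denominators, \<open>D * x\<close> preserves
  the integral span, and the determinant trick applies.\<close>

lemma number_field_multiple_integral:
  assumes L: "number_field L" and x: "x \<in> L"
  obtains D where "D > 0" "algebraic_int (of_nat D * x)"
proof -
  have sf: "is_subring L" using L by (auto simp: number_field_def subfield_CC_iff)
  obtain U where U: "finite U" "U \<subseteq> L" "L \<subseteq> qspan U" using number_field_qspan[OF L] .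
  have "\<exists>D>0. of_nat D * (x * u) \<in> zspan U" if "u \<in> U" for u
    using U(2,3) that is_subringD(5)[OF sf x, of u] qspan_multiple_zspan by blast
  then obtain d where d: "\<And>u. u \<in> U \<Longrightarrow> d u > 0 \<and> of_nat (d u) * (x * u) \<in> zspan U" by metis
  define D where "D = prod d U"
  have "D > 0" unfolding D_def using d by (intro prod_pos) auto
  moreover have "algebraic_int (of_nat D * x)"
  proof -
    have "\<exists>u\<in>U. u \<noteq> 0"
    proof (rule ccontr)
      assume no: "\<not> ?thesis"
      have "y = 0" if "y \<in> qspan U" for y using that by induction (use no in auto)
      then show False using U(3) is_subringD(2)[OF sf] by force
    qed
    then obtain u0 where u0: "u0 \<in> U" "u0 \<noteq> 0" by blast
    show ?thesis
    proof (rule algebraic_int_zspan[OF U(1) u0])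
      fix u assume u: "u \<in> U"
      have "D = d u * prod d (U - {u})" unfolding D_def by (rule prod.remove[OF U(1) u])
      then have "of_nat D * x * u = of_nat (prod d (U - {u})) * (of_nat (d u) * (x * u))"
        by (simp add: mult_ac)
      also have "\<dots> \<in> zspan U" by (rule zspan_nat_mult[OF conjunct2[OF d[OF u]]])
      finally show "of_nat D * x * u \<in> zspan U" .
    qed
  qed
  ultimately show ?thesis by (rule that)
qed

lemma hom_mod_0_of_int:
  assumes L: "is_subring L" and f: "hom_mod L {0} f"
  shows "f (of_int n) = of_int n"
proof -
  have nat: "f (of_nat k) = of_nat k" for k
  proof (induction k)
    case 0
    then show ?case using hom_modD(1)[OF f] by simp
  next
    case (Suc k)
    have "f (1 + of_nat k) - (f 1 + f (of_nat k)) \<in> {0}"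
      by (intro hom_modD(4)[OF f] is_subringD(2)[OF L] is_subring_of_nat[OF L])
    then show ?case using Suc hom_modD(2)[OF f] by simp
  qed
  show ?thesis
  proof (cases "n \<ge> 0")
    case True
    then show ?thesis using nat[of "nat n"] by simp
  next
    case False
    then have "of_int n = (- of_nat (nat (- n)) :: 'a)" by simp
    then show ?thesis using nat[of "nat (- n)"] hom_mod_0_minus[OF L f is_subring_of_nat[OF L], of "nat (- n)"] by simp
  qed
qed

lemma hom_mod_0_poly:
  fixes p :: "complex poly"
  assumes L: "is_subring L" and f: "hom_mod L {0} f" and x: "x \<in> L" and p: "\<And>i. coeff p i \<in> \<int>"
  shows "f (poly p x) = poly p (f x) \<and> poly p x \<in> L"
  using p
proof (induction p)
  case 0
  then show ?case using hom_modD(1)[OF f] is_subringD(1)[OF L] by simp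
next
  case (pCons a p)
  have "coeff p i \<in> \<int>" for i using pCons.prems[of "Suc i"] by simp
  then have IH: "f (poly p x) = poly p (f x)" "poly p x \<in> L" using pCons.IH by auto
  obtain n where a: "a = of_int n" using pCons.prems[of 0] by (auto elim: Ints_cases)
  have aL: "a \<in> L" unfolding a by (rule is_subring_of_int[OF L])
  have xp: "x * poly p x \<in> L" by (rule is_subringD(5)[OF L x IH(2)])
  have "f (a + x * poly p x) = f a + f (x * poly p x)" using hom_modD(4)[OF f aL xp] by simp
  also have "f (x * poly p x) = f x * f (poly p x)" using hom_modD(5)[OF f x IH(2)] by simp
  also have "f a = a" unfolding a by (rule hom_mod_0_of_int[OF L f])
  finally show ?case using IH(1) is_subringD(4)[OF L aL xp] by simp
qed

lemma galois_group_carrier: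
  "\<sigma> \<in> carrier (galois_group K L) \<longleftrightarrow> \<sigma> \<in> extensional L \<and> bij_betw \<sigma> L L \<and> \<sigma> 1 = 1 \<and>
     (\<forall>x\<in>L. \<forall>y\<in>L. \<sigma> (x + y) = \<sigma> x + \<sigma> y \<and> \<sigma> (x * y) = \<sigma> x * \<sigma> y) \<and> (\<forall>x\<in>K. \<sigma> x = x)"
  by (auto simp: galois_group_def Bij_def Ring.ring_hom_def CC_simps bij_betw_def)

lemma galois_group_hom:
  assumes "is_subring L" "\<sigma> \<in> carrier (galois_group K L)"
  shows "hom_mod L {0} \<sigma>"
proof -
  have s: "\<sigma> 1 = 1" "bij_betw \<sigma> L L" "\<And>x y. x \<in> L \<Longrightarrow> y \<in> L \<Longrightarrow> \<sigma> (x + y) = \<sigma> x + \<sigma> y"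
    "\<And>x y. x \<in> L \<Longrightarrow> y \<in> L \<Longrightarrow> \<sigma> (x * y) = \<sigma> x * \<sigma> y"
    using assms(2) by (auto simp: galois_group_carrier)
  have "\<sigma> 0 = 0" using s(3)[of 0 0] is_subringD(1)[OF assms(1)] by simp
  moreover have "\<sigma> x \<in> L" if "x \<in> L" for x using s(2) that by (auto simp: bij_betw_def)
  ultimately show ?thesis unfolding hom_mod_def using s by simp
qed

text \<open>An automorphism is determined by its values on the finite spanning set \<open>U\<close>,
  and each \<open>u\<close> can only go to a root of a fixed integer polynomial divided by a fixed
  \<open>D\<close>.\<close>

lemma finite_galois_group:
  assumes L: "number_field L" and K: "subfield K CC"
  shows "finite (carrier (galois_group K L))"
proof -
  have sf: "is_subring L" using L by (auto simp: number_field_def subfield_CC_iff)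
  obtain U where U: "finite U" "U \<subseteq> L" "L \<subseteq> qspan U" using number_field_qspan[OF L] .
  have "\<exists>S. finite S \<and> (\<forall>\<sigma>\<in>carrier (galois_group K L). \<sigma> u \<in> S)" if u: "u \<in> U" for u
  proof -
    obtain D where D: "D > 0" "algebraic_int (of_nat D * u)"
      using number_field_multiple_integral[OF L] u U(2) by blast
    obtain p where p: "monic p" "\<And>i. coeff p i \<in> \<int>" "poly p (of_nat D * u) = 0"
      using D(2) by (auto elim: algebraic_int.cases)
    define S where "S = (\<lambda>r. r / of_nat D) ` {r. poly p r = 0}"
    have "p \<noteq> 0" using p(1) by auto
    then have "finite S" unfolding S_def by (intro finite_imageI poly_roots_finite)
    moreover have "\<sigma> u \<in> S" if "\<sigma> \<in> carrier (galois_group K L)" for \<sigma>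
    proof -
      have hom: "hom_mod L {0} \<sigma>" by (rule galois_group_hom[OF sf that])
      have uL: "u \<in> L" and DL: "of_nat D \<in> L" using u U(2) is_subring_of_nat[OF sf] by auto
      have "\<sigma> (of_nat D * u) = of_nat D * \<sigma> u"
        using hom_modD(5)[OF hom DL uL] hom_mod_0_of_int[OF sf hom, of "int D"] by simp
      moreover have "poly p (\<sigma> (of_nat D * u)) = 0"
        using hom_mod_0_poly[OF sf hom is_subringD(5)[OF sf DL uL] p(2)] p(3) hom_modD(1)[OF hom] by simp
      ultimately show ?thesis unfolding S_def using D(1) by (intro image_eqI[of _ _ "of_nat D * \<sigma> u"]) auto
    qed
    ultimately show ?thesis by blast
  qed
  then obtain S where S: "\<And>u. u \<in> U \<Longrightarrow> finite (S u)"
    "\<And>u \<sigma>. u \<in> U \<Longrightarrow> \<sigma> \<in> carrier (galois_group K L) \<Longrightarrow> \<sigma> u \<in> S u" by metis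
  have "(\<lambda>\<sigma>. restrict \<sigma> U) ` carrier (galois_group K L) \<subseteq> Pi\<^sub>E U S" using S(2) by auto
  moreover have "finite (Pi\<^sub>E U S)" using U(1) S(1) by (rule finite_PiE)
  moreover have "inj_on (\<lambda>\<sigma>. restrict \<sigma> U) (carrier (galois_group K L))"
  proof (rule inj_onI)
    fix \<sigma> \<rho> assume s: "\<sigma> \<in> carrier (galois_group K L)" and r: "\<rho> \<in> carrier (galois_group K L)"
      and eq: "restrict \<sigma> U = restrict \<rho> U"
    have hs: "hom_mod L {0} \<sigma>" and hr: "hom_mod L {0} \<rho>" using galois_group_hom[OF sf] s r by auto
    have "\<sigma> x = \<rho> x \<and> x \<in> L" if "x \<in> qspan U" for x
      using that
    proof induction
      case zero
      then show ?case using hom_modD(1)[OF hs] hom_modD(1)[OF hr] is_subringD(1)[OF sf] by simp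
    next
      case (base q u)
      have q: "q \<in> K" "q \<in> L" using base subfield_Rats[OF K] subfield_Rats[of L] L by (auto simp: number_field_def)
      have u: "u \<in> L" using base U(2) by blast
      have "\<sigma> u = \<rho> u" using fun_cong[OF eq, of u] base by simp
      moreover have "\<sigma> q = q" "\<rho> q = q" using s r q(1) by (auto simp: galois_group_carrier)
      ultimately show ?case
        using hom_modD(5)[OF hs q(2) u] hom_modD(5)[OF hr q(2) u] is_subringD(5)[OF sf q(2) u] by simp
    next
      case (add a b)
      then show ?case
        using hom_modD(4)[OF hs, of a b] hom_modD(4)[OF hr, of a b] is_subringD(4)[OF sf, of a b] by simp
    qed
    then have "\<sigma> x = \<rho> x" if "x \<in> L" for x using that U(3) by blast
    then show "\<sigma> = \<rho>" using s r by (intro extensionalityI[of _ L]) (auto simp: galois_group_carrier)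
  qed
  ultimately show ?thesis by (meson finite_imageD finite_subset)
qed

section \<open>Rings of integers\<close>

definition ints :: "complex set \<Rightarrow> complex set" where
  "ints L = {x \<in> L. algebraic_int x}"

lemma integer_ring_eq: "integer_ring L = CC\<lparr>carrier := ints L\<rparr>"
  by (simp add: integer_ring_def ints_def)

lemma integer_ring_simps:
  "carrier (integer_ring L) = ints L" "x \<otimes>\<^bsub>integer_ring L\<^esub> y = x * y" "x \<oplus>\<^bsub>integer_ring L\<^esub> y = x + y"
  "\<zero>\<^bsub>integer_ring L\<^esub> = 0" "\<one>\<^bsub>integer_ring L\<^esub> = 1"
  by (simp_all add: integer_ring_eq CC_simps)

lemma is_subring_ints: "is_subring L \<Longrightarrow> is_subring (ints L)"
  by (auto simp: is_subring_def ints_def intro: algebraic_int_plus algebraic_int_times)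

lemma cring_integer_ring: assumes "is_subring L" shows "cring (integer_ring L)"
proof -
  note R = is_subringD[OF is_subring_ints[OF assms]]
  show ?thesis
  proof (rule cringI)
    show "abelian_group (integer_ring L)"
    proof (rule abelian_groupI)
      show "\<exists>y\<in>carrier (integer_ring L). y \<oplus>\<^bsub>integer_ring L\<^esub> x = \<zero>\<^bsub>integer_ring L\<^esub>"
        if "x \<in> carrier (integer_ring L)" for x
        using that R(3)[of x] by (intro bexI[of _ "- x"]) (auto simp: integer_ring_simps)
    qed (use R in \<open>auto simp: integer_ring_simps\<close>)
    show "comm_monoid (integer_ring L)"
      by (rule comm_monoidI) (use R in \<open>auto simp: integer_ring_simps\<close>)
  qed (auto simp: integer_ring_simps distrib_right)
qed

lemma ideal_integer_ring_iff:
  assumes "is_subring L" shows "ideal Q (integer_ring L) \<longleftrightarrow> is_ideal (ints L) Q"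
proof -
  interpret cring "integer_ring L" by (rule cring_integer_ring[OF assms])
  note R = is_subring_ints[OF assms]
  have minus: "\<ominus>\<^bsub>integer_ring L\<^esub> x = - x" if "x \<in> ints L" for x
    using minus_equality[of "- x" x] that is_subringD(3)[OF R that] by (simp add: integer_ring_simps)
  show ?thesis
  proof
    assume "ideal Q (integer_ring L)"
    then interpret I: ideal Q "integer_ring L" .
    show "is_ideal (ints L) Q"
      unfolding is_ideal_def using I.a_subset I.zero_closed I.a_closed I.I_l_closed
      by (auto simp: integer_ring_simps)
  next
    assume Q: "is_ideal (ints L) Q"
    show "ideal Q (integer_ring L)"
    proof (rule idealI[OF ring_axioms])
      show "subgroup Q (add_monoid (integer_ring L))"
      proof
        show "inv\<^bsub>add_monoid (integer_ring L)\<^esub> x \<in> Q" if "x \<in> Q" for x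
          using is_ideal_minus[OF R Q that] minus[OF is_idealD(1)[OF Q that]] by (simp add: a_inv_def)
      qed (use is_idealD[OF Q] in \<open>auto simp: integer_ring_simps\<close>)
    qed (use is_idealD[OF Q] in \<open>auto simp: integer_ring_simps\<close>)
  qed
qed

lemma primeideal_integer_ring_iff:
  assumes "is_subring L" shows "primeideal Q (integer_ring L) \<longleftrightarrow> is_prime (ints L) Q"
proof
  assume "primeideal Q (integer_ring L)"
  then interpret I: primeideal Q "integer_ring L" .
  have id: "is_ideal (ints L) Q" using ideal_integer_ring_iff[OF assms] I.ideal_axioms by blast
  have "1 \<notin> Q" using I.one_imp_carrier I.I_notcarr by (auto simp: integer_ring_simps)
  then show "is_prime (ints L) Q" using id I.I_prime by (auto simp: is_prime_def integer_ring_simps)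
next
  assume Q: "is_prime (ints L) Q"
  show "primeideal Q (integer_ring L)"
  proof (rule primeidealI)
    show "ideal Q (integer_ring L)" using ideal_integer_ring_iff[OF assms] is_prime_ideal[OF Q] by blast
    show "cring (integer_ring L)" by (rule cring_integer_ring[OF assms])
    have "1 \<in> ints L" using is_subringD(2)[OF is_subring_ints[OF assms]] .
    then show "carrier (integer_ring L) \<noteq> Q" using Q by (auto simp: is_prime_def integer_ring_simps)
  qed (use Q in \<open>auto simp: is_prime_def integer_ring_simps\<close>)
qed

lemma ideal_prod_eq_iprod: "ideal_prod (integer_ring L) I J = iprod I J"
proof (intro equalityI subsetI)
  fix x assume "x \<in> ideal_prod (integer_ring L) I J"
  then show "x \<in> iprod I J"
    by induction (auto simp: integer_ring_simps intro: iprod.intros)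
next
  fix x assume "x \<in> iprod I J"
  then show "x \<in> ideal_prod (integer_ring L) I J"
    by induction (use ideal_prod.prod[of _ I _ J "integer_ring L"] ideal_prod.sum[of _ "integer_ring L" I J] in
      \<open>auto simp: integer_ring_simps\<close>)
qed

lemma ideal_power_eq_ipow: "Q [^]\<^bsub>ideals_set (integer_ring L)\<^esub> (n :: nat) = ipow (ints L) Q n"
  by (induction n) (simp_all add: nat_pow_def ideals_set_def ideal_prod_eq_iprod integer_ring_simps)

lemma ramification_index_eq:
  assumes L: "is_subring L" and Q: "is_ideal (ints L) Q"
  shows "ramification_index K L Q = (GREATEST e. Q \<inter> ints K \<subseteq> ipow (ints L) Q e)"
proof -
  interpret cring "integer_ring L" by (rule cring_integer_ring[OF L])
  have "Idl\<^bsub>integer_ring L\<^esub> (Q \<inter> ints K) \<subseteq> ipow (ints L) Q e \<longleftrightarrow> Q \<inter> ints K \<subseteq> ipow (ints L) Q e" for e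
  proof
    assume "Idl\<^bsub>integer_ring L\<^esub> (Q \<inter> ints K) \<subseteq> ipow (ints L) Q e"
    moreover have "Q \<inter> ints K \<subseteq> Idl\<^bsub>integer_ring L\<^esub> (Q \<inter> ints K)"
      using is_idealD(1)[OF Q] by (intro genideal_self) (auto simp: integer_ring_simps)
    ultimately show "Q \<inter> ints K \<subseteq> ipow (ints L) Q e" by blast
  next
    assume "Q \<inter> ints K \<subseteq> ipow (ints L) Q e"
    moreover have "ideal (ipow (ints L) Q e) (integer_ring L)"
      using ideal_integer_ring_iff[OF L] is_ideal_ipow[OF is_subring_ints[OF L] Q] by blast
    ultimately show "Idl\<^bsub>integer_ring L\<^esub> (Q \<inter> ints K) \<subseteq> ipow (ints L) Q e" by (rule genideal_minimal[rotated])
  qed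
  then show ?thesis
    by (simp add: ramification_index_def prime_below_def ideal_power_eq_ipow integer_ring_simps)
qed

lemma unramified_extension_iff:
  assumes L: "is_subring L"
  shows "unramified_extension K L \<longleftrightarrow>
    (\<forall>Q. is_prime (ints L) Q \<and> Q \<noteq> {0} \<longrightarrow> (GREATEST e. Q \<inter> ints K \<subseteq> ipow (ints L) Q e) = 1) \<and>
    (\<forall>\<phi> \<in> Ring.ring_hom (field_on L) CC. \<phi> ` K \<subseteq> \<real> \<longrightarrow> \<phi> ` L \<subseteq> \<real>)"
  unfolding unramified_extension_def primeideal_integer_ring_iff[OF L]
  by (simp add: ramification_index_eq[OF L is_prime_ideal] cong: conj_cong)

section \<open>Complex conjugates of extensions\<close>

lemma cnj_image_cnj: "cnj ` cnj ` L = L"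
  by (simp add: image_image)

lemma inj_cnj: "inj cnj"
  by (simp add: inj_def)

lemma cnj_image_iff: "x \<in> cnj ` L \<longleftrightarrow> cnj x \<in> L"
  by (metis complex_cnj_cnj image_iff)

lemma subfield_cnj: "subfield L CC \<Longrightarrow> subfield (cnj ` L) CC"
  unfolding subfield_CC_iff is_subring_def
  by (auto simp: cnj_image_iff simp flip: complex_cnj_minus complex_cnj_add complex_cnj_mult)

lemma cnj_Rats: "x \<in> \<rat> \<Longrightarrow> cnj x = x"
  by (auto elim!: Rats_cases')

lemma dimension_cnj:
  assumes "ring.dimension CC n \<rat> E" shows "ring.dimension CC n \<rat> (cnj ` E)"
proof -
  interpret field CC by (rule field_CC)
  define Q where "Q = (\<rat> :: complex set)"
  have "dimension n Q E" using assms by (simp add: Q_def)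
  then have "Q = \<rat> \<longrightarrow> dimension n \<rat> (cnj ` E)"
  proof induction
    case (zero_dim K)
    show ?case using dimension.zero_dim[of \<rat>] by (simp add: CC_simps)
  next
    case (Suc_dim v E n K)
    show ?case
    proof
      assume K: "K = \<rat>"
      then have d: "dimension n \<rat> (cnj ` E)" using Suc_dim.IH by blast
      have v: "cnj v \<notin> cnj ` E" using Suc_dim.hyps(2) by (simp add: cnj_image_iff)
      have "cnj ` line_extension K v E = line_extension \<rat> (cnj v) (cnj ` E)"
      proof (intro equalityI subsetI)
        fix x assume "x \<in> cnj ` line_extension K v E"
        then have "cnj x \<in> line_extension K v E" by (simp add: cnj_image_iff)
        then obtain k e where ke: "k \<in> K" "e \<in> E" "cnj x = k * v + e" by (rule CC_line_extensionE)
        have "x = cnj (cnj x)" by simp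
        also have "\<dots> = k * cnj v + cnj e" using ke(1) by (simp add: ke(3) K cnj_Rats)
        also have "\<dots> \<in> line_extension \<rat> (cnj v) (cnj ` E)" using ke K by (intro CC_line_extensionI) auto
        finally show "x \<in> line_extension \<rat> (cnj v) (cnj ` E)" .
      next
        fix x assume "x \<in> line_extension \<rat> (cnj v) (cnj ` E)"
        then obtain k e where ke: "k \<in> \<rat>" "e \<in> cnj ` E" "x = k * cnj v + e" by (rule CC_line_extensionE)
        have "cnj x = k * v + cnj e" using ke(1) by (simp add: ke(3) cnj_Rats)
        also have "\<dots> \<in> line_extension K v E" using ke K by (intro CC_line_extensionI) (auto simp: cnj_image_iff)
        finally show "x \<in> cnj ` line_extension K v E" by (simp add: cnj_image_iff)
      qed
      moreover have "dimension (Suc n) \<rat> (line_extension \<rat> (cnj v) (cnj ` E))"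
        by (rule dimension.Suc_dim[OF _ v d]) (simp add: CC_simps)
      ultimately show "dimension (Suc n) \<rat> (cnj ` line_extension K v E)" by simp
    qed
  qed
  then show ?thesis by (simp add: Q_def)
qed

lemma number_field_cnj: "number_field L \<Longrightarrow> number_field (cnj ` L)"
proof -
  assume L: "number_field L"
  interpret field CC by (rule field_CC)
  show ?thesis using L subfield_cnj dimension_cnj unfolding number_field_def finite_dimension_def by blast
qed

text \<open>Transport of structure: conjugation by \<open>cnj\<close> carries automorphisms of
  \<open>L\<close> to automorphisms of the conjugate field.\<close>

definition conj_aut :: "complex set \<Rightarrow> (complex \<Rightarrow> complex) \<Rightarrow> complex \<Rightarrow> complex" where
  "conj_aut L \<sigma> = (\<lambda>x\<in>cnj ` L. cnj (\<sigma> (cnj x)))"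

lemma conj_aut_apply: "x \<in> L \<Longrightarrow> conj_aut L \<sigma> (cnj x) = cnj (\<sigma> x)"
  by (simp add: conj_aut_def)

lemma conj_aut_mem:
  assumes L: "is_subring L" and KL: "K \<subseteq> L" and K: "cnj ` K = K" and s: "\<sigma> \<in> carrier (galois_group K L)"
  shows "conj_aut L \<sigma> \<in> carrier (galois_group K (cnj ` L))"
proof -
  have s': "bij_betw \<sigma> L L" "\<sigma> 1 = 1" "\<And>x y. x \<in> L \<Longrightarrow> y \<in> L \<Longrightarrow> \<sigma> (x + y) = \<sigma> x + \<sigma> y"
    "\<And>x y. x \<in> L \<Longrightarrow> y \<in> L \<Longrightarrow> \<sigma> (x * y) = \<sigma> x * \<sigma> y" "\<And>x. x \<in> K \<Longrightarrow> \<sigma> x = x"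
    using s by (auto simp: galois_group_carrier)
  note R = is_subringD[OF L]
  have b1: "bij_betw cnj (cnj ` L) L" by (rule bij_betw_byWitness[of _ cnj]) auto
  have b2: "bij_betw cnj L (cnj ` L)" by (rule bij_betw_byWitness[of _ cnj]) auto
  have "bij_betw (cnj \<circ> \<sigma> \<circ> cnj) (cnj ` L) (cnj ` L)"
    by (intro bij_betw_trans[OF bij_betw_trans[OF b1 s'(1)] b2, unfolded comp_assoc[symmetric]])
  then have "bij_betw (conj_aut L \<sigma>) (cnj ` L) (cnj ` L)"
    by (rule bij_betw_cong[THEN iffD1, rotated]) (simp add: conj_aut_def)
  moreover have "conj_aut L \<sigma> 1 = 1" using conj_aut_apply[OF R(2), of \<sigma>] s'(2) by simp
  moreover have "conj_aut L \<sigma> (x + y) = conj_aut L \<sigma> x + conj_aut L \<sigma> y"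
    "conj_aut L \<sigma> (x * y) = conj_aut L \<sigma> x * conj_aut L \<sigma> y" if xy: "x \<in> cnj ` L" "y \<in> cnj ` L" for x y
  proof -
    define a b where "a = cnj x" and "b = cnj y"
    then have ab: "a \<in> L" "b \<in> L" "x = cnj a" "y = cnj b" using xy by (auto simp: cnj_image_iff)
    show "conj_aut L \<sigma> (x + y) = conj_aut L \<sigma> x + conj_aut L \<sigma> y"
      using conj_aut_apply[OF R(4)[OF ab(1,2)], of \<sigma>] conj_aut_apply[OF ab(1), of \<sigma>]
        conj_aut_apply[OF ab(2), of \<sigma>] s'(3)[OF ab(1,2)] by (simp add: ab)
    show "conj_aut L \<sigma> (x * y) = conj_aut L \<sigma> x * conj_aut L \<sigma> y"
      using conj_aut_apply[OF R(5)[OF ab(1,2)], of \<sigma>] conj_aut_apply[OF ab(1), of \<sigma>]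
        conj_aut_apply[OF ab(2), of \<sigma>] s'(4)[OF ab(1,2)] by (simp add: ab)
  qed
  moreover have "conj_aut L \<sigma> x = x" if "x \<in> K" for x
  proof -
    have "cnj x \<in> K" using that K by (metis cnj_image_iff)
    then show ?thesis using conj_aut_apply[of "cnj x" L \<sigma>] KL s'(5) by auto
  qed
  moreover have "conj_aut L \<sigma> \<in> extensional (cnj ` L)" by (simp add: conj_aut_def)
  ultimately show ?thesis unfolding galois_group_carrier by blast
qed

lemma conj_aut_conj_aut:
  assumes "\<sigma> \<in> extensional L" shows "conj_aut (cnj ` L) (conj_aut L \<sigma>) = \<sigma>"
proof (rule ext)
  fix x show "conj_aut (cnj ` L) (conj_aut L \<sigma>) x = \<sigma> x"
    using assms by (cases "x \<in> L") (auto simp: conj_aut_def cnj_image_cnj extensional_def)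
qed

lemma galois_group_mult:
  "\<sigma> \<in> carrier (galois_group K L) \<Longrightarrow> \<rho> \<in> carrier (galois_group K L) \<Longrightarrow>
    \<sigma> \<otimes>\<^bsub>galois_group K L\<^esub> \<rho> = compose L \<sigma> \<rho>"
  by (simp add: galois_group_def BijGroup_def)

lemma galois_group_one: "\<one>\<^bsub>galois_group K L\<^esub> = (\<lambda>x\<in>L. x)"
  by (simp add: galois_group_def BijGroup_def)

lemma galois_group_maps: "\<sigma> \<in> carrier (galois_group K L) \<Longrightarrow> x \<in> L \<Longrightarrow> \<sigma> x \<in> L"
  by (auto simp: galois_group_carrier bij_betw_def)

lemma conj_aut_iso:
  assumes L: "is_subring L" and KL: "K \<subseteq> L" and K: "cnj ` K = K"
  shows "conj_aut L \<in> iso (galois_group K L) (galois_group K (cnj ` L))"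
proof (rule isoI)
  have L': "is_subring (cnj ` L)"
    using L unfolding is_subring_def
    by (auto simp: cnj_image_iff simp flip: complex_cnj_minus complex_cnj_add complex_cnj_mult)
  have KL': "K \<subseteq> cnj ` L" using KL K by blast
  show "conj_aut L \<in> hom (galois_group K L) (galois_group K (cnj ` L))"
  proof (rule homI)
    fix \<sigma> \<rho> assume s: "\<sigma> \<in> carrier (galois_group K L)" and r: "\<rho> \<in> carrier (galois_group K L)"
    have "conj_aut L (compose L \<sigma> \<rho>) = compose (cnj ` L) (conj_aut L \<sigma>) (conj_aut L \<rho>)"
      proof (rule ext)
      fix x show "conj_aut L (compose L \<sigma> \<rho>) x = compose (cnj ` L) (conj_aut L \<sigma>) (conj_aut L \<rho>) x"
      proof (cases "x \<in> cnj ` L")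
        case True
        then have "cnj x \<in> L" by (simp add: cnj_image_iff)
        then show ?thesis
          using True galois_group_maps[OF r] by (simp add: conj_aut_def compose_def cnj_image_iff)
      qed (simp add: conj_aut_def compose_def)
    qed
    then show "conj_aut L (\<sigma> \<otimes>\<^bsub>galois_group K L\<^esub> \<rho>) =
        conj_aut L \<sigma> \<otimes>\<^bsub>galois_group K (cnj ` L)\<^esub> conj_aut L \<rho>"
      using s r conj_aut_mem[OF L KL K] by (simp add: galois_group_mult)
  qed (rule conj_aut_mem[OF L KL K])
  show "bij_betw (conj_aut L) (carrier (galois_group K L)) (carrier (galois_group K (cnj ` L)))"
  proof (rule bij_betw_byWitness[of _ "conj_aut (cnj ` L)"])
    show "\<forall>\<sigma>\<in>carrier (galois_group K L). conj_aut (cnj ` L) (conj_aut L \<sigma>) = \<sigma>"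
      using conj_aut_conj_aut by (auto simp: galois_group_carrier)
    show "\<forall>\<sigma>\<in>carrier (galois_group K (cnj ` L)). conj_aut L (conj_aut (cnj ` L) \<sigma>) = \<sigma>"
      using conj_aut_conj_aut[of _ "cnj ` L"] by (auto simp: galois_group_carrier cnj_image_cnj)
    show "conj_aut L ` carrier (galois_group K L) \<subseteq> carrier (galois_group K (cnj ` L))"
      using conj_aut_mem[OF L KL K] by blast
    show "conj_aut (cnj ` L) ` carrier (galois_group K (cnj ` L)) \<subseteq> carrier (galois_group K L)"
      using conj_aut_mem[OF L' KL' K] by (auto simp: cnj_image_cnj)
  qed
qed

lemma abelian_extension_cnj:
  assumes K: "cnj ` K = K" and ab: "abelian_extension K L"
  shows "abelian_extension K (cnj ` L)"
proof -
  have nf: "number_field K" "number_field L" and KL: "K \<subseteq> L"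
    and fixed: "{x \<in> L. \<forall>\<sigma>\<in>carrier (galois_group K L). \<sigma> x = x} = K"
    and comm: "comm_group (galois_group K L)"
    using ab by (auto simp: abelian_extension_def galois_extension_def)
  have L: "is_subring L" using nf(2) by (simp add: number_field_def subfield_CC_iff)
  have KL': "K \<subseteq> cnj ` L" using KL K by blast
  have "{x \<in> cnj ` L. \<forall>\<sigma>\<in>carrier (galois_group K (cnj ` L)). \<sigma> x = x} = K"
  proof (intro equalityI subsetI)
    fix x assume x: "x \<in> {x \<in> cnj ` L. \<forall>\<sigma>\<in>carrier (galois_group K (cnj ` L)). \<sigma> x = x}"
    then obtain y where y: "y \<in> L" "x = cnj y" by blast
    have "\<sigma> y = y" if s: "\<sigma> \<in> carrier (galois_group K L)" for \<sigma>
    proof -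
      have "conj_aut L \<sigma> x = x" using x conj_aut_mem[OF L KL K s] by blast
      then have "cnj (\<sigma> y) = cnj y" using conj_aut_apply[OF y(1), of \<sigma>] y(2) by simp
      then show ?thesis by simp
    qed
    then have "y \<in> K" using fixed y(1) by blast
    then show "x \<in> K" using K y(2) by blast
  next
    fix x assume "x \<in> K"
    then show "x \<in> {x \<in> cnj ` L. \<forall>\<sigma>\<in>carrier (galois_group K (cnj ` L)). \<sigma> x = x}"
      using KL' by (auto simp: galois_group_carrier)
  qed
  moreover have "comm_group (galois_group K (cnj ` L))"
  proof -
    have "conj_aut L \<one>\<^bsub>galois_group K L\<^esub> = \<one>\<^bsub>galois_group K (cnj ` L)\<^esub>"
      by (auto simp: galois_group_one conj_aut_def fun_eq_iff)
    then show ?thesis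
      using comm_group.iso_imp_img_comm_group[OF comm conj_aut_iso[OF L KL K]] by simp
  qed
  ultimately show ?thesis
    using nf number_field_cnj KL' by (simp add: abelian_extension_def galois_extension_def)
qed

lemma ints_cnj: "ints (cnj ` L) = cnj ` ints L"
  by (auto simp: ints_def cnj_image_iff)

lemma is_prime_cnj:
  assumes "is_prime R Q" shows "is_prime (cnj ` R) (cnj ` Q)"
  using assms unfolding is_prime_def is_ideal_def
  by (auto simp: cnj_image_iff simp flip: complex_cnj_add complex_cnj_mult)

lemma iprod_cnj: "iprod (cnj ` I) (cnj ` J) = cnj ` iprod I J"
proof -
  have *: "iprod (cnj ` I) (cnj ` J) \<subseteq> cnj ` iprod I J" for I J
  proof
    fix x assume "x \<in> iprod (cnj ` I) (cnj ` J)"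
    then show "x \<in> cnj ` iprod I J"
      by induction (auto simp: cnj_image_iff intro: iprod.intros)
  qed
  have "cnj ` iprod I J \<subseteq> iprod (cnj ` I) (cnj ` J)"
    using image_mono[OF *[of "cnj ` I" "cnj ` J"], of cnj] by (simp add: cnj_image_cnj)
  then show ?thesis using * by blast
qed

lemma ipow_cnj: "ipow (cnj ` R) (cnj ` Q) n = cnj ` ipow R Q n"
  by (induction n) (simp_all add: iprod_cnj)

lemma unramified_extension_cnj:
  assumes K: "cnj ` K = K" and L: "is_subring L" and un: "unramified_extension K L"
  shows "unramified_extension K (cnj ` L)"
proof -
  have L': "is_subring (cnj ` L)"
    using L unfolding is_subring_def
    by (auto simp: cnj_image_iff simp flip: complex_cnj_minus complex_cnj_add complex_cnj_mult)
  have iK: "cnj ` ints K = ints K" using ints_cnj[of K] K by simp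
  have "(GREATEST e. Q \<inter> ints K \<subseteq> ipow (ints (cnj ` L)) Q e) = 1"
    if Q: "is_prime (ints (cnj ` L)) Q" "Q \<noteq> {0}" for Q
  proof -
    have Q': "is_prime (ints L) (cnj ` Q)"
      using is_prime_cnj[OF Q(1)] by (simp add: ints_cnj cnj_image_cnj)
    have "cnj ` Q \<noteq> {0}"
    proof
      assume "cnj ` Q = {0}"
      then have "cnj ` cnj ` Q = cnj ` {0}" by simp
      then show False using Q(2) by (simp add: cnj_image_cnj)
    qed
    then have "(GREATEST e. cnj ` Q \<inter> ints K \<subseteq> ipow (ints L) (cnj ` Q) e) = 1"
      using un Q' unfolding unramified_extension_iff[OF L] by blast
    moreover have "(cnj ` Q \<inter> ints K \<subseteq> ipow (ints L) (cnj ` Q) e) \<longleftrightarrow>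
        (Q \<inter> ints K \<subseteq> ipow (ints (cnj ` L)) Q e)" for e
    proof -
      have "cnj ` Q \<inter> ints K = cnj ` (Q \<inter> ints K)"
        using iK image_Int[OF inj_cnj, of Q "ints K"] by simp
      moreover have "ipow (ints L) (cnj ` Q) e = cnj ` ipow (ints (cnj ` L)) Q e"
        using ipow_cnj[of "ints (cnj ` L)" Q e] by (simp add: ints_cnj cnj_image_cnj)
      ultimately show ?thesis using inj_image_subset_iff[OF inj_cnj] by simp
    qed
    ultimately show ?thesis by simp
  qed
  moreover have "\<phi> ` (cnj ` L) \<subseteq> \<real>"
    if phi: "\<phi> \<in> Ring.ring_hom (field_on (cnj ` L)) CC" "\<phi> ` K \<subseteq> \<real>" for \<phi>
  proof -
    have "\<phi> \<circ> cnj \<in> Ring.ring_hom (field_on L) CC"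
      using phi(1) by (auto simp: Ring.ring_hom_def CC_simps)
    moreover have "(\<phi> \<circ> cnj) ` K \<subseteq> \<real>" using phi(2) unfolding image_comp[symmetric] K .
    ultimately have "(\<phi> \<circ> cnj) ` L \<subseteq> \<real>" using un unfolding unramified_extension_def by blast
    then show ?thesis unfolding image_comp .
  qed
  ultimately show ?thesis unfolding unramified_extension_iff[OF L'] by blast
qed

lemma hilbert_class_field_cnj:
  assumes K: "cnj ` K = K" and H: "is_hilbert_class_field K H"
  shows "cnj ` H = H"
proof -
  have ab: "abelian_extension K H" and un: "unramified_extension K H"
    and max: "\<And>L. abelian_extension K L \<Longrightarrow> unramified_extension K L \<Longrightarrow> L \<subseteq> H"
    using H by (auto simp: is_hilbert_class_field_def)
  have "is_subring H"
    using ab by (simp add: abelian_extension_def galois_extension_def number_field_def subfield_CC_iff)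
  then have sub: "cnj ` H \<subseteq> H"
    using abelian_extension_cnj[OF K ab] unramified_extension_cnj[OF K _ un] max by blast
  then have "cnj ` cnj ` H \<subseteq> cnj ` H" by (rule image_mono)
  then show ?thesis using sub by (simp add: cnj_image_cnj)
qed

section \<open>Residue fields with few elements\<close>

text \<open>Lagrange's bound on the number of roots over the domain \<open>R / Q\<close>: after
  division by the linear factor of \<open>t\<close>, the other elements of \<open>T\<close> remain
  roots modulo \<open>Q\<close>, because their differences from \<open>t\<close> are outside the
  prime.\<close>

lemma coeff_in_ideal_if_many_roots:
  fixes f :: "'a::comm_ring_1 poly"
  assumes R: "is_subring R" and Q: "is_prime R Q"
  shows "degree f \<le> n \<Longrightarrow> f \<in> polys R \<Longrightarrow> finite T \<Longrightarrow> T \<subseteq> R \<Longrightarrow> card T = Suc n \<Longrightarrow>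
    (\<And>s t. s \<in> T \<Longrightarrow> t \<in> T \<Longrightarrow> s \<noteq> t \<Longrightarrow> s - t \<notin> Q) \<Longrightarrow> (\<And>t. t \<in> T \<Longrightarrow> poly f t \<in> Q) \<Longrightarrow>
    f \<in> polys Q"
proof (induction n arbitrary: f T)
  case 0
  obtain c where f: "f = [:c:]" using 0(1) by (meson degree_eq_zeroE le_zero_eq)
  obtain t where "t \<in> T" using 0(5) by fastforce
  then have "c \<in> Q" using 0(7) f by fastforce
  then show ?case using is_idealD(2)[OF is_prime_ideal[OF Q]] by (simp add: f polys_def coeff_pCons split: nat.splits)
next
  case (Suc n)
  note id = is_prime_ideal[OF Q]
  obtain t where t: "t \<in> T" using Suc.prems(5) by fastforce
  then have tR: "t \<in> R" using Suc.prems(4) by blast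
  have poly_R: "poly q t \<in> R" if "q \<in> polys R" for q
    unfolding poly_altdef using that is_subringD(5)[OF R] is_subring_power[OF R tR]
    by (intro is_subring_sum[OF R]) (simp add: polys_def)
  have div_R: "synthetic_div q t \<in> polys R" if "q \<in> polys R" for q
    using that
  proof (induction q)
    case 0
    then show ?case by simp
  next
    case (pCons a q)
    have q: "q \<in> polys R" unfolding polys_def
    proof (intro CollectI allI)
      fix i
      have "coeff (pCons a q) (Suc i) \<in> R" using pCons.prems unfolding polys_def by blast
      then show "coeff q i \<in> R" by simp
    qed
    then show ?case using pCons.IH poly_R[OF q] by (simp add: polys_def coeff_pCons split: nat.splits)
  qed
  define g where "g = synthetic_div f t"
  have f: "f = [:-t, 1:] * g + [:poly f t:]" unfolding g_def by (rule synthetic_div_correct'[symmetric])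
  have "g \<in> polys Q"
  proof (rule Suc.IH)
    show "degree g \<le> n" using Suc.prems(1) by (simp add: g_def degree_synthetic_div)
    show "g \<in> polys R" unfolding g_def by (rule div_R[OF Suc.prems(2)])
    then have gR: "poly g s \<in> R" if "s \<in> T" for s
      unfolding poly_altdef using that Suc.prems(4) is_subringD(5)[OF R] is_subring_power[OF R]
      by (intro is_subring_sum[OF R]) (auto simp: polys_def)
    show "finite (T - {t})" "T - {t} \<subseteq> R" "card (T - {t}) = Suc n" using Suc.prems(3-5) t by auto
    show "a - b \<notin> Q" if "a \<in> T - {t}" "b \<in> T - {t}" "a \<noteq> b" for a b using Suc.prems(6) that by blast
    show "poly g s \<in> Q" if s: "s \<in> T - {t}" for s
    proof -
      have eq: "poly f s - poly f t = (s - t) * poly g s" by (subst f) (simp add: algebra_simps)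
      have "poly f s - poly f t \<in> Q" using Suc.prems(7) s t by (intro is_ideal_diff[OF R id]) auto
      then have "(s - t) * poly g s \<in> Q" by (simp only: eq)
      moreover have "s - t \<in> R" using s Suc.prems(4) tR by (intro is_subringD(6)[OF R]) auto
      moreover have "s - t \<notin> Q" using Suc.prems(6) s t by blast
      ultimately show ?thesis using Q gR s unfolding is_prime_def by blast
    qed
  qed
  moreover have "[:-t, 1:] \<in> polys R"
    using is_subringD(1-3)[OF R] tR by (simp add: polys_def coeff_pCons split: nat.splits)
  ultimately have "[:-t, 1:] * g \<in> polys Q" by (intro is_idealD(4)[OF is_ideal_polys[OF id]])
  moreover have "[:poly f t:] \<in> polys Q"
    using Suc.prems(7)[OF t] is_idealD(2)[OF id] by (simp add: polys_def coeff_pCons split: nat.splits)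
  ultimately have "[:-t, 1:] * g + [:poly f t:] \<in> polys Q" by (rule is_idealD(3)[OF is_ideal_polys[OF id]])
  then show ?case using f by simp
qed

text \<open>Otherwise the polynomial \<open>X ^ p - X\<close> would have \<open>x\<close> as a root
  modulo \<open>P\<close> besides the numbers below \<open>p\<close>. That is one root too many, and
  its coefficient -1 would lie in \<open>P\<close>.\<close>

lemma cong_nat_if_power_cong:
  fixes x :: "'a::{comm_ring_1,ring_char_0}"
  assumes R: "is_subring R" and P: "is_prime R P" and p: "prime (p :: nat)" "of_nat p \<in> P"
    and x: "x \<in> R" "x ^ p - x \<in> P"
  shows "\<exists>n. x - of_nat n \<in> P"
proof (rule ccontr)
  assume no: "\<not> ?thesis"
  note id = is_prime_ideal[OF P]
  have one: "1 \<notin> P" using P unfolding is_prime_def by blast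
  have dvd: "of_int n \<in> P \<longleftrightarrow> int p dvd n" for n by (rule is_ideal_of_int_dvd[OF R id one p])
  define T where "T = insert x (of_nat ` {..<p})"
  define f where "f = monom 1 p - monom (1 :: 'a) 1"
  have p1: "p > 1" using prime_gt_1_nat[OF p(1)] .
  have "f \<in> polys P"
  proof (rule coeff_in_ideal_if_many_roots[OF R P, of _ p T])
    show "degree f \<le> p" unfolding f_def using p1 by (intro degree_diff_le) (auto simp: degree_monom_eq)
    show "f \<in> polys R"
      using is_subringD(1-3)[OF R] by (auto simp: f_def polys_def)
    show "finite T" "T \<subseteq> R" using x(1) is_subring_of_nat[OF R] by (auto simp: T_def)
    have "x \<notin> of_nat ` {..<p}"
    proof
      assume "x \<in> of_nat ` {..<p}"
      then obtain n where "x = of_nat n" by blast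
      then show False using no is_idealD(2)[OF id] by (metis diff_self)
    qed
    moreover have "card (of_nat ` {..<p} :: 'a set) = p" by (simp add: card_image inj_on_def)
    ultimately show "card T = Suc p" by (simp add: T_def)
    show "s - t \<notin> P" if s: "s \<in> T" and t: "t \<in> T" and ne: "s \<noteq> t" for s t
    proof
      assume st: "s - t \<in> P"
      then have ts: "t - s \<in> P" using is_ideal_minus[OF R id st] by simp
      consider "s = x" | "t = x" | "s \<noteq> x" "t \<noteq> x" by blast
      then show False
      proof cases
        case 1
        then show ?thesis using t ne st no by (auto simp: T_def)
      next
        case 2
        then show ?thesis using s ne ts no by (auto simp: T_def)
      next
        case 3
        then obtain m n where mn: "s = of_nat m" "t = of_nat n" "m < p" "n < p" using s t by (auto simp: T_def)
        then have "of_int (int m - int n) \<in> P" using st by simp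
        then have "int p dvd int m - int n" using dvd by blast
        moreover have "\<bar>int m - int n\<bar> < int p" using mn by linarith
        ultimately have "int m - int n = 0" by (metis abs_of_nat dvd_imp_le_int not_less)
        then show False using ne mn by simp
      qed
    qed
    show "poly f t \<in> P" if t: "t \<in> T" for t
    proof (cases "t = x")
      case True
      then show ?thesis using x(2) by (simp add: f_def poly_monom)
    next
      case False
      then obtain n where "t = of_nat n" using t by (auto simp: T_def)
      then have "poly f t = of_int (int n ^ p - int n)" by (simp add: f_def poly_monom)
      then show ?thesis using iffD2[OF dvd fermat_int[OF p(1), of "int n"]] by simp
    qed
  qed
  then have "coeff f 1 \<in> P" unfolding polys_def by blast
  then have "- 1 \<in> P" using p1 by (simp add: f_def)
  then show False using one is_ideal_minus[OF R id, of "- 1"] by simp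
qed

lemma ints_Rats: "ints \<rat> = \<int>"
  unfolding ints_def using rational_algebraic_int_is_int by (auto elim!: Ints_cases)

text \<open>Each class contains an integer, so the residue field is the image of the integers and
  has dimension 1 over itself. The quotient is a field because \<open>x ^ (p - 2)\<close> inverts
  \<open>x\<close> modulo \<open>P\<close>.\<close>

lemma residue_degree_1:
  assumes L: "subfield L CC" and P: "is_prime (ints L) P" and p: "prime (p :: nat)" "of_nat p \<in> P"
    and pow: "\<And>x. x \<in> ints L \<Longrightarrow> x ^ p - x \<in> P"
  shows "residue_degree \<rat> L P = 1"
proof -
  have sr: "is_subring L" using L by (simp add: subfield_CC_iff)
  note R = is_subring_ints[OF sr] and id = is_prime_ideal[OF P]
  let ?S = "integer_ring L"
  let ?k = "?S Quot P"
  interpret S: cring ?S by (rule cring_integer_ring[OF sr])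
  interpret P: primeideal P ?S using primeideal_integer_ring_iff[OF sr] P by blast
  interpret k: domain ?k by (rule P.quotient_is_domain)
  note h = ring_hom_memE[OF P.rcos_ring_hom, unfolded integer_ring_simps]
  have minus: "x \<ominus>\<^bsub>?S\<^esub> y = x - y" if "x \<in> ints L" "y \<in> ints L" for x y
  proof -
    have "\<ominus>\<^bsub>?S\<^esub> y = - y"
      using S.minus_equality[of "- y" y] that is_subringD(3)[OF R, of y] by (simp add: integer_ring_simps)
    then show ?thesis by (simp add: a_minus_def integer_ring_simps)
  qed
  have eq: "P +>\<^bsub>?S\<^esub> x = P +>\<^bsub>?S\<^esub> y" if "x \<in> ints L" "y \<in> ints L" "x - y \<in> P" for x y
    using S.quotient_eq_iff_same_a_r_cos[OF P.ideal_axioms, of x y] that minus[of x y]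
    by (simp add: integer_ring_simps)
  have carrier_k: "carrier ?k = (\<lambda>x. P +>\<^bsub>?S\<^esub> x) ` ints L"
    by (auto simp: FactRing_def A_RCOSETS_def' integer_ring_simps)
  have zero_k: "P +>\<^bsub>?S\<^esub> x = \<zero>\<^bsub>?k\<^esub>" if "x \<in> P" for x
    using S.a_rcos_zero[OF P.ideal_axioms that] by (simp add: FactRing_def)
  have "field ?k"
  proof (rule k.cring_fieldI2)
    show "\<zero>\<^bsub>?k\<^esub> \<noteq> \<one>\<^bsub>?k\<^esub>" using k.one_not_zero by metis
    fix a assume a: "a \<in> carrier ?k" "a \<noteq> \<zero>\<^bsub>?k\<^esub>"
    then obtain x where x: "x \<in> ints L" "a = P +>\<^bsub>?S\<^esub> x" unfolding carrier_k by blast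
    have xP: "x \<notin> P" using zero_k a(2) x(2) by blast
    have p2: "p \<ge> 2" using prime_ge_2_nat[OF p(1)] .
    define y where "y = x ^ (p - 2)"
    have y: "y \<in> ints L" unfolding y_def by (rule is_subring_power[OF R x(1)])
    have xy: "x * y = x ^ (p - 1)" unfolding y_def using p2 by (simp add: Suc_diff_Suc numeral_2_eq_2 flip: power_Suc)
    have "x * (x * y - 1) = x ^ p - x" unfolding xy using p2 by (simp add: algebra_simps flip: power_Suc)
    then have "x * (x * y - 1) \<in> P" using pow[OF x(1)] by simp
    moreover have xyR: "x * y \<in> ints L" by (rule is_subringD(5)[OF R x(1) y])
    moreover have "x * y - 1 \<in> ints L" by (rule is_subringD(6)[OF R xyR is_subringD(2)[OF R]])
    ultimately have "x * y - 1 \<in> P" using P xP x(1) unfolding is_prime_def by blast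
    then have "P +>\<^bsub>?S\<^esub> (x * y) = P +>\<^bsub>?S\<^esub> 1" using eq[OF xyR is_subringD(2)[OF R]] by simp
    then have "a \<otimes>\<^bsub>?k\<^esub> (P +>\<^bsub>?S\<^esub> y) = \<one>\<^bsub>?k\<^esub>" using h(2)[OF x(1) y] h(4) x(2) by simp
    then show "\<exists>b\<in>carrier ?k. a \<otimes>\<^bsub>?k\<^esub> b = \<one>\<^bsub>?k\<^esub>" using h(1)[OF y] by blast
  qed
  then interpret k: field ?k .
  have "(\<lambda>x. P +>\<^bsub>?S\<^esub> x) ` ints \<rat> = carrier ?k"
  proof (intro equalityI subsetI)
    fix a assume "a \<in> (\<lambda>x. P +>\<^bsub>?S\<^esub> x) ` ints \<rat>"
    then obtain n where "a = P +>\<^bsub>?S\<^esub> of_int n" unfolding ints_Rats by (auto elim: Ints_cases)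
    then show "a \<in> carrier ?k" using h(1)[OF is_subring_of_int[OF R]] by simp
  next
    fix a assume "a \<in> carrier ?k"
    then obtain x where x: "x \<in> ints L" "a = P +>\<^bsub>?S\<^esub> x" unfolding carrier_k by blast
    obtain n where "x - of_nat n \<in> P" using cong_nat_if_power_cong[OF R P p x(1) pow[OF x(1)]] by blast
    then have "a = P +>\<^bsub>?S\<^esub> of_nat n" using eq[OF x(1) is_subring_of_nat[OF R]] x(2) by blast
    then show "a \<in> (\<lambda>x. P +>\<^bsub>?S\<^esub> x) ` ints \<rat>" unfolding ints_Rats by auto
  qed
  then have "residue_degree \<rat> L P = ring.dim ?k (carrier ?k) (carrier ?k)"
    by (simp add: residue_degree_def Let_def integer_ring_simps)
  also have "\<dots> = 1"
    using k.dimI[OF k.carrier_is_subfield k.dimension_one[OF k.carrier_is_subfield]] by (simp add: over_def)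
  finally show ?thesis .
qed

lemma prime_below_Rats:
  assumes L: "subfield L CC" and P: "is_prime (ints L) P" and p: "prime (p :: nat)" "of_nat p \<in> P"
  shows "prime_below \<rat> P = PIdl\<^bsub>integer_ring \<rat>\<^esub> (of_nat p)"
proof -
  have sr: "is_subring L" using L by (simp add: subfield_CC_iff)
  have one: "1 \<notin> P" using P unfolding is_prime_def by blast
  have dvd: "of_int n \<in> P \<longleftrightarrow> int p dvd n" for n
    by (rule is_ideal_of_int_dvd[OF is_subring_ints[OF sr] is_prime_ideal[OF P] one p])
  show ?thesis
    unfolding prime_below_def cgenideal_def integer_ring_simps ints_Rats
  proof (intro equalityI subsetI)
    fix x assume "x \<in> P \<inter> \<int>"
    then obtain n where n: "x = of_int n" "of_int n \<in> P" by (auto elim: Ints_cases)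
    then obtain m where "n = int p * m" using dvd by blast
    then have "x = of_int m * of_nat p \<and> of_int m \<in> (\<int> :: complex set)" using n(1) by simp
    then show "x \<in> {x * of_nat p |x. x \<in> \<int>}" unfolding mem_Collect_eq by (rule exI)
  next
    fix x :: complex assume "x \<in> {x * of_nat p |x. x \<in> \<int>}"
    then obtain m where "x = of_int m * of_nat p" by (auto elim: Ints_cases)
    then have "x = of_int (m * int p)" by simp
    then show "x \<in> P \<inter> \<int>" using dvd[of "m * int p"] by simp
  qed
qed

section \<open>The setting of the Hilbert class field\<close>

text \<open>With \<open>g = gcd N m\<close> and \<open>N = g * a\<close>, the cofactor
  \<open>a\<close> is coprime to that of \<open>m\<close>, so it divides \<open>g\<close>; its
  square divides \<open>N\<close>, which makes it a unit.\<close>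

lemma squarefree_dvd_power2:
  fixes N m :: int
  assumes "squarefree N" "N dvd m ^ 2" shows "N dvd m"
proof -
  have N: "N \<noteq> 0" using assms(1) by auto
  define g where "g = gcd N m"
  have g: "g \<noteq> 0" using N by (simp add: g_def)
  obtain a b where ab: "N = g * a" "m = g * b" "coprime a b"
    using gcd_coprime_exists[of N m] g unfolding g_def by (metis mult.commute)
  have "g * a dvd g * (g * b ^ 2)" using assms(2) unfolding ab by (simp add: power2_eq_square mult_ac)
  then have "a dvd g * b ^ 2" using g by simp
  moreover have "coprime a (b ^ 2)" using ab(3) by simp
  ultimately have "a dvd g" by (simp add: coprime_dvd_mult_left_iff)
  then have "a ^ 2 dvd N" unfolding ab(1) power2_eq_square by (rule mult_dvd_mono) simp
  then have "a dvd 1" by (rule squarefreeD[OF assms(1)])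
  then have "g * a dvd g * b" by (metis dvd_mult_unit_iff' dvd_refl dvd_triv_left dvd_trans mult_dvd_mono one_dvd)
  then show ?thesis by (simp add: ab)
qed

locale class_field_setting =
  fixes N :: nat and K L :: "complex set" and \<omega> :: complex
  assumes N: "N > 0" "squarefree N"
    and omega_def: "\<omega> = csqrt (- of_nat N)"
    and K_def: "K = generate_field CC {\<omega>}"
    and L_class_field: "is_hilbert_class_field K L"
begin

lemma omega_square: "\<omega>\<^sup>2 = - of_nat N"
  unfolding omega_def by (rule power2_csqrt)

lemma omega_cnj: "cnj \<omega> = - \<omega>"
  by (simp add: omega_def)

lemma number_fields: "number_field K" "number_field L"
  and K_subset: "K \<subseteq> L"
  and fixed_K: "{x \<in> L. \<forall>\<sigma>\<in>carrier (galois_group K L). \<sigma> x = x} = K"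
  and Gal_comm: "comm_group (galois_group K L)"
  and unramified_L: "unramified_extension K L"
  using L_class_field
  by (auto simp: is_hilbert_class_field_def abelian_extension_def galois_extension_def)

lemma subfields: "subfield K CC" "subfield L CC"
  using number_fields by (auto simp: number_field_def)

lemma subrings: "is_subring K" "is_subring L"
  using subfields by (auto simp: subfield_CC_iff)

lemma omega_K: "\<omega> \<in> K"
  unfolding K_def by (rule generate_field.incl) simp

lemma K_elem: "x \<in> K \<Longrightarrow> \<exists>a\<in>\<rat>. \<exists>b\<in>\<rat>. x = a + b * \<omega>"
  unfolding K_def
proof (induction rule: generate_field.induct)
  case one
  show ?case by (intro bexI[of _ 1] bexI[of _ 0]) (auto simp: CC_simps)
next
  case (incl h)
  then show ?case by (intro bexI[of _ 0] bexI[of _ 1]) auto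
next
  case (a_inv h)
  then obtain a b where ab: "a \<in> \<rat>" "b \<in> \<rat>" "h = a + b * \<omega>" by blast
  show ?case using ab by (intro bexI[of _ "- a"] bexI[of _ "- b"]) (auto simp: CC_minus)
next
  case (m_inv h)
  then obtain a b where ab: "a \<in> \<rat>" "b \<in> \<rat>" "h = a + b * \<omega>" by blast
  have h: "h \<noteq> 0" using m_inv by (simp add: CC_simps)
  have c: "cnj h = a - b * \<omega>" using ab by (simp add: cnj_Rats omega_cnj)
  define n where "n = a\<^sup>2 + of_nat N * b\<^sup>2"
  have "h * cnj h = a\<^sup>2 - \<omega>\<^sup>2 * b\<^sup>2"
    unfolding c unfolding ab(3) by (simp add: algebra_simps power2_eq_square)
  then have n: "h * cnj h = n" unfolding omega_square n_def by simp
  have nQ: "n \<in> \<rat>" unfolding n_def using ab by auto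
  have n0: "n \<noteq> 0" using h n by (metis complex_cnj_zero_iff mult_eq_0_iff)
  have "inverse h = cnj h / n" using h n0 n by (simp add: field_simps)
  also have "\<dots> = a / n + (- b / n) * \<omega>" unfolding c by (simp add: field_simps n0)
  finally have "inv\<^bsub>CC\<^esub> h = a / n + (- b / n) * \<omega>" using h by (simp add: CC_inverse)
  then show ?case using ab nQ by (intro bexI[of _ "a / n"] bexI[of _ "- b / n"]) auto
next
  case (eng_add h k)
  then obtain a b c d where ab: "a \<in> \<rat>" "b \<in> \<rat>" "h = a + b * \<omega>" "c \<in> \<rat>" "d \<in> \<rat>" "k = c + d * \<omega>" by blast
  show ?case using ab
    by (intro bexI[of _ "a + c"] bexI[of _ "b + d"]) (auto simp: CC_simps algebra_simps)
next
  case (eng_mult h k)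
  then obtain a b c d where ab: "a \<in> \<rat>" "b \<in> \<rat>" "h = a + b * \<omega>" "c \<in> \<rat>" "d \<in> \<rat>" "k = c + d * \<omega>" by blast
  have "h * k = a * c + b * d * \<omega>\<^sup>2 + (a * d + b * c) * \<omega>"
    unfolding ab by (simp add: algebra_simps power2_eq_square)
  then have "h * k = (a * c - of_nat N * b * d) + (a * d + b * c) * \<omega>"
    unfolding omega_square by (simp add: algebra_simps)
  then show ?case using ab
    by (intro bexI[of _ "a * c - of_nat N * b * d"] bexI[of _ "a * d + b * c"]) (auto simp: CC_simps)
qed

lemma cnj_K: "cnj ` K = K"
proof -
  have sub: "cnj ` K \<subseteq> K"
  proof
    fix y assume "y \<in> cnj ` K"
    then obtain x where x: "x \<in> K" "y = cnj x" by blast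
    then obtain a b where ab: "a \<in> \<rat>" "b \<in> \<rat>" "x = a + b * \<omega>" using K_elem by blast
    have "y = a - b * \<omega>" using ab x(2) by (simp add: cnj_Rats omega_cnj)
    moreover have "a \<in> K" "b \<in> K" using ab subfield_Rats[OF subfields(1)] by auto
    ultimately show "y \<in> K"
      using is_subringD(6)[OF subrings(1), of a "b * \<omega>"] is_subringD(5)[OF subrings(1), of b \<omega>] omega_K by simp
  qed
  then have "cnj ` cnj ` K \<subseteq> cnj ` K" by (rule image_mono)
  then show ?thesis using sub by (simp add: cnj_image_cnj)
qed

lemma cnj_L: "cnj ` L = L"
  by (rule hilbert_class_field_cnj[OF cnj_K L_class_field])

section \<open>The group of the Hilbert class field over \<open>\<rat>\<close>, acting on its
  integers\<close>

definition R :: "complex set" where "R = ints L"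

lemma subring_R: "is_subring R"
  unfolding R_def by (rule is_subring_ints[OF subrings(2)])

lemma cnj_R: "x \<in> R \<Longrightarrow> cnj x \<in> R"
  using cnj_L unfolding R_def ints_def by (auto simp: cnj_image_iff)

text \<open>The abstract theory of actions on a ring wants maps that are the identity outside of that ring.\<close>

definition ext :: "(complex \<Rightarrow> complex) \<Rightarrow> complex \<Rightarrow> complex" where
  "ext \<sigma> = (\<lambda>x. if x \<in> R then \<sigma> x else x)"

abbreviation Gal :: "(complex \<Rightarrow> complex) set" where
  "Gal \<equiv> carrier (galois_group K L)"

definition A :: "(complex \<Rightarrow> complex) set" where "A = ext ` Gal"

definition \<tau> :: "complex \<Rightarrow> complex" where "\<tau> = ext cnj"

definition G :: "(complex \<Rightarrow> complex) set" where "G = A \<union> (\<lambda>a. a \<circ> \<tau>) ` A"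

lemma Gal_closed: "\<sigma> \<in> Gal \<Longrightarrow> x \<in> R \<Longrightarrow> \<sigma> x \<in> R"
proof -
  assume s: "\<sigma> \<in> Gal" and x: "x \<in> R"
  note hom = galois_group_hom[OF subrings(2) s]
  have xL: "x \<in> L" "algebraic_int x" using x by (auto simp: R_def ints_def)
  obtain q where q: "monic q" "\<And>i. coeff q i \<in> \<int>" "poly q x = 0"
    using xL(2) by (auto elim: algebraic_int.cases)
  have "poly q (\<sigma> x) = 0"
    using hom_mod_0_poly[OF subrings(2) hom xL(1) q(2)] q(3) hom_modD(1)[OF hom] by simp
  then have "algebraic_int (\<sigma> x)" using q by (intro algebraic_int.intros[of q]) auto
  then show ?thesis using galois_group_maps[OF s xL(1)] by (simp add: R_def ints_def)
qed

lemma ext_comp: "(\<And>x. x \<in> R \<Longrightarrow> \<rho> x \<in> R) \<Longrightarrow> ext \<sigma> \<circ> ext \<rho> = ext (\<sigma> \<circ> \<rho>)"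
  by (auto simp: ext_def fun_eq_iff)

lemma ext_cong: "(\<And>x. x \<in> R \<Longrightarrow> \<sigma> x = \<rho> x) \<Longrightarrow> ext \<sigma> = ext \<rho>"
  by (auto simp: ext_def fun_eq_iff)

lemma R_L: "x \<in> R \<Longrightarrow> x \<in> L"
  by (simp add: R_def ints_def)

lemma ext_mult:
  assumes "\<sigma> \<in> Gal" "\<rho> \<in> Gal" shows "ext \<sigma> \<circ> ext \<rho> = ext (\<sigma> \<otimes>\<^bsub>galois_group K L\<^esub> \<rho>)"
proof -
  have "ext \<sigma> \<circ> ext \<rho> = ext (\<sigma> \<circ> \<rho>)" using Gal_closed[OF assms(2)] by (rule ext_comp)
  also have "\<dots> = ext (\<sigma> \<otimes>\<^bsub>galois_group K L\<^esub> \<rho>)"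
    using assms R_L by (intro ext_cong) (simp add: galois_group_mult compose_def)
  finally show ?thesis .
qed

lemma ext_one: "ext \<one>\<^bsub>galois_group K L\<^esub> = id"
  using R_L by (auto simp: ext_def galois_group_one fun_eq_iff)

lemma A_id: "id \<in> A"
proof -
  interpret comm_group "galois_group K L" by (rule Gal_comm)
  show ?thesis unfolding A_def using ext_one[symmetric] one_closed by (rule image_eqI)
qed

lemma A_comp: "a \<in> A \<Longrightarrow> b \<in> A \<Longrightarrow> a \<circ> b \<in> A"
proof -
  interpret comm_group "galois_group K L" by (rule Gal_comm)
  assume "a \<in> A" "b \<in> A"
  then obtain \<sigma> \<rho> where s: "\<sigma> \<in> Gal" "\<rho> \<in> Gal" "a = ext \<sigma>" "b = ext \<rho>" by (auto simp: A_def)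
  then show ?thesis unfolding A_def using ext_mult[OF s(1,2)] m_closed[OF s(1,2)] by blast
qed

lemma A_commute: "a \<in> A \<Longrightarrow> b \<in> A \<Longrightarrow> a \<circ> b = b \<circ> a"
proof -
  interpret comm_group "galois_group K L" by (rule Gal_comm)
  assume "a \<in> A" "b \<in> A"
  then obtain \<sigma> \<rho> where s: "\<sigma> \<in> Gal" "\<rho> \<in> Gal" "a = ext \<sigma>" "b = ext \<rho>" by (auto simp: A_def)
  then show ?thesis using ext_mult[OF s(1,2)] ext_mult[OF s(2,1)] m_comm[OF s(1,2)] by simp
qed

lemma A_inverse: "a \<in> A \<Longrightarrow> \<exists>b\<in>A. b \<circ> a = id \<and> a \<circ> b = id"
proof -
  interpret comm_group "galois_group K L" by (rule Gal_comm)
  assume "a \<in> A"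
  then obtain \<sigma> where s: "\<sigma> \<in> Gal" "a = ext \<sigma>" by (auto simp: A_def)
  let ?r = "inv\<^bsub>galois_group K L\<^esub> \<sigma>"
  have r: "?r \<in> Gal" using s(1) by (rule inv_closed)
  have "ext ?r \<circ> a = id" using ext_mult[OF r s(1)] s l_inv[OF s(1)] ext_one by simp
  moreover have "a \<circ> ext ?r = id" using ext_mult[OF s(1) r] s r_inv[OF s(1)] ext_one by simp
  moreover have "ext ?r \<in> A" using r by (simp add: A_def)
  ultimately show ?thesis by blast
qed

lemma tau_tau: "\<tau> \<circ> \<tau> = id"
  using cnj_R by (auto simp: \<tau>_def ext_def fun_eq_iff)

lemma tau_A_tau: "a \<in> A \<Longrightarrow> \<tau> \<circ> a \<circ> \<tau> \<in> A"
proof -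
  assume "a \<in> A"
  then obtain \<sigma> where s: "\<sigma> \<in> Gal" "a = ext \<sigma>" by (auto simp: A_def)
  have "\<tau> \<circ> a \<circ> \<tau> = ext (cnj \<circ> \<sigma> \<circ> cnj)"
    unfolding \<tau>_def s(2) using Gal_closed[OF s(1)] cnj_R by (simp add: ext_comp)
  also have "\<dots> = ext (conj_aut L \<sigma>)"
    using R_L cnj_L by (intro ext_cong) (simp add: conj_aut_def)
  finally show ?thesis
    using conj_aut_mem[OF subrings(2) K_subset cnj_K s(1)] cnj_L by (simp add: A_def)
qed

lemma hom_mod_ext: "a \<in> A \<Longrightarrow> hom_mod R {0} a"
proof -
  assume "a \<in> A"
  then obtain \<sigma> where s: "\<sigma> \<in> Gal" "a = ext \<sigma>" by (auto simp: A_def)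
  note h = hom_modD[OF galois_group_hom[OF subrings(2) s(1)]] and S = is_subringD[OF subring_R]
  show ?thesis
    unfolding hom_mod_def s(2) ext_def using S h(1,2) h(4,5)[OF R_L R_L] Gal_closed[OF s(1)] by auto
qed

lemma hom_mod_tau: "hom_mod R {0} \<tau>"
  unfolding hom_mod_def \<tau>_def ext_def using is_subringD[OF subring_R] cnj_R by auto

lemma hom_mod_0_comp:
  assumes f: "hom_mod S {0} f" and g: "hom_mod S {0} g" shows "hom_mod S {0} (f \<circ> g)"
  unfolding hom_mod_def using hom_modD[OF f] hom_modD[OF g] by simp

lemma tau_A: "a \<in> A \<Longrightarrow> \<tau> \<circ> a = (\<tau> \<circ> a \<circ> \<tau>) \<circ> \<tau>"
  using tau_tau by (simp add: comp_assoc)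

lemma A_outside: "a \<in> A \<Longrightarrow> x \<notin> R \<Longrightarrow> a x = x"
  by (auto simp: A_def ext_def)

lemma G_cases:
  assumes "g \<in> G" obtains "g \<in> A" | a where "a \<in> A" "g = a \<circ> \<tau>"
  using assms by (auto simp: G_def)

lemma ring_action_G: "ring_action R G"
proof
  show "is_subring R" by (rule subring_R)
  have "finite A" unfolding A_def by (intro finite_imageI finite_galois_group number_fields subfields)
  then show "finite G" by (simp add: G_def)
  show "id \<in> G" using A_id by (simp add: G_def)
  fix g assume g: "g \<in> G"
  show "g \<circ> h \<in> G" if h: "h \<in> G" for h
    using g
  proof (cases rule: G_cases)
    case 1
    note gA = this
    show ?thesis using h
    proof (cases rule: G_cases)
      case 1
      then show ?thesis using gA A_comp by (simp add: G_def)
    next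
      case (2 b)
      then have "g \<circ> h = (g \<circ> b) \<circ> \<tau>" by (simp add: comp_assoc)
      then show ?thesis using A_comp[OF gA 2(1)] unfolding G_def by blast
    qed
  next
    case (2 a)
    note a = this
    show ?thesis using h
    proof (cases rule: G_cases)
      case 1
      have "g \<circ> h = (a \<circ> (\<tau> \<circ> h \<circ> \<tau>)) \<circ> \<tau>" unfolding a(2) by (simp only: comp_assoc tau_tau comp_id)
      then show ?thesis using A_comp[OF a(1) tau_A_tau[OF 1]] unfolding G_def by blast
    next
      case (2 b)
      then have "g \<circ> h = a \<circ> (\<tau> \<circ> b \<circ> \<tau>)" using a(2) by (simp add: comp_assoc)
      then show ?thesis using A_comp[OF a(1) tau_A_tau[OF 2(1)]] by (simp add: G_def)
    qed
  qed
  show "\<exists>h\<in>G. h \<circ> g = id \<and> g \<circ> h = id"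
    using g
  proof (cases rule: G_cases)
    case 1
    then show ?thesis using A_inverse[OF 1] unfolding G_def by blast
  next
    case (2 a)
    obtain b where b: "b \<in> A" "b \<circ> a = id" "a \<circ> b = id" using A_inverse[OF 2(1)] by blast
    have "\<tau> \<circ> b \<in> G" using tau_A[OF b(1)] tau_A_tau[OF b(1)] unfolding G_def by blast
    moreover have "(\<tau> \<circ> b) \<circ> g = \<tau> \<circ> (b \<circ> a) \<circ> \<tau>" "g \<circ> (\<tau> \<circ> b) = a \<circ> (\<tau> \<circ> \<tau>) \<circ> b"
      using 2(2) by (simp_all add: comp_assoc)
    ultimately show ?thesis using b tau_tau by (intro bexI[of _ "\<tau> \<circ> b"]) simp_all
  qed
  show "hom_mod R {0} g"
    using g
  proof (cases rule: G_cases)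
    case 1
    then show ?thesis by (rule hom_mod_ext)
  next
    case (2 a)
    show ?thesis unfolding 2(2) by (rule hom_mod_0_comp[OF hom_mod_ext[OF 2(1)] hom_mod_tau])
  qed
  show "g x = x" if "x \<notin> R" for x
    using g
  proof (cases rule: G_cases)
    case 1
    then show ?thesis using A_outside that by blast
  next
    case (2 a)
    then show ?thesis using A_outside[OF 2(1) that] that by (simp add: \<tau>_def ext_def)
  qed
qed

lemma tau_G: "\<tau> \<in> G"
  using A_id unfolding G_def by (metis UnI2 id_comp image_eqI)

lemma A_fixed_K: "x \<in> R \<Longrightarrow> (\<And>a. a \<in> A \<Longrightarrow> a x = x) \<Longrightarrow> x \<in> K"
proof -
  assume x: "x \<in> R" and fx: "\<And>a. a \<in> A \<Longrightarrow> a x = x"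
  have "\<sigma> x = x" if "\<sigma> \<in> Gal" for \<sigma> using fx[of "ext \<sigma>"] x that by (simp add: A_def ext_def)
  then show ?thesis using fixed_K R_L[OF x] by blast
qed

lemma K_fixed_A: "x \<in> K \<Longrightarrow> a \<in> A \<Longrightarrow> a x = x"
  by (auto simp: A_def ext_def galois_group_carrier)

lemma integer_action_G: "integer_action R G"
proof (intro integer_action.intro ring_action_G integer_action_axioms.intro)
  interpret ring_action R G by (rule ring_action_G)
  show "algebraic_int x" if "x \<in> R" for x using that by (simp add: R_def ints_def)
  show "x / of_nat n \<in> R" if "x \<in> R" "n > 0" "algebraic_int (x / of_nat n)" for x and n :: nat
    using subfield_divide[OF subfields(2) R_L[OF that(1)] is_subring_of_nat[OF subrings(2)]] that(3)
    by (simp add: R_def ints_def)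
  show "fixed \<subseteq> \<int>"
  proof
    fix x assume x: "x \<in> fixed"
    then have xR: "x \<in> R" and fx: "\<And>g. g \<in> G \<Longrightarrow> g x = x" by (auto simp: fixed_def)
    have "x \<in> K" using fx by (intro A_fixed_K[OF xR]) (simp add: G_def)
    then obtain a b where ab: "a \<in> \<rat>" "b \<in> \<rat>" "x = a + b * \<omega>" using K_elem by blast
    have "cnj x = x" using fx[OF tau_G] xR by (simp add: \<tau>_def ext_def)
    then have "b * \<omega> = - (b * \<omega>)" using ab by (simp add: cnj_Rats omega_cnj)
    then have "b * \<omega> = 0" by auto
    then have "x \<in> \<rat>" unfolding ab(3) using ab(1) by (simp only: add_0_right)
    then show "x \<in> \<int>"
      using xR by (intro rational_algebraic_int_is_int) (simp_all add: R_def ints_def)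
  qed
qed

lemma algebraic_int_half: "N mod 4 = 3 \<Longrightarrow> algebraic_int ((1 + \<omega>) / 2)"
proof -
  assume "N mod 4 = 3"
  then obtain m where m: "N + 1 = 4 * m" by (metis Suc_eq_plus1 dvdE mod_Suc numeral_3_eq_3 mod_eq_0_iff_dvd numeral_eq_Suc pred_numeral_simps(2) semiring_norm(26) semiring_norm(27))
  have Nm: "of_nat N = (4 * of_nat m - 1 :: complex)"
    using arg_cong[OF m, of "of_nat :: nat \<Rightarrow> complex"] by (simp add: algebra_simps)
  have "poly [:of_nat m, -1, 1:] ((1 + \<omega>) / 2) = (4 * of_nat m - 1 + \<omega>\<^sup>2) / 4"
    by (simp add: field_simps power2_eq_square)
  also have "\<dots> = 0" unfolding omega_square Nm by simp
  finally have "poly [:of_nat m, -1, 1:] ((1 + \<omega>) / 2) = 0" .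
  moreover have "coeff [:of_nat m, -1, 1 :: complex:] i \<in> \<int>" for i
    by (auto simp: coeff_pCons split: nat.splits)
  ultimately show ?thesis by (intro algebraic_int.intros[of "[:of_nat m, -1, 1:]"]) auto
qed

lemma quadratic_integer:
  assumes x: "x \<in> R" "x \<in> K"
  shows "\<exists>b c :: int. 2 * x = of_int b + of_int c * \<omega> \<and> 4 dvd b\<^sup>2 + int N * c\<^sup>2"
proof -
  obtain a b where ab: "a \<in> \<rat>" "b \<in> \<rat>" "x = a + b * \<omega>" using K_elem[OF x(2)] by blast
  have c: "cnj x = a - b * \<omega>" using ab by (simp add: cnj_Rats omega_cnj)
  have xi: "algebraic_int x" "algebraic_int (cnj x)" using x by (auto simp: R_def ints_def)
  have trace: "x + cnj x = 2 * a" unfolding c unfolding ab(3) by simp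
  have "x * cnj x = a\<^sup>2 - \<omega>\<^sup>2 * b\<^sup>2"
    unfolding c unfolding ab(3) by (simp add: algebra_simps power2_eq_square)
  then have norm: "x * cnj x = a\<^sup>2 + of_nat N * b\<^sup>2" unfolding omega_square by simp
  have "2 * a \<in> \<int>"
    using algebraic_int_plus[OF xi] ab(1) unfolding trace by (intro rational_algebraic_int_is_int) auto
  then obtain s where s: "2 * a = of_int s" by (auto elim: Ints_cases)
  have "a\<^sup>2 + of_nat N * b\<^sup>2 \<in> \<int>"
    using algebraic_int_times[OF xi] ab(1,2) unfolding norm by (intro rational_algebraic_int_is_int) auto
  then obtain n where n: "a\<^sup>2 + of_nat N * b\<^sup>2 = of_int n" by (auto elim: Ints_cases)
  \<comment> \<open>Trace and norm make \<open>2 * a\<close> integral, but not directly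
    \<open>2 * b\<close>. The multiple \<open>y\<close> is integral because its square is an
    integer, and squarefreeness of \<open>N\<close> removes the factor \<open>N\<close>
    again.\<close>
  define y where "y = of_nat N * (2 * b)"
  have y2: "y\<^sup>2 = of_int (int N * (4 * n - s\<^sup>2))"
  proof -
    have "of_int (int N * (4 * n - s\<^sup>2)) = of_nat N * (4 * of_int n - (of_int s)\<^sup>2 :: complex)" by simp
    also have "\<dots> = y\<^sup>2" unfolding n[symmetric] s[symmetric] y_def
      by (simp add: algebra_simps power2_eq_square)
    finally show ?thesis by simp
  qed
  have "algebraic_int y" 
    by (rule algebraic_int_square_root) (simp only: y2 algebraic_int_of_int)
  then have "y \<in> \<int>" using ab(2) by (intro rational_algebraic_int_is_int) (auto simp: y_def)
  then obtain m where m: "y = of_int m" by (auto elim: Ints_cases)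
  have "of_int (m\<^sup>2) = (of_int (int N * (4 * n - s\<^sup>2)) :: complex)" using y2 unfolding m by simp
  then have m2: "m\<^sup>2 = int N * (4 * n - s\<^sup>2)" by (simp only: of_int_eq_iff)
  moreover have "squarefree (int N)"
  proof (rule squarefreeI)
    fix z assume "z\<^sup>2 dvd int N"
    then have "int ((nat \<bar>z\<bar>)\<^sup>2) dvd int N" by simp
    then have "(nat \<bar>z\<bar>)\<^sup>2 dvd N" by (simp only: int_dvd_int_iff)
    then have "nat \<bar>z\<bar> dvd 1" by (rule squarefreeD[OF N(2)])
    then show "z dvd 1" by (simp add: nat_eq_iff)
  qed
  ultimately have "int N dvd m" using squarefree_dvd_power2[of "int N" m] by simp
  then obtain t where t: "m = int N * t" by blast
  have "of_nat N * (2 * b) = of_nat N * of_int t" using m unfolding y_def t by simp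
  then have b: "2 * b = of_int t" using N(1) by simp
  have "int N * (int N * t\<^sup>2) = int N * (4 * n - s\<^sup>2)" using m2 unfolding t by (simp add: power2_eq_square mult_ac)
  then have "int N * t\<^sup>2 = 4 * n - s\<^sup>2" using N(1) by simp
  then have "s\<^sup>2 + int N * t\<^sup>2 = 4 * n" by simp
  moreover have "2 * x = of_int s + of_int t * \<omega>" unfolding ab(3) s[symmetric] b[symmetric] by (simp add: algebra_simps)
  ultimately show ?thesis by (intro exI[of _ s] exI[of _ t]) simp
qed

text \<open>If all elements of \<open>Q\<close> fixed by \<open>A\<close> were in its square, 2
  would be among the exponents whose maximum is the ramification index 1. The bound
  \<open>card G\<close> on these exponents, from \<open>of_int_in_ipow\<close>, ensures that the
  maximum is attained.\<close>

lemma unramified_prime: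
  assumes Q: "is_prime R Q" "prime q" "of_nat q \<in> Q"
  shows "\<exists>x\<in>Q. x \<notin> ipow R Q 2 \<and> (\<forall>a\<in>A. a x = x)"
proof (rule ccontr)
  assume no: "\<not> ?thesis"
  interpret integer_action R G by (rule integer_action_G)
  let ?S = "\<lambda>e. Q \<inter> ints K \<subseteq> ipow R Q e"
  have q: "q > 1" using prime_gt_1_nat[OF Q(2)] .
  have "Q \<noteq> {0}" using Q(3) q by auto
  then have "(GREATEST e. ?S e) = 1"
    using unramified_L Q(1) unfolding unramified_extension_iff[OF subrings(2)] R_def by blast
  moreover have "2 \<le> (GREATEST e. ?S e)"
  proof (rule Greatest_le_nat)
    show "?S 2" using no K_fixed_A by (auto simp: ints_def)
    show "e \<le> card G" if "?S e" for e
    proof -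
      have "of_nat q \<in> ints K" using is_subring_of_nat[OF is_subring_ints[OF subrings(1)]] .
      then have "of_int (int q) \<in> ipow R Q e" using that Q(3) by auto
      then have "int q ^ e dvd int q ^ card G" by (rule of_int_in_ipow[OF Q])
      then have "q ^ e dvd q ^ card G" by (metis int_dvd_int_iff of_nat_power)
      then show ?thesis using q by (rule power_dvd_imp_le)
    qed
  qed
  ultimately show False by simp
qed

lemma quadratic_setting: "quadratic_setting R G A \<tau> N \<omega>"
proof (intro quadratic_setting.intro integer_action_G quadratic_setting_axioms.intro)
  have omega_int: "algebraic_int \<omega>"
    by (rule algebraic_int_square_root) (simp add: omega_square)
  show "\<omega> \<in> R" using omega_int omega_K K_subset by (auto simp: R_def ints_def)
  show "A \<subseteq> G" by (auto simp: G_def)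
  show "\<tau> x = cnj x" if "x \<in> R" for x using that by (simp add: \<tau>_def ext_def)
  show "g \<in> A \<or> g \<circ> \<tau> \<in> A" if "g \<in> G" for g
    using that
  proof (cases rule: G_cases)
    case (2 a)
    then show ?thesis using tau_tau by (simp add: comp_assoc)
  qed simp
  show "(1 + \<omega>) / 2 \<in> R" if "N mod 4 = 3"
  proof -
    have "\<omega> \<in> L" using omega_K K_subset by blast
    then have "1 + \<omega> \<in> L" by (intro is_subringD(4)[OF subrings(2) is_subringD(2)[OF subrings(2)]])
    then have "(1 + \<omega>) / of_nat 2 \<in> L" by (rule subfield_divide[OF subfields(2) _ is_subring_of_nat[OF subrings(2)]])
    then show ?thesis using algebraic_int_half[OF that] by (simp add: R_def ints_def)
  qed
  show "\<exists>b c :: int. 2 * x = of_int b + of_int c * \<omega> \<and> 4 dvd b\<^sup>2 + int N * c\<^sup>2"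
    if "x \<in> R" "\<And>a. a \<in> A \<Longrightarrow> a x = x" for x
    by (rule quadratic_integer[OF that(1)], rule A_fixed_K[OF that(1)], rule that(2))
qed (fact A_id A_comp A_inverse A_commute tau_G tau_A_tau omega_square K_fixed_A[OF omega_K] N unramified_prime)+

lemma degree_1_prime:
  assumes p: "prime p" "odd p" "Legendre (- int N) (int p) = -1"
    and q: "\<And>q. prime q \<Longrightarrow> odd q \<Longrightarrow> q dvd N \<Longrightarrow> Legendre (- int p) (int q) = 1"
  shows "\<exists>P. primeideal P (integer_ring (L \<inter> \<real>)) \<and>
     prime_below \<rat> P = PIdl\<^bsub>integer_ring \<rat>\<^esub> (of_nat p) \<and> residue_degree \<rat> (L \<inter> \<real>) P = 1"
proof -
  interpret quadratic_setting R G A \<tau> N \<omega> by (rule quadratic_setting)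
  have "p > 2" using prime_ge_2_nat[OF p(1)] p(2) by (cases "p = 2") auto
  obtain P where P: "is_prime R P" "of_nat p \<in> P" "\<And>x. x \<in> R \<Longrightarrow> x ^ p - cnj x \<in> P"
    using frobenius_conjugate[OF p(1) \<open>p > 2\<close> p(3) q] by blast
  define L0 where "L0 = L \<inter> \<real>"
  have L0: "subfield L0 CC"
    using subfields(2) unfolding subfield_CC_iff is_subring_def L0_def by auto
  then have sr: "is_subring L0" by (simp add: subfield_CC_iff)
  define P0 where "P0 = P \<inter> ints L0"
  have sub: "ints L0 \<subseteq> R" by (auto simp: L0_def R_def ints_def)
  have P0: "is_prime (ints L0) P0"
  proof -
    note S = is_subringD[OF is_subring_ints[OF sr]] and id = is_idealD[OF is_prime_ideal[OF P(1)]]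
    have "is_ideal (ints L0) P0"
      unfolding is_ideal_def P0_def using S(1,4,5) id(2,3) id(4)[OF subsetD[OF sub]] by simp
    moreover have "1 \<notin> P0" using P(1) by (simp add: is_prime_def P0_def)
    moreover have "x \<in> P0 \<or> y \<in> P0" if xy: "x \<in> ints L0" "y \<in> ints L0" "x * y \<in> P0" for x y
      using P(1) subsetD[OF sub xy(1)] subsetD[OF sub xy(2)] xy by (simp add: is_prime_def P0_def)
    ultimately show ?thesis unfolding is_prime_def by simp
  qed
  have p0: "of_nat p \<in> P0" using P(2) is_subring_of_nat[OF is_subring_ints[OF sr]] by (simp add: P0_def)
  have "x ^ p - x \<in> P0" if x: "x \<in> ints L0" for x
  proof -
    have "cnj x = x" using x by (auto simp: L0_def ints_def Reals_cnj_iff)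
    then have "x ^ p - x \<in> P" using P(3)[of x] x sub by auto
    moreover have "x ^ p - x \<in> ints L0"
      using x by (intro is_subringD(6)[OF is_subring_ints[OF sr]] is_subring_power[OF is_subring_ints[OF sr]])
    ultimately show ?thesis by (simp add: P0_def)
  qed
  then show ?thesis
    using primeideal_integer_ring_iff[OF sr] P0 prime_below_Rats[OF L0 P0 p(1) p0]
      residue_degree_1[OF L0 P0 p(1) p0] unfolding L0_def by blast
qed

end

theorem theorem2:
  fixes N p :: nat and K \<Sigma> \<Sigma>\<^sub>0 :: "complex set"
  assumes "N > 0" and "squarefree N"
    and "K = generate_field CC {csqrt (- of_nat N)}"
    and "is_hilbert_class_field K \<Sigma>"
    and "\<Sigma>\<^sub>0 = \<Sigma> \<inter> \<real>"
    and "Factorial_Ring.prime p" and "odd p"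
    and "Legendre (- int N) (int p) = -1"
    and "\<And>q :: nat. Factorial_Ring.prime q \<Longrightarrow> odd q \<Longrightarrow> q dvd N \<Longrightarrow> Legendre (- int p) (int q) = 1"
  shows "\<exists>P. primeideal P (integer_ring \<Sigma>\<^sub>0) \<and>
             prime_below \<rat> P = PIdl\<^bsub>integer_ring \<rat>\<^esub> (of_nat p) \<and>
             residue_degree \<rat> \<Sigma>\<^sub>0 P = 1"
proof -
  interpret class_field_setting N K \<Sigma> "csqrt (- of_nat N)"
    using assms(1-4) by unfold_locales simp_all
  show ?thesis unfolding assms(5) by (rule degree_1_prime[OF assms(6-9)])
qed

end
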